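(* Consider the setting of the modular convex Nash equilibrium problem (the spaces $\mathcal{H}_i,\mathcal{G}_k,\boldsymbol{\mathcal{H}},\boldsymbol{\mathcal{G}}$, the functions $\varphi_i,\boldsymbol{f}_i,g_k$, and the operators $\boldsymbol{L}_k,\boldsymbol{G}$, with assumptions [a]–[c]) described in the context. For every $i\in I$, set $\Pi_i\colon\boldsymbol{\mathcal{H}}\to\mathcal{H}_i\colon\boldsymbol{x}\mapsto x_i$. Let $(\chi_i)_{i\in I}$ be a family in $[0,+\infty[$ such that $$(\forall\boldsymbol{x}\in\boldsymbol{\mathcal{H}})(\forall\boldsymbol{y}\in\boldsymbol{\mathcal{H}})\quad\langle\boldsymbol{x}-\boldsymbol{y}\mid\boldsymbol{G}\boldsymbol{x}-\boldsymbol{G}\boldsymbol{y}\rangle\leq\sum_{i\in I}\chi_i\|x_i-y_i\|^2,$$ let $\alpha\in\,]0,+\infty[$ and $\varepsilon\in\,]0,1[$ be such that $1/\varepsilon>\alpha+\max_{i\in I}\chi_i$, let $(\lambda_n)_{n\in\mathbb{N}}$ be in $[\varepsilon,2-\varepsilon]$, and let $D\in\mathbb{N}$. Suppose that the following are satisfied: (a) There exists $(\overline{\boldsymbol{x}},\overline{\boldsymbol{v}}^* )\in\boldsymbol{\mathcal{H}}\oplus\boldsymbol{\mathcal{G}}$ such that $$\begin{cases}(\forall i\in I)\;\;-\nabla_i\boldsymbol{f}_i(\overline{\boldsymbol{x}})-\sum_{k\in K}\Pi_i(\boldsymbol{L}_k^*\overline{v}_k^* )\in\partial\varphi_i(\overline{x}_i)\\(\forall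 k\in K)\;\;\boldsymbol{L}_k\overline{\boldsymbol{x}}\in\partial g_k^*(\overline{v}_k^* ).\end{cases}$$ (b) For every $i\in I$, $x_{i,0}\in\mathcal{H}_i$ and, for every $n\in\mathbb{N}$, $\gamma_{i,n}\in[\varepsilon,1/(\chi_i+\alpha)]$ and $c_i(n)\in\mathbb{N}$ satisfies $n-D\leq c_i(n)\leq n$. (c) For every $k\in K$, $v_{k,0}^*\in\mathcal{G}_k$ and, for every $n\in\mathbb{N}$, $\mu_{k,n}\in[\alpha,1/\varepsilon]$ and $d_k(n)\in\mathbb{N}$ satisfies $n-D\leq d_k(n)\leq n$. (d) $(I_n)_{n\in\mathbb{N}}$ are nonempty subsets of $I$ and $(K_n)_{n\in\mathbb{N}}$ are nonempty subsets of $K$ such that $I_0=I$, $K_0=K$, and there exists $m\in\mathbb{N}$ such that, for every $n\in\mathbb{N}$, $\bigcup_{j=n}^{n+m}I_j=I$ and $\bigcup_{j=n}^{n+m}K_j=K$. Set $\boldsymbol{L}\colon\boldsymbol{\mathcal{H}}\to\boldsymbol{\mathcal{G}}\colon\boldsymbol{x}\mapsto(\boldsymbol{L}_k\boldsymbol{x})_{k\in K}$. For $n=0,1,\ldots$ iterate the following steps. 1. For every $i\in I_n$: $$x_{i,n}^*=x_{i,c_i(n)}-\gamma_{i,c_i(n)}\Big(\nabla_i\boldsymbol{f}_i(\boldsymbol{x}_{c_i(n)})+\sum_{k\in K}\Pi_i\big(\boldsymbol{L}_k^*v_{k,c_i(n)}^*\big)\Big),\quad a_{i,n}=\operatorname{prox}_{\gamma_{i,c_i(n)}\varphi_i}x_{i,n}^*,\quad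 a_{i,n}^*=\gamma_{i,c_i(n)}^{-1}(x_{i,n}^*-a_{i,n}).$$ 2. For every $i\in I\smallsetminus I_n$: $(a_{i,n},a_{i,n}^* )=(a_{i,n-1},a_{i,n-1}^* )$. 3. For every $k\in K_n$: $$y_{k,n}^*=\mu_{k,d_k(n)}v_{k,d_k(n)}^*+\boldsymbol{L}_k\boldsymbol{x}_{d_k(n)},\quad b_{k,n}=\operatorname{prox}_{\mu_{k,d_k(n)}g_k}y_{k,n}^*,\quad b_{k,n}^*=\mu_{k,d_k(n)}^{-1}(y_{k,n}^*-b_{k,n}).$$ 4. For every $k\in K\smallsetminus K_n$: $(b_{k,n},b_{k,n}^* )=(b_{k,n-1},b_{k,n-1}^* )$. 5. Set $$\boldsymbol{t}_n^*=\boldsymbol{a}_n^*+\boldsymbol{G}\boldsymbol{a}_n+\boldsymbol{L}^*\boldsymbol{b}_n^*,\quad\boldsymbol{t}_n=\boldsymbol{b}_n-\boldsymbol{L}\boldsymbol{a}_n,\quad\pi_n=\langle\boldsymbol{a}_n-\boldsymbol{x}_n\mid\boldsymbol{t}_n^*\rangle+\langle\boldsymbol{t}_n\mid\boldsymbol{b}_n^*-\boldsymbol{v}_n^*\rangle.$$ 6. If $\pi_n<0$, set $\alpha_n=\lambda_n\pi_n/(\|\boldsymbol{t}_n\|^2+\|\boldsymbol{t}_n^*\|^2)$, $\boldsymbol{x}_{n+1}=\boldsymbol{x}_n+\alpha_n\boldsymbol{t}_n^*$, and $\boldsymbol{v}_{n+1}^*=\boldsymbol{v}_n^*+\alpha_n\boldsymbol{t}_n$.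 Otherwise, set $(\boldsymbol{x}_{n+1},\boldsymbol{v}_{n+1}^* )=(\boldsymbol{x}_n,\boldsymbol{v}_n^* )$. Then $(\boldsymbol{x}_n)_{n\in\mathbb{N}}$ converges weakly to a solution to the modular convex Nash equilibrium problem, that is, to a point $\boldsymbol{x}\in\boldsymbol{\mathcal{H}}$ such that $$(\forall i\in I)\quad x_i\in\operatorname{Argmin}\Big(\varphi_i+\boldsymbol{f}_i(\,\cdot\,;\boldsymbol{x}_{\smallsetminus i})+\sum_{k\in K}(g_k\circ\boldsymbol{L}_k)(\,\cdot\,;\boldsymbol{x}_{\smallsetminus i})\Big).$$
   Context: **Setting (modular convex Nash equilibrium problem).** Let $I=\{1,\ldots,p\}$ and let $K$ be a finite set. Let $(\mathcal{H}_i)_{i\in I}$ and $(\mathcal{G}_k)_{k\in K}$ be finite families of real Hilbert spaces, and let $\boldsymbol{\mathcal{H}}=\bigoplus_{i\in I}\mathcal{H}_i$ and $\boldsymbol{\mathcal{G}}=\bigoplus_{k\in K}\mathcal{G}_k$ be their Hilbert direct sums. Generic elements are written $\boldsymbol{x}=(x_i)_{i\in I}\in\boldsymbol{\mathcal{H}}$ and $\boldsymbol{v}^*=(v_k^* )_{k\in K}\in\boldsymbol{\mathcal{G}}$. For $i\in I$ and $\boldsymbol{x}\in\boldsymbol{\mathcal{H}}$, $\boldsymbol{x}_{\smallsetminus i}=(x_j)_{j\in I\smallsetminus\{i\}}$; for $x_i\in\mathcal{H}_i$ and $\boldsymbol{y}\in\boldsymbol{\mathcal{H}}$, $(x_i;\boldsymbol{y}_{\smallsetminus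 i})=(y_1,\ldots,y_{i-1},x_i,y_{i+1},\ldots,y_p)$. For a function $\boldsymbol{h}$ on $\boldsymbol{\mathcal{H}}$, $\boldsymbol{h}(\,\cdot\,;\boldsymbol{x}_{\smallsetminus i})$ is the function $x_i'\mapsto\boldsymbol{h}(x_i';\boldsymbol{x}_{\smallsetminus i})$ on $\mathcal{H}_i$. $\Gamma_0(\mathcal{H})$ denotes the class of lower semicontinuous convex functions $\varphi\colon\mathcal{H}\to\,]-\infty,+\infty]$ on a real Hilbert space $\mathcal{H}$ which are proper, i.e., $\operatorname{dom}\varphi=\{x\in\mathcal{H}\mid\varphi(x)<+\infty\}\neq\varnothing$. The following are assumed: - [a] For every $i\in I$, $\varphi_i\in\Gamma_0(\mathcal{H}_i)$. - [b] For every $i\in I$, $\boldsymbol{f}_i\colon\boldsymbol{\mathcal{H}}\to\mathbb{R}$ is such that, for every $\boldsymbol{x}\in\boldsymbol{\mathcal{H}}$, $\boldsymbol{f}_i(\,\cdot\,;\boldsymbol{x}_{\smallsetminus i})\colon\mathcal{H}_i\to\mathbb{R}$ is convex and differentiable, and its gradient at $x_i$ is denoted by $\nabla_i\boldsymbol{f}_i(\boldsymbol{x})$. Further, the operator $\boldsymbol{G}\colon\boldsymbol{\mathcal{H}}\to\boldsymbol{\mathcal{H}}\colon\boldsymbol{x}\mapsto(\nabla_i\boldsymbol{f}_i(\boldsymbol{x}))_{i\in I}$ is monotone and Lipschitzian. - [c] For every $k\in K$, $g_k\in\Gamma_0(\mathcal{G}_k)$ and $\boldsymbol{L}_k\colon\boldsymbol{\mathcal{H}}\to\mathcal{G}_k$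 is linear and bounded. The problem is to find $\boldsymbol{x}\in\boldsymbol{\mathcal{H}}$ such that, for every $i\in I$, $x_i\in\operatorname{Argmin}\big(\varphi_i+\boldsymbol{f}_i(\,\cdot\,;\boldsymbol{x}_{\smallsetminus i})+\sum_{k\in K}(g_k\circ\boldsymbol{L}_k)(\,\cdot\,;\boldsymbol{x}_{\smallsetminus i})\big)$, where $\operatorname{Argmin}$ is the set of global minimizers over $\mathcal{H}_i$. **Further notation.** For $\varphi\in\Gamma_0(\mathcal{H})$: $\partial\varphi(x)=\{x^*\in\mathcal{H}\mid(\forall y\in\mathcal{H})\ \langle y-x\mid x^*\rangle+\varphi(x)\leq\varphi(y)\}$ is the subdifferential, $\varphi^*$ is the Fenchel conjugate, and $\operatorname{prox}_\varphi x$ is the unique minimizer of $\varphi+\frac12\|\cdot-x\|^2$. $\boldsymbol{L}_k^*$ and $\boldsymbol{L}^*$ denote adjoints of bounded linear operators, so $\boldsymbol{L}^*\boldsymbol{v}^*=\sum_{k\in K}\boldsymbol{L}_k^*v_k^*$. In the algorithm, boldface letters collect components: $\boldsymbol{x}_n=(x_{i,n})_{i\in I}$, $\boldsymbol{a}_n=(a_{i,n})_{i\in I}$, $\boldsymbol{a}_n^*=(a_{i,n}^* )_{i\in I}$, $\boldsymbol{b}_n=(b_{k,n})_{k\in K}$, $\boldsymbol{b}_n^*=(b_{k,n}^* )_{k\in K}$, $\boldsymbol{v}_n^*=(v_{k,n}^* )_{k\in K}$. *)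

theory Defs
  imports "HOL-Analysis.Analysis"
begin

text \<open>
  A finite family of (different) real Hilbert spaces is represented by a family of closed linear
  subspaces \<open>S i\<close> of one complete real inner product space; any finite family of Hilbert spaces is
  of this form, up to isometry, inside its direct sum.  The Hilbert direct sum of the family is then
  the closed subspace \<open>direct_sum S\<close> of \<open>'a ^ 'i\<close>, whose inner product is the sum of the
  componentwise inner products.  A function on a Hilbert space is a total function of which only
  the values on the corresponding subspace are ever used; hence every notion below is relative to
  a carrier \<open>S\<close>.
\<close>

definition direct_sum :: "('i \<Rightarrow> 'a set) \<Rightarrow> ('a ^ 'i::finite) set" where
  "direct_sum S = {x. \<forall>i. x $ i \<in> S i}"

text \<open>The point \<open>(z; x\<^sub>-\<^sub>i)\<close>: the \<open>i\<close>-th component of \<open>x\<close> is replaced by \<open>z\<close>.\<close>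

definition replace :: "'i \<Rightarrow> 'a \<Rightarrow> 'a ^ 'i \<Rightarrow> 'a ^ 'i::finite" where
  "replace i z x = (\<chi> j. if j = i then z else x $ j)"

definition Gamma0 :: "'a::real_inner set \<Rightarrow> ('a \<Rightarrow> ereal) set" where
  "Gamma0 S = {\<phi>.
     (\<forall>x\<in>S. \<phi> x \<noteq> -\<infinity>) \<and>
     (\<exists>x\<in>S. \<phi> x < \<infinity>) \<and>
     (\<forall>x\<in>S. \<forall>y\<in>S. \<forall>u\<ge>0. \<forall>v\<ge>0. u + v = 1 \<longrightarrow>
        \<phi> (u *\<^sub>R x + v *\<^sub>R y) \<le> ereal u * \<phi> x + ereal v * \<phi> y) \<and>
     (\<forall>x\<in>S. \<phi> x \<le> Liminf (at x within S) \<phi>)}"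

definition Argmin :: "'a set \<Rightarrow> ('a \<Rightarrow> ereal) \<Rightarrow> 'a set" where
  "Argmin S h = {x. is_arg_min h (\<lambda>z. z \<in> S) x}"

definition subdifferential :: "'a::real_inner set \<Rightarrow> ('a \<Rightarrow> ereal) \<Rightarrow> 'a \<Rightarrow> 'a set" where
  "subdifferential S \<phi> x = {u \<in> S. \<forall>y\<in>S. ereal ((y - x) \<bullet> u) + \<phi> x \<le> \<phi> y}"

definition fenchel_conjugate :: "'a::real_inner set \<Rightarrow> ('a \<Rightarrow> ereal) \<Rightarrow> 'a \<Rightarrow> ereal" where
  "fenchel_conjugate S \<phi> u = (SUP x\<in>S. ereal (x \<bullet> u) - \<phi> x)"

definition prox :: "'a::real_inner set \<Rightarrow> ('a \<Rightarrow> ereal) \<Rightarrow> 'a \<Rightarrow> 'a" where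
  "prox S \<phi> x = (THE p. p \<in> Argmin S (\<lambda>z. \<phi> z + ereal (1/2 * (norm (z - x))\<^sup>2)))"

definition bounded_linear_between ::
    "'a::real_normed_vector set \<Rightarrow> 'b::real_normed_vector set \<Rightarrow> ('a \<Rightarrow> 'b) \<Rightarrow> bool" where
  "bounded_linear_between S T A \<longleftrightarrow>
     (\<forall>x\<in>S. A x \<in> T) \<and>
     (\<forall>x\<in>S. \<forall>y\<in>S. A (x + y) = A x + A y) \<and>
     (\<forall>x\<in>S. \<forall>r. A (r *\<^sub>R x) = r *\<^sub>R A x) \<and>
     (\<exists>B. \<forall>x\<in>S. norm (A x) \<le> B * norm x)"

text \<open>The adjoint, mapping the codomain \<open>T\<close> to \<open>S\<close>, of a bounded linear operator from \<open>S\<close> to \<open>T\<close>.\<close>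

definition adjoint_on :: "'a::real_inner set \<Rightarrow> ('a \<Rightarrow> 'b::real_inner) \<Rightarrow> 'b \<Rightarrow> 'a" where
  "adjoint_on S A v = (THE w. w \<in> S \<and> (\<forall>x\<in>S. A x \<bullet> v = x \<bullet> w))"

text \<open>
  The gradient of \<open>h : S \<rightarrow> \<real>\<close>: requiring \<open>g \<in> S\<close> makes it unique, since the derivative within a
  linear subspace is determined only along that subspace.
\<close>

definition gradient_on :: "'a::real_inner set \<Rightarrow> ('a \<Rightarrow> real) \<Rightarrow> 'a \<Rightarrow> 'a" where
  "gradient_on S h x = (THE g. g \<in> S \<and> (h has_derivative (\<lambda>d. d \<bullet> g)) (at x within S))"

definition partial_gradient ::
    "('i \<Rightarrow> 'a::real_inner set) \<Rightarrow> ('i \<Rightarrow> 'a ^ 'i \<Rightarrow> real) \<Rightarrow> 'i \<Rightarrow> 'a ^ 'i::finite \<Rightarrow> 'a" where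
  "partial_gradient \<H> f i x = gradient_on (\<H> i) (\<lambda>z. f i (replace i z x)) (x $ i)"

definition gradient_operator ::
    "('i \<Rightarrow> 'a::real_inner set) \<Rightarrow> ('i \<Rightarrow> 'a ^ 'i \<Rightarrow> real) \<Rightarrow> 'a ^ 'i \<Rightarrow> 'a ^ 'i::finite" where
  "gradient_operator \<H> f x = (\<chi> i. partial_gradient \<H> f i x)"

definition monotone_operator_on :: "'a::real_inner set \<Rightarrow> ('a \<Rightarrow> 'a) \<Rightarrow> bool" where
  "monotone_operator_on S A \<longleftrightarrow> (\<forall>x\<in>S. \<forall>y\<in>S. 0 \<le> (x - y) \<bullet> (A x - A y))"

definition nash_solution ::
    "('i \<Rightarrow> 'a set) \<Rightarrow> ('i \<Rightarrow> 'a \<Rightarrow> ereal) \<Rightarrow> ('i \<Rightarrow> 'a ^ 'i \<Rightarrow> real) \<Rightarrow>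
     ('k::finite \<Rightarrow> 'b \<Rightarrow> ereal) \<Rightarrow> ('k \<Rightarrow> 'a ^ 'i \<Rightarrow> 'b) \<Rightarrow> 'a ^ 'i::finite \<Rightarrow> bool" where
  "nash_solution \<H> \<phi> f g L x \<longleftrightarrow> x \<in> direct_sum \<H> \<and>
     (\<forall>i. x $ i \<in> Argmin (\<H> i)
        (\<lambda>z. \<phi> i z + ereal (f i (replace i z x)) + (\<Sum>k\<in>UNIV. g k (L k (replace i z x)))))"

definition weakly_converges_on :: "'a::real_inner set \<Rightarrow> (nat \<Rightarrow> 'a) \<Rightarrow> 'a \<Rightarrow> bool" where
  "weakly_converges_on S X l \<longleftrightarrow> (\<forall>u\<in>S. (\<lambda>n. X n \<bullet> u) \<longlonglongrightarrow> l \<bullet> u)"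

end

theory Submission
  imports Defs "HOL-Complex_Analysis.Great_Picard"
begin

text \<open>
  The iteration is an outer approximation method for the set of Kuhn--Tucker points, that is, pairs \<open>(x, v)\<close> with
  \<open>-G x - L\<^sup>* v \<in> \<partial>\<phi> x\<close> and \<open>v \<in> \<partial>g (L x)\<close>, where \<open>\<phi>\<close> and \<open>g\<close> denote the separable sums of the \<open>\<phi>\<^sub>i\<close> and of the \<open>g\<^sub>k\<close>.  The
  primal component of such a pair is an equilibrium (\<open>KT_nash\<close>).  The proximal steps produce a point
  \<open>((a\<^sub>n, b\<^sup>*\<^sub>n), (t\<^sup>*\<^sub>n, t\<^sub>n))\<close> of the graph of the associated monotone operator, whatever the delays and the selection
  of blocks.  By monotonicity this point defines a half-space that contains all Kuhn--Tucker points (\<open>KT_halfspace\<close>), and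
  \<open>\<pi>\<^sub>n < 0\<close> says that the current iterate \<open>(x\<^sub>n, v\<^sup>*\<^sub>n)\<close> lies outside it.  The last step is the relaxed projection onto this half-space,
  so the iterates are Fejer monotone with respect to the Kuhn--Tucker set, successive iterates merge, and the
  negative part of \<open>\<pi>\<^sub>n\<close> vanishes (\<open>relaxed_projection_step\<close>, \<open>Fejer_sequence_converges\<close>).

  Since the delays and the idle periods of the blocks are bounded, the updates differ from those computed at the current
  iterate by a null error, and the choice of parameters bounds \<open>\<alpha> \<parallel>a\<^sub>n - x\<^sub>n\<parallel>\<^sup>2 + \<epsilon> \<parallel>b\<^sub>n - L x\<^sub>n\<parallel>\<^sup>2\<close> by the negative part of \<open>\<pi>\<^sub>n\<close> plus a null sequence
  (\<open>gap_estimate\<close>).  Hence \<open>a\<^sub>n - x\<^sub>n\<close>, \<open>b\<^sup>*\<^sub>n - v\<^sup>*\<^sub>n\<close>, \<open>t\<^sub>n\<close> and \<open>t\<^sup>*\<^sub>n\<close> tend to zero.  The graph of the operator is closed under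
  weak convergence with null residuals (\<open>KT_demiclosed\<close>), so every weak cluster point of the iterates is a
  Kuhn--Tucker point, and \<open>Opial\<close> gives weak convergence of the whole sequence.

  The Hilbert space theory rests on one construction: the proximal point of a function in \<^const>\<open>Gamma0\<close> exists by
  a Cauchy sequence argument (\<open>Argmin_prox_exists\<close>).  From it follow the Riesz representation on closed subspaces, hence
  adjoints, gradients and weak sequential compactness, as well as weak lower semicontinuity of convex functions and the
  inversion of conjugate subgradients.
\<close>

section \<open>Proper lower semicontinuous convex functions\<close>

text \<open>
  Lower semicontinuity is stated with a \<open>Liminf\<close> along a punctured neighbourhood.  This lemma and the
  next one translate between it and the \<open>\<delta>\<close>-form, in which the centre is included; sums, compositions and
  limits along sequences are handled in that form.
\<close>

lemma Gamma0_lower_bound: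
  assumes "\<phi> \<in> Gamma0 S" "x \<in> S" "ereal C < \<phi> x"
  shows "\<exists>\<delta>>0. \<forall>y\<in>S. dist y x < \<delta> \<longrightarrow> ereal C < \<phi> y"
proof -
  have "ereal C < Liminf (at x within S) \<phi>"
    using assms by (auto simp: Gamma0_def intro: less_le_trans)
  then have "\<forall>\<^sub>F y in at x within S. ereal C < \<phi> y"
    by (rule less_LiminfD)
  then obtain \<delta> where "\<delta> > 0" "\<forall>y\<in>S. y \<noteq> x \<and> dist y x < \<delta> \<longrightarrow> ereal C < \<phi> y"
    unfolding eventually_at by auto
  then show ?thesis using assms(3) by metis
qed

lemma Gamma0I:
  assumes notMInf: "\<And>x. x \<in> S \<Longrightarrow> \<phi> x \<noteq> -\<infinity>"
    and proper: "z \<in> S" "\<phi> z < \<infinity>"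
    and conv: "\<And>x y u v. x \<in> S \<Longrightarrow> y \<in> S \<Longrightarrow> 0 \<le> u \<Longrightarrow> 0 \<le> v \<Longrightarrow> u + v = 1 \<Longrightarrow>
        \<phi> (u *\<^sub>R x + v *\<^sub>R y) \<le> ereal u * \<phi> x + ereal v * \<phi> y"
    and lsc: "\<And>x C. x \<in> S \<Longrightarrow> ereal C < \<phi> x \<Longrightarrow>
        \<exists>\<delta>>0. \<forall>y\<in>S. dist y x < \<delta> \<longrightarrow> ereal C < \<phi> y"
  shows "\<phi> \<in> Gamma0 S"
proof -
  have "\<phi> x \<le> Liminf (at x within S) \<phi>" if "x \<in> S" for x
    unfolding le_Liminf_iff
  proof (intro allI impI)
    fix y assume "y < \<phi> x"
    then obtain C where C: "y < ereal C" "ereal C < \<phi> x"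
      using ereal_dense2 by blast
    with lsc[OF that] obtain \<delta> where "\<delta> > 0" "\<forall>y\<in>S. dist y x < \<delta> \<longrightarrow> ereal C < \<phi> y" by blast
    then have "\<forall>\<^sub>F z in at x within S. ereal C < \<phi> z"
      unfolding eventually_at by blast
    then show "\<forall>\<^sub>F z in at x within S. y < \<phi> z"
      by eventually_elim (use C(1) in \<open>rule less_trans\<close>)
  qed
  then show ?thesis
    unfolding Gamma0_def using notMInf proper conv by blast
qed

lemma Gamma0_not_MInf: "\<phi> \<in> Gamma0 S \<Longrightarrow> x \<in> S \<Longrightarrow> \<phi> x \<noteq> -\<infinity>"
  by (auto simp: Gamma0_def)

lemma Gamma0_proper:
  assumes "\<phi> \<in> Gamma0 S"
  obtains x r where "x \<in> S" "\<phi> x = ereal r"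
proof -
  obtain x where "x \<in> S" "\<phi> x < \<infinity>" using assms by (auto simp: Gamma0_def)
  with Gamma0_not_MInf[OF assms] that show ?thesis by (cases "\<phi> x") auto
qed

lemma Gamma0_convex:
  assumes "\<phi> \<in> Gamma0 S" "x \<in> S" "y \<in> S" "0 \<le> u" "0 \<le> v" "u + v = 1"
  shows "\<phi> (u *\<^sub>R x + v *\<^sub>R y) \<le> ereal u * \<phi> x + ereal v * \<phi> y"
  using assms by (auto simp: Gamma0_def)

lemma Gamma0_sequential_bound:
  assumes "\<phi> \<in> Gamma0 S" "p \<in> S" "\<And>n. y n \<in> S" "y \<longlonglongrightarrow> p" "c \<longlonglongrightarrow> C"
    and "\<And>n. \<phi> (y n) \<le> ereal (c n)"
  shows "\<phi> p \<le> ereal C"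
proof (rule ccontr)
  assume "\<not> ?thesis"
  then have "ereal C < \<phi> p" by simp
  then obtain E where E: "ereal C < ereal E" "ereal E < \<phi> p"
    using ereal_dense2 by blast
  from Gamma0_lower_bound[OF assms(1,2) E(2)] obtain \<delta>
    where "\<delta> > 0" and \<delta>: "\<And>z. z \<in> S \<Longrightarrow> dist z p < \<delta> \<Longrightarrow> ereal E < \<phi> z" by blast
  have "\<forall>\<^sub>F n in sequentially. dist (y n) p < \<delta>"
    using assms(4) \<open>\<delta> > 0\<close> by (rule tendstoD)
  moreover have "\<forall>\<^sub>F n in sequentially. c n < E"
    using order_tendstoD(2)[OF assms(5)] E(1) by simp
  ultimately have "\<forall>\<^sub>F n in sequentially. False"
  proof eventually_elim
    case (elim n)
    have "ereal E < ereal (c n)" using \<delta>[OF assms(3) elim(1)] assms(6)[of n] by (rule less_le_trans)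
    with elim show ?case by simp
  qed
  then show False by simp
qed

text \<open>
  Near a point \<open>x0\<close> of the domain, lower semicontinuity bounds \<open>\<phi>\<close> below by \<open>\<phi> x0 - 1\<close>.  A far point \<open>y\<close> is
  joined to \<open>x0\<close> by a segment that meets this neighbourhood, and convexity on the segment turns the
  local bound into one that is linear in the distance.
\<close>

lemma Gamma0_minorant:
  assumes \<phi>: "\<phi> \<in> Gamma0 S" and S: "subspace S"
  obtains A B where "0 \<le> B" "\<And>y. y \<in> S \<Longrightarrow> ereal (- A - B * norm y) \<le> \<phi> y"
proof -
  obtain x0 r where x0: "x0 \<in> S" and r: "\<phi> x0 = ereal r" using Gamma0_proper[OF \<phi>] .
  have "ereal (r - 1) < \<phi> x0" by (simp add: r)
  from Gamma0_lower_bound[OF \<phi> x0 this] obtain \<delta> where "\<delta> > 0"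
    and \<delta>: "\<And>y. y \<in> S \<Longrightarrow> dist y x0 < \<delta> \<Longrightarrow> ereal (r - 1) < \<phi> y" by blast
  have key: "ereal (r - 1 - (2 / \<delta>) * norm (y - x0)) \<le> \<phi> y" if y: "y \<in> S" for y
  proof (cases "dist y x0 < \<delta>")
    case True
    have "ereal (r - 1 - (2 / \<delta>) * norm (y - x0)) \<le> ereal (r - 1)" using \<open>\<delta> > 0\<close> by simp
    also have "\<dots> \<le> \<phi> y" using \<delta>[OF y True] by simp
    finally show ?thesis .
  next
    case False
    define N where "N = norm (y - x0)"
    have N: "N \<ge> \<delta>" using False by (simp add: N_def dist_norm)
    \<comment> \<open>the step that puts \<open>w\<close> at distance \<open>\<delta> / 2\<close> from \<open>x0\<close>\<close>
    define s where "s = \<delta> / (2 * N)"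
    have s: "0 < s" "s < 1" using N \<open>\<delta> > 0\<close> by (auto simp: s_def field_simps)
    define w where "w = (1 - s) *\<^sub>R x0 + s *\<^sub>R y"
    have w: "w \<in> S" using S x0 y by (simp add: w_def subspace_add subspace_scale)
    have "w - x0 = s *\<^sub>R (y - x0)" by (simp add: w_def algebra_simps)
    then have "dist w x0 = s * N" using s by (simp add: dist_norm N_def)
    also have "\<dots> < \<delta>" using N \<open>\<delta> > 0\<close> by (simp add: s_def)
    finally have lw: "ereal (r - 1) < \<phi> w" using \<delta>[OF w] by blast
    have cw: "\<phi> w \<le> ereal (1 - s) * ereal r + ereal s * \<phi> y"
      using Gamma0_convex[OF \<phi> x0 y, of "1 - s" s] s by (simp add: w_def r)
    show ?thesis
    proof (cases "\<phi> y")
      case (real q)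
      have "r - 1 < (1 - s) * r + s * q" using less_le_trans[OF lw cw] by (simp add: real)
      then have "s * (r - q) < 1" by (simp add: algebra_simps)
      then have "r - q < 1 / s" using s by (simp add: field_simps)
      also have "1 / s = (2 / \<delta>) * N" by (simp add: s_def)
      finally show ?thesis by (simp add: real N_def)
    next
      case PInf then show ?thesis by simp
    next
      case MInf then show ?thesis using Gamma0_not_MInf[OF \<phi> y] by simp
    qed
  qed
  show ?thesis
  proof (rule that[of "2 / \<delta>" "1 - r + (2 / \<delta>) * norm x0"])
    show "0 \<le> 2 / \<delta>" using \<open>\<delta> > 0\<close> by simp
    fix y assume y: "y \<in> S"
    have "(2 / \<delta>) * norm (y - x0) \<le> (2 / \<delta>) * (norm y + norm x0)"
      using \<open>\<delta> > 0\<close> by (intro mult_left_mono norm_triangle_ineq4) simp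
    then have "ereal (- (1 - r + (2 / \<delta>) * norm x0) - (2 / \<delta>) * norm y)
        \<le> ereal (r - 1 - (2 / \<delta>) * norm (y - x0))"
      by (simp add: algebra_simps add_divide_distrib)
    also have "\<dots> \<le> \<phi> y" by (rule key[OF y])
    finally show "ereal (- (1 - r + (2 / \<delta>) * norm x0) - (2 / \<delta>) * norm y) \<le> \<phi> y" .
  qed
qed

lemma ereal_mult_not_MInf: "0 \<le> u \<Longrightarrow> a \<noteq> -\<infinity> \<Longrightarrow> ereal u * a \<noteq> -\<infinity>"
  by (cases a; cases "u = 0") auto

lemma ereal_mult_add_distrib:
  "0 \<le> u \<Longrightarrow> a \<noteq> -\<infinity> \<Longrightarrow> b \<noteq> -\<infinity> \<Longrightarrow> ereal u * (a + b) = ereal u * a + ereal u * b"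
  by (cases a; cases b; cases "u = 0") (auto simp: algebra_simps)

lemma Gamma0_scale:
  assumes \<phi>: "\<phi> \<in> Gamma0 S" and "0 < r"
  shows "(\<lambda>z. ereal r * \<phi> z) \<in> Gamma0 S"
proof -
  obtain z q where z: "z \<in> S" "\<phi> z = ereal q" using Gamma0_proper[OF \<phi>] .
  show ?thesis
  proof (rule Gamma0I)
    show "ereal r * \<phi> x \<noteq> -\<infinity>" if "x \<in> S" for x
      using Gamma0_not_MInf[OF \<phi> that] \<open>0 < r\<close> by (cases "\<phi> x") auto
    show "z \<in> S" "ereal r * \<phi> z < \<infinity>" using z by auto
    show "ereal r * \<phi> (u *\<^sub>R x + v *\<^sub>R y) \<le> ereal u * (ereal r * \<phi> x) + ereal v * (ereal r * \<phi> y)"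
      if "x \<in> S" "y \<in> S" "0 \<le> u" "0 \<le> v" "u + v = 1" for x y u v
    proof -
      have "ereal r * \<phi> (u *\<^sub>R x + v *\<^sub>R y) \<le> ereal r * (ereal u * \<phi> x + ereal v * \<phi> y)"
        using Gamma0_convex[OF \<phi> that] \<open>0 < r\<close> by (intro ereal_mult_left_mono) auto
      also have "\<dots> = ereal u * (ereal r * \<phi> x) + ereal v * (ereal r * \<phi> y)"
        using \<open>0 < r\<close> ereal_mult_add_distrib Gamma0_not_MInf[OF \<phi> that(1)]
          Gamma0_not_MInf[OF \<phi> that(2)] that by (simp add: ereal_mult_not_MInf mult.left_commute)
      finally show ?thesis .
    qed
    show "\<exists>\<delta>>0. \<forall>y\<in>S. dist y x < \<delta> \<longrightarrow> ereal C < ereal r * \<phi> y"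
      if "x \<in> S" "ereal C < ereal r * \<phi> x" for x C
    proof -
      have iff: "ereal C < ereal r * w \<longleftrightarrow> ereal (C / r) < w" for w
        using \<open>0 < r\<close> by (cases w) (auto simp: field_simps)
      show ?thesis using Gamma0_lower_bound[OF \<phi> that(1)] that(2) unfolding iff by blast
    qed
  qed
qed

lemma Gamma0_add:
  assumes \<phi>: "\<phi> \<in> Gamma0 S" and \<psi>: "\<psi> \<in> Gamma0 S" and z: "z \<in> S" "\<phi> z < \<infinity>" "\<psi> z < \<infinity>"
  shows "(\<lambda>x. \<phi> x + \<psi> x) \<in> Gamma0 S"
proof (rule Gamma0I[OF _ z(1)])
  show "\<phi> x + \<psi> x \<noteq> -\<infinity>" if "x \<in> S" for x
    using Gamma0_not_MInf[OF \<phi> that] Gamma0_not_MInf[OF \<psi> that]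
    by (cases "\<phi> x"; cases "\<psi> x") auto
  show "\<phi> z + \<psi> z < \<infinity>" using z by simp
  show "\<phi> (u *\<^sub>R x + v *\<^sub>R y) + \<psi> (u *\<^sub>R x + v *\<^sub>R y)
      \<le> ereal u * (\<phi> x + \<psi> x) + ereal v * (\<phi> y + \<psi> y)"
    if "x \<in> S" "y \<in> S" "0 \<le> u" "0 \<le> v" "u + v = 1" for x y u v
  proof -
    have "\<phi> (u *\<^sub>R x + v *\<^sub>R y) + \<psi> (u *\<^sub>R x + v *\<^sub>R y)
        \<le> (ereal u * \<phi> x + ereal v * \<phi> y) + (ereal u * \<psi> x + ereal v * \<psi> y)"
      by (intro add_mono Gamma0_convex[OF \<phi> that] Gamma0_convex[OF \<psi> that])
    also have "\<dots> = ereal u * (\<phi> x + \<psi> x) + ereal v * (\<phi> y + \<psi> y)"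
      using Gamma0_not_MInf[OF \<phi> that(1)] Gamma0_not_MInf[OF \<psi> that(1)]
        Gamma0_not_MInf[OF \<phi> that(2)] Gamma0_not_MInf[OF \<psi> that(2)] that
      by (simp add: ereal_mult_add_distrib ac_simps)
    finally show ?thesis .
  qed
  show "\<exists>\<delta>>0. \<forall>y\<in>S. dist y x < \<delta> \<longrightarrow> ereal C < \<phi> y + \<psi> y"
    if x: "x \<in> S" and C: "ereal C < \<phi> x + \<psi> x" for x C
  proof -
    obtain A B where AB: "ereal A < \<phi> x" "ereal B < \<psi> x" "C \<le> A + B"
    proof (cases "\<phi> x")
      case (real p)
      have "ereal (C - p) < \<psi> x" using C real by (cases "\<psi> x") auto
      then obtain B where B: "ereal (C - p) < ereal B" "ereal B < \<psi> x" using ereal_dense2 by blast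
      show ?thesis by (rule that[of "C - B" B]) (use B real in auto)
    next
      case PInf
      have "-\<infinity> < \<psi> x" using Gamma0_not_MInf[OF \<psi> x] by auto
      then obtain B where B: "ereal B < \<psi> x" using ereal_dense2 by blast
      show ?thesis by (rule that[of "C - B" B]) (use B PInf in auto)
    next
      case MInf then show ?thesis using Gamma0_not_MInf[OF \<phi> x] by simp
    qed
    from Gamma0_lower_bound[OF \<phi> x AB(1)] obtain \<delta>1 where \<delta>1: "\<delta>1 > 0"
      "\<And>y. y \<in> S \<Longrightarrow> dist y x < \<delta>1 \<Longrightarrow> ereal A < \<phi> y" by blast
    from Gamma0_lower_bound[OF \<psi> x AB(2)] obtain \<delta>2 where \<delta>2: "\<delta>2 > 0"
      "\<And>y. y \<in> S \<Longrightarrow> dist y x < \<delta>2 \<Longrightarrow> ereal B < \<psi> y" by blast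
    have "ereal C < \<phi> y + \<psi> y" if "y \<in> S" "dist y x < min \<delta>1 \<delta>2" for y
    proof -
      have "ereal C \<le> ereal A + ereal B" using AB by simp
      also have "\<dots> < \<phi> y + \<psi> y"
        using that \<delta>1(2)[of y] \<delta>2(2)[of y] by (intro ereal_add_strict_mono2) auto
      finally show ?thesis .
    qed
    then show ?thesis using \<delta>1(1) \<delta>2(1) by (intro exI[of _ "min \<delta>1 \<delta>2"]) auto
  qed
qed

lemma Gamma0_sum:
  assumes "finite I" "I \<noteq> {}" "\<And>i. i \<in> I \<Longrightarrow> \<phi> i \<in> Gamma0 S"
    and "z \<in> S" "\<And>i. i \<in> I \<Longrightarrow> \<phi> i z < \<infinity>"
  shows "(\<lambda>x. \<Sum>i\<in>I. \<phi> i x) \<in> Gamma0 S"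
  using assms
proof (induction I rule: finite_ne_induct)
  case (singleton i) then show ?case by simp
next
  case (insert i I)
  have "(\<lambda>x. \<phi> i x + (\<Sum>i\<in>I. \<phi> i x)) \<in> Gamma0 S"
  proof (rule Gamma0_add[where z = z])
    have "\<bar>\<phi> j z\<bar> \<noteq> \<infinity>" if "j \<in> I" for j
      using insert.prems(1,3)[of j] Gamma0_not_MInf[of "\<phi> j" S z] that insert.prems(2) by auto
    then show "(\<Sum>i\<in>I. \<phi> i z) < \<infinity>" 
      using insert.prems(3) by (metis ereal_infty_less(1) insertCI sum_Pinfty)
  qed (use insert in auto)
  then show ?case using insert.hyps by simp
qed

lemma Gamma0_comp:
  assumes \<phi>: "\<phi> \<in> Gamma0 T" and h: "linear h" "\<And>x. norm (h x) \<le> norm x" "h ` S = T"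
  shows "(\<lambda>x. \<phi> (h x)) \<in> Gamma0 S"
proof -
  obtain z q where "z \<in> T" "\<phi> z = ereal q" using Gamma0_proper[OF \<phi>] .
  then obtain z' where z': "z' \<in> S" "\<phi> (h z') < \<infinity>" using h(3) by force
  show ?thesis
  proof (rule Gamma0I[where z = z'])
    show "z' \<in> S" "\<phi> (h z') < \<infinity>" by (rule z')+
    show "\<phi> (h x) \<noteq> -\<infinity>" if "x \<in> S" for x
      using Gamma0_not_MInf[OF \<phi>] that h(3) by blast
    show "\<phi> (h (u *\<^sub>R x + v *\<^sub>R y)) \<le> ereal u * \<phi> (h x) + ereal v * \<phi> (h y)"
      if "x \<in> S" "y \<in> S" "0 \<le> u" "0 \<le> v" "u + v = 1" for x y u v
      using Gamma0_convex[OF \<phi>, of "h x" "h y" u v] that h(3)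
      by (auto simp: linear_add[OF h(1)] linear_scale[OF h(1)])
    show "\<exists>\<delta>>0. \<forall>y\<in>S. dist y x < \<delta> \<longrightarrow> ereal C < \<phi> (h y)"
      if x: "x \<in> S" and C: "ereal C < \<phi> (h x)" for x C
    proof -
      have "h x \<in> T" using x h(3) by blast
      from Gamma0_lower_bound[OF \<phi> this C] obtain \<delta> where \<delta>: "\<delta> > 0"
        "\<And>y. y \<in> T \<Longrightarrow> dist y (h x) < \<delta> \<Longrightarrow> ereal C < \<phi> y" by blast
      have "dist (h y) (h x) \<le> dist y x" for y
        using h(2)[of "y - x"] by (simp add: dist_norm linear_diff[OF h(1)])
      then show ?thesis using \<delta> h(3) by (intro exI[of _ \<delta>]) (auto intro: le_less_trans)
    qed
  qed
qed

lemma subdifferential_finite: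
  assumes \<phi>: "\<phi> \<in> Gamma0 S" and "x \<in> S" "u \<in> subdifferential S \<phi> x"
  obtains r where "\<phi> x = ereal r"
proof -
  obtain z q where z: "z \<in> S" "\<phi> z = ereal q" using Gamma0_proper[OF \<phi>] .
  then have "ereal ((z - x) \<bullet> u) + \<phi> x \<le> ereal q"
    using assms(3) by (auto simp: subdifferential_def)
  then show ?thesis using that Gamma0_not_MInf[OF \<phi> assms(2)] by (cases "\<phi> x") auto
qed

lemma subdifferential_monotone:
  assumes \<phi>: "\<phi> \<in> Gamma0 S" and "x \<in> S" "u \<in> subdifferential S \<phi> x"
    and "y \<in> S" "v \<in> subdifferential S \<phi> y"
  shows "0 \<le> (x - y) \<bullet> (u - v)"
proof -
  obtain r where r: "\<phi> x = ereal r" using subdifferential_finite[OF assms(1-3)] .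
  obtain s where s: "\<phi> y = ereal s" using subdifferential_finite[OF assms(1,4,5)] .
  have "ereal ((y - x) \<bullet> u) + \<phi> x \<le> \<phi> y" "ereal ((x - y) \<bullet> v) + \<phi> y \<le> \<phi> x"
    using assms(2-5) unfolding subdifferential_def by blast+
  then have "(y - x) \<bullet> u + r \<le> s" "(x - y) \<bullet> v + s \<le> r" by (simp_all add: r s)
  then show ?thesis by (simp add: inner_diff_left inner_diff_right)
qed

section \<open>Proximal points and their consequences\<close>

text \<open>
  First-order optimality: moving from the minimizer \<open>p\<close> to \<open>p + \<tau> (y - p)\<close> changes the quadratic term by
  \<open>\<tau> \<langle>y - p | p - x\<rangle> + O(\<tau>\<^sup>2)\<close>, while convexity bounds the change of \<open>\<phi>\<close> by \<open>\<tau> (\<phi> y - \<phi> p)\<close>.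
\<close>

lemma Argmin_prox_subgradient:
  assumes \<phi>: "\<phi> \<in> Gamma0 S" and S: "subspace S" and x: "x \<in> S"
    and p: "p \<in> Argmin S (\<lambda>z. \<phi> z + ereal (1/2 * (norm (z - x))\<^sup>2))"
  shows "p \<in> S" "x - p \<in> subdifferential S \<phi> p"
proof -
  let ?h = "\<lambda>z. \<phi> z + ereal (1/2 * (norm (z - x))\<^sup>2)"
  show pS: "p \<in> S" using p by (auto simp: Argmin_def is_arg_min_def)
  have min: "?h p \<le> ?h z" if "z \<in> S" for z
    using p that by (auto simp: Argmin_def is_arg_min_def not_less)
  obtain z0 q where z0: "z0 \<in> S" "\<phi> z0 = ereal q" using Gamma0_proper[OF \<phi>] .
  obtain r where r: "\<phi> p = ereal r"
    using min[OF z0(1)] Gamma0_not_MInf[OF \<phi> pS] by (cases "\<phi> p") (auto simp: z0)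
  have "ereal ((y - p) \<bullet> (x - p)) + \<phi> p \<le> \<phi> y" if y: "y \<in> S" for y
  proof (cases "\<phi> y")
    case (real s)
    let ?c = "(norm (y - p))\<^sup>2 / 2"
    have expand: "(norm (a + t *\<^sub>R b))\<^sup>2 = (norm a)\<^sup>2 + 2 * t * (b \<bullet> a) + t\<^sup>2 * (norm b)\<^sup>2"
      for a b :: 'a and t :: real
      unfolding power2_norm_eq_inner
      by (simp add: inner_add_left inner_add_right inner_commute[of a b] power2_eq_square algebra_simps)
    have bound: "(y - p) \<bullet> (x - p) + r - s \<le> \<tau> * ?c" if \<tau>: "0 < \<tau>" "\<tau> < 1" for \<tau>
    proof -
      define w where "w = (1 - \<tau>) *\<^sub>R p + \<tau> *\<^sub>R y"
      have w: "w \<in> S" using S pS y by (simp add: w_def subspace_add subspace_scale)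
      have "\<phi> w \<le> ereal ((1 - \<tau>) * r + \<tau> * s)"
        using Gamma0_convex[OF \<phi> pS y, of "1 - \<tau>" \<tau>] \<tau> by (simp add: w_def r real)
      then have "?h w \<le> ereal ((1 - \<tau>) * r + \<tau> * s + 1/2 * (norm (w - x))\<^sup>2)"
        by (cases "\<phi> w") auto
      with min[OF w] have "?h p \<le> ereal ((1 - \<tau>) * r + \<tau> * s + 1/2 * (norm (w - x))\<^sup>2)"
        by (rule order_trans)
      then have "r + 1/2 * (norm (p - x))\<^sup>2 \<le> (1 - \<tau>) * r + \<tau> * s + 1/2 * (norm (w - x))\<^sup>2"
        by (simp add: r)
      moreover have "w - x = (p - x) + \<tau> *\<^sub>R (y - p)" by (simp add: w_def algebra_simps)
      then have "(norm (w - x))\<^sup>2 = (norm (p - x))\<^sup>2 + 2 * \<tau> * ((y - p) \<bullet> (p - x)) + \<tau>\<^sup>2 * (norm (y - p))\<^sup>2"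
        using expand[of "p - x" \<tau> "y - p"] by (simp only:)
      ultimately have "0 \<le> \<tau> * (s - r + (y - p) \<bullet> (p - x) + \<tau> * ?c)"
        by (simp add: algebra_simps power2_eq_square)
      then have "0 \<le> s - r + (y - p) \<bullet> (p - x) + \<tau> * ?c"
        using \<tau> by (simp add: zero_le_mult_iff)
      then show ?thesis by (simp add: inner_diff_right)
    qed
    have "((\<lambda>\<tau>. \<tau> * ?c) \<longlongrightarrow> 0 * ?c) (at_right 0)" by (intro tendsto_intros)
    moreover have "\<forall>\<^sub>F \<tau> in at_right 0. (y - p) \<bullet> (x - p) + r - s \<le> \<tau> * ?c"
      unfolding eventually_at_right_field using bound by (intro exI[of _ 1]) auto
    ultimately have "(y - p) \<bullet> (x - p) + r - s \<le> 0 * ?c"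
      by (rule tendsto_lowerbound) simp
    then show ?thesis by (simp add: r real)
  next
    case PInf then show ?thesis by simp
  next
    case MInf then show ?thesis using Gamma0_not_MInf[OF \<phi> y] by simp
  qed
  then show "x - p \<in> subdifferential S \<phi> p"
    using S x pS by (auto simp: subdifferential_def subspace_diff)
qed

text \<open>
  The linear minorant makes the regularized function bounded below, and the parallelogram law makes
  every minimizing sequence Cauchy; its limit is a minimizer by lower semicontinuity.
\<close>

lemma Argmin_prox_exists:
  fixes S :: "'a::{real_inner, complete_space} set"
  assumes \<phi>: "\<phi> \<in> Gamma0 S" and S: "subspace S" "closed S"
  shows "\<exists>p. p \<in> Argmin S (\<lambda>z. \<phi> z + ereal (1/2 * (norm (z - x))\<^sup>2))"
proof -
  define Dm where "Dm = {y\<in>S. \<phi> y < \<infinity>}"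
  define F where "F y = real_of_ereal (\<phi> y)" for y
  have F: "\<phi> y = ereal (F y)" if "y \<in> Dm" for y
    using that Gamma0_not_MInf[OF \<phi>, of y] by (cases "\<phi> y") (auto simp: F_def Dm_def)
  define h where "h y = F y + 1/2 * (norm (y - x))\<^sup>2" for y
  obtain A B where B: "0 \<le> B" and AB: "\<And>y. y \<in> S \<Longrightarrow> ereal (- A - B * norm y) \<le> \<phi> y"
    by (rule Gamma0_minorant[OF \<phi> S(1)]) blast
  have low: "- A - B * norm x - B\<^sup>2 / 2 \<le> h y" if y: "y \<in> Dm" for y
  proof -
    have "- A - B * norm y \<le> F y" using AB[of y] F[OF y] y by (simp add: Dm_def)
    moreover have "B * norm y \<le> B * (norm x + norm (y - x))"
      using B by (intro mult_left_mono) (use norm_triangle_ineq[of x "y - x"] in simp_all)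
    moreover have "0 \<le> (norm (y - x) - B)\<^sup>2" by simp
    then have "B * norm (y - x) \<le> B\<^sup>2 / 2 + 1/2 * (norm (y - x))\<^sup>2"
      by (simp add: power2_diff algebra_simps)
    ultimately show ?thesis unfolding h_def by (simp add: algebra_simps)
  qed
  obtain z0 q where z0: "z0 \<in> S" "\<phi> z0 = ereal q" using Gamma0_proper[OF \<phi>] .
  then have ne: "z0 \<in> Dm" by (simp add: Dm_def)
  define m where "m = Inf (h ` Dm)"
  have bdd: "bdd_below (h ` Dm)" using low by (intro bdd_belowI[of _ "- A - B * norm x - B\<^sup>2 / 2"]) auto
  have m: "m \<le> h y" if "y \<in> Dm" for y
    unfolding m_def by (rule cInf_lower[OF _ bdd]) (use that in auto)
  have "\<exists>y\<in>Dm. h y < m + 1 / real (Suc n)" for n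
    using cInf_lessD[of "h ` Dm" "m + 1 / real (Suc n)"] ne by (auto simp: m_def)
  then obtain y where y: "\<And>n. y n \<in> Dm" and hy: "\<And>n. h (y n) < m + 1 / real (Suc n)"
    by metis
  have strong: "(norm (u - v))\<^sup>2 / 8 \<le> (h u + h v) / 2 - m" if uv: "u \<in> Dm" "v \<in> Dm" for u v
  proof -
    have midpoint: "(norm ((1/2::real) *\<^sub>R a + (1/2::real) *\<^sub>R b))\<^sup>2
        = ((norm a)\<^sup>2 + (norm b)\<^sup>2) / 2 - (norm (a - b))\<^sup>2 / 4" for a b :: 'a
      unfolding power2_norm_eq_inner
      by (simp add: inner_add_left inner_add_right inner_diff_left inner_diff_right
          inner_commute[of b a] algebra_simps add_divide_distrib diff_divide_distrib)
    define w where "w = (1/2::real) *\<^sub>R u + (1/2::real) *\<^sub>R v"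
    have w: "w \<in> S" using S uv by (simp add: w_def Dm_def subspace_add subspace_scale)
    have cw: "\<phi> w \<le> ereal ((F u + F v) / 2)"
    proof -
      have "\<phi> w \<le> ereal (1/2) * ereal (F u) + ereal (1/2) * ereal (F v)"
        using Gamma0_convex[OF \<phi>, of u v "1/2" "1/2"] uv
        unfolding F[OF uv(1), symmetric] F[OF uv(2), symmetric] w_def Dm_def by simp
      then show ?thesis by (simp add: field_simps)
    qed
    then have wD: "w \<in> Dm" using w by (auto simp: Dm_def)
    have "F w \<le> (F u + F v) / 2" using cw F[OF wD] by simp
    moreover have "(norm (w - x))\<^sup>2 = ((norm (u - x))\<^sup>2 + (norm (v - x))\<^sup>2) / 2 - (norm (u - v))\<^sup>2 / 4"
    proof -
      have split: "a + b - (c + c) = (a - c) + (b - c)" for a b c :: 'a by simp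
      have "w - x = (1/2::real) *\<^sub>R (u - x) + (1/2::real) *\<^sub>R (v - x)"
        using split[of "(1/2::real) *\<^sub>R u" "(1/2::real) *\<^sub>R v" "(1/2::real) *\<^sub>R x"] scaleR_half_double[of x]
        by (simp only: w_def scaleR_right_diff_distrib scaleR_add_right)
      then show ?thesis using midpoint[of "u - x" "v - x"] by simp
    qed
    ultimately show ?thesis using m[OF wD] by (simp add: h_def field_simps)
  qed
  have "Cauchy y"
  proof (rule metric_CauchyI)
    fix e :: real assume "0 < e"
    then have "0 < e\<^sup>2 / 8" by simp
    then obtain N where "N > 0" and N: "1 / real N < e\<^sup>2 / 8"
      using real_arch_inverse[of "e\<^sup>2 / 8"] by (auto simp: inverse_eq_divide)
    have "dist (y i) (y j) < e" if "i \<ge> N" "j \<ge> N" for i j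
    proof -
      have "1 / real (Suc i) \<le> 1 / real N" "1 / real (Suc j) \<le> 1 / real N"
        using that \<open>N > 0\<close> by (auto intro!: divide_left_mono)
      then have "h (y i) < m + 1 / real N" "h (y j) < m + 1 / real N"
        using hy[of i] hy[of j] by (meson add_left_mono order_less_le_trans)+
      then have "(h (y i) + h (y j)) / 2 - m < 1 / real N" by argo
      then have "(norm (y i - y j))\<^sup>2 / 8 < e\<^sup>2 / 8"
        using strong[OF y y, of i j] N by (meson order_le_less_trans order_less_trans)
      then have "(norm (y i - y j))\<^sup>2 < e\<^sup>2" by simp
      then show ?thesis using \<open>0 < e\<close> by (simp add: dist_norm power_less_imp_less_base)
    qed
    then show "\<exists>M. \<forall>i\<ge>M. \<forall>j\<ge>M. dist (y i) (y j) < e" by blast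
  qed
  then obtain p where p: "y \<longlonglongrightarrow> p" using Cauchy_convergent_iff convergent_def by blast
  have pS: "p \<in> S" using S(2) y p unfolding closed_sequential_limits Dm_def by blast
  have "\<phi> p \<le> ereal (m + 0 - 1/2 * (norm (p - x))\<^sup>2)"
  proof (rule Gamma0_sequential_bound[OF \<phi> pS _ p])
    show "y n \<in> S" for n using y by (auto simp: Dm_def)
    show "(\<lambda>n. m + 1 / real (Suc n) - 1/2 * (norm (y n - x))\<^sup>2) \<longlonglongrightarrow> m + 0 - 1/2 * (norm (p - x))\<^sup>2"
      using p LIMSEQ_Suc[OF lim_1_over_n[where 'a = real]] by (intro tendsto_intros) auto
    show "\<phi> (y n) \<le> ereal (m + 1 / real (Suc n) - 1/2 * (norm (y n - x))\<^sup>2)" for n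
      using hy[of n] F[OF y] by (simp add: h_def)
  qed
  then have hp: "\<phi> p + ereal (1/2 * (norm (p - x))\<^sup>2) \<le> ereal m"
    by (cases "\<phi> p") auto
  have "ereal m \<le> \<phi> z + ereal (1/2 * (norm (z - x))\<^sup>2)" if "z \<in> S" for z
  proof (cases "\<phi> z < \<infinity>")
    case True
    then have "z \<in> Dm" using that by (simp add: Dm_def)
    then show ?thesis using m[of z] F[of z] by (simp add: h_def)
  qed simp
  with hp pS show ?thesis
    unfolding Argmin_def is_arg_min_def by (intro exI[of _ p]) (auto simp: not_less intro: order_trans)
qed

text \<open>
  Minimizers are unique because two of them would contradict monotonicity of the subdifferential, so the
  definite description in \<^const>\<open>prox\<close> denotes.
\<close>

lemma prox_subgradient:
  fixes S :: "'a::{real_inner, complete_space} set"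
  assumes \<phi>: "\<phi> \<in> Gamma0 S" and S: "subspace S" "closed S" and x: "x \<in> S"
  shows "prox S \<phi> x \<in> S" "x - prox S \<phi> x \<in> subdifferential S \<phi> (prox S \<phi> x)"
proof -
  let ?A = "Argmin S (\<lambda>z. \<phi> z + ereal (1/2 * (norm (z - x))\<^sup>2))"
  note sub = Argmin_prox_subgradient[OF \<phi> S(1) x]
  have uniq: "p = q" if "p \<in> ?A" "q \<in> ?A" for p q
  proof -
    have "0 \<le> (p - q) \<bullet> ((x - p) - (x - q))"
      using subdifferential_monotone[OF \<phi>] sub[OF that(1)] sub[OF that(2)] by blast
    then have "0 \<le> - ((p - q) \<bullet> (p - q))" by (simp add: inner_diff_right)
    then show ?thesis by (smt (verit) inner_ge_zero inner_eq_zero_iff eq_iff_diff_eq_0)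
  qed
  obtain p where p: "p \<in> ?A" using Argmin_prox_exists[OF \<phi> S] by blast
  then have "prox S \<phi> x = p" unfolding prox_def using uniq by blast
  with sub[OF p] show "prox S \<phi> x \<in> S" "x - prox S \<phi> x \<in> subdifferential S \<phi> (prox S \<phi> x)" by auto
qed

lemma prox_scaled_subgradient:
  fixes S :: "'a::{real_inner, complete_space} set"
  assumes \<phi>: "\<phi> \<in> Gamma0 S" and S: "subspace S" "closed S" and x: "x \<in> S" and r: "0 < r"
    and p: "p = prox S (\<lambda>z. ereal r * \<phi> z) x"
  shows "p \<in> S" "inverse r *\<^sub>R (x - p) \<in> subdifferential S \<phi> p"
proof -
  note P = prox_subgradient[OF Gamma0_scale[OF \<phi> r] S x, folded p]
  show pS: "p \<in> S" by (rule P)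
  obtain q where "ereal r * \<phi> p = ereal q"
    using subdifferential_finite[OF Gamma0_scale[OF \<phi> r] P] .
  then obtain s where s: "\<phi> p = ereal s" using r by (cases "\<phi> p") auto
  have "ereal ((y - p) \<bullet> (inverse r *\<^sub>R (x - p))) + \<phi> p \<le> \<phi> y" if y: "y \<in> S" for y
  proof -
    have "ereal ((y - p) \<bullet> (x - p)) + ereal r * \<phi> p \<le> ereal r * \<phi> y"
      using P(2) y by (auto simp: subdifferential_def)
    then have "ereal (inverse r * ((y - p) \<bullet> (x - p))) + \<phi> p \<le> \<phi> y"
      using r by (cases "\<phi> y") (auto simp: s field_simps)
    then show ?thesis by (simp only: inner_scaleR_right)
  qed
  then show "inverse r *\<^sub>R (x - p) \<in> subdifferential S \<phi> p"
    using S x pS by (auto simp: subdifferential_def subspace_diff subspace_scale)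
qed

text \<open>
  The proximal point of \<open>-l\<close> at the origin represents \<open>l\<close>: its subgradient inequality
  reads \<open>l y \<le> y \<bullet> p\<close> on the whole subspace, and replacing \<open>y\<close> by \<open>-y\<close> turns this into equality.
\<close>

lemma subspace_Riesz:
  fixes S :: "'a::{real_inner, complete_space} set"
  assumes S: "subspace S" "closed S"
    and add: "\<And>x y. x \<in> S \<Longrightarrow> y \<in> S \<Longrightarrow> l (x + y) = l x + l y"
    and scale: "\<And>x r. x \<in> S \<Longrightarrow> l (r *\<^sub>R x) = r * l x"
    and bound: "\<And>x. x \<in> S \<Longrightarrow> \<bar>l x\<bar> \<le> B * norm x"
  shows "\<exists>w\<in>S. \<forall>x\<in>S. l x = x \<bullet> w"
proof -
  have minus: "l (x - y) = l x - l y" if "x \<in> S" "y \<in> S" for x y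
    using add[of x "(-1) *\<^sub>R y"] scale[of y "-1"] that S(1) by (simp add: subspace_neg)
  have "(\<lambda>x. ereal (- l x)) \<in> Gamma0 S"
  proof (rule Gamma0I[of S _ 0])
    show "0 \<in> S" by (rule subspace_0[OF S(1)])
    show "ereal (- l (u *\<^sub>R x + v *\<^sub>R y)) \<le> ereal u * ereal (- l x) + ereal v * ereal (- l y)"
      if "x \<in> S" "y \<in> S" for x y u v
      using that S(1) by (simp add: add scale subspace_scale)
    show "\<exists>\<delta>>0. \<forall>y\<in>S. dist y x < \<delta> \<longrightarrow> ereal C < ereal (- l y)"
      if x: "x \<in> S" and C: "ereal C < ereal (- l x)" for x C
    proof -
      define \<delta> where "\<delta> = (- l x - C) / (\<bar>B\<bar> + 1)"
      have "0 < \<delta>" using C by (simp add: \<delta>_def)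
      have "C < - l y" if y: "y \<in> S" "dist y x < \<delta>" for y
      proof -
        have "l y - l x \<le> B * norm (y - x)"
          using bound[of "y - x"] minus[OF y(1) x] S(1) x y by (simp add: subspace_diff)
        also have "\<dots> \<le> (\<bar>B\<bar> + 1) * norm (y - x)" by (intro mult_right_mono) auto
        also have "\<dots> < (\<bar>B\<bar> + 1) * \<delta>" using y(2) by (intro mult_strict_left_mono) (auto simp: dist_norm)
        also have "\<dots> = - l x - C" by (simp add: \<delta>_def add_nonneg_eq_0_iff)
        finally show ?thesis by simp
      qed
      then show ?thesis using \<open>0 < \<delta>\<close> by auto
    qed
  qed auto
  from prox_subgradient[OF this S subspace_0[OF S(1)]] obtain p where p: "p \<in> S"
    "0 - p \<in> subdifferential S (\<lambda>x. ereal (- l x)) p" by blast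
  have le: "l y \<le> y \<bullet> p" if y: "y \<in> S" for y
  proof -
    have "ereal ((y + p - p) \<bullet> (0 - p)) + ereal (- l p) \<le> ereal (- l (y + p))"
      using p(2) subspace_add[OF S(1) y p(1)] unfolding subdifferential_def by blast
    then show ?thesis using add[OF y p(1)] by simp
  qed
  have "l y = y \<bullet> p" if y: "y \<in> S" for y
    using le[OF y] le[of "(-1) *\<^sub>R y"] scale[OF y, of "-1"] y S(1) by (simp add: subspace_neg)
  with p show ?thesis by blast
qed

lemma norm_tendsto_0_of_power2:
  "((\<lambda>n. (norm (v n))\<^sup>2) \<longlongrightarrow> 0) F \<Longrightarrow> ((\<lambda>n. norm (v n)) \<longlongrightarrow> 0) F"
  using tendsto_real_sqrt[of "\<lambda>n. (norm (v n))\<^sup>2" 0 F] by simp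

text \<open>
  Weak lower semicontinuity, with a convergent perturbation \<open>l\<close>.  The subgradients \<open>(u - p\<^sub>n) / r\<^sub>n\<close> of \<open>\<phi>\<close> at the
  proximal points \<open>p\<^sub>n\<close> of \<open>u\<close> give affine minorants, whose values do pass to the weak limit; this yields
  \<open>\<phi> p\<^sub>n + \<parallel>u - p\<^sub>n\<parallel>\<^sup>2 / r\<^sub>n \<le> C - l'\<close>.  As the parameter \<open>r\<^sub>n\<close> vanishes, \<open>p\<^sub>n\<close> tends to \<open>u\<close> in norm, and strong lower
  semicontinuity suffices.
\<close>

lemma Gamma0_weak_lsc:
  fixes S :: "'a::{real_inner, complete_space} set"
  assumes \<phi>: "\<phi> \<in> Gamma0 S" and S: "subspace S" "closed S" and u: "u \<in> S" "\<And>n. w n \<in> S"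
    and weak: "weakly_converges_on S w u" and l: "l \<longlonglongrightarrow> l'"
    and le: "\<And>n. \<phi> (w n) + ereal (l n) \<le> ereal C"
  shows "\<phi> u + ereal l' \<le> ereal C"
proof -
  obtain A B where B: "0 \<le> B" and AB: "\<And>y. y \<in> S \<Longrightarrow> ereal (- A - B * norm y) \<le> \<phi> y"
    by (rule Gamma0_minorant[OF \<phi> S(1)]) blast
  define r where "r n = 1 / real (Suc n)" for n
  have r: "0 < r n" for n by (simp add: r_def)
  define p where "p n = prox S (\<lambda>z. ereal (r n) * \<phi> z) u" for n
  note P = prox_scaled_subgradient[OF \<phi> S u(1) r p_def]
  have "\<exists>s. \<phi> (p n) = ereal s" for n
    using subdifferential_finite[OF \<phi> P] by metis
  then obtain s where s: "\<And>n. \<phi> (p n) = ereal (s n)" by metis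
  have key: "s n + inverse (r n) * (norm (u - p n))\<^sup>2 \<le> C - l'" for n
  proof -
    let ?g = "inverse (r n) *\<^sub>R (u - p n)"
    have g: "?g \<in> S" using u P(1)[of n] S by (simp add: subspace_diff subspace_scale)
    have "(w k - p n) \<bullet> ?g + s n + l k \<le> C" for k
    proof -
      have "ereal ((w k - p n) \<bullet> ?g) + \<phi> (p n) \<le> \<phi> (w k)"
        using P(2)[of n] u(2)[of k] by (auto simp: subdifferential_def)
      then have "ereal ((w k - p n) \<bullet> ?g + s n) + ereal (l k) \<le> \<phi> (w k) + ereal (l k)"
        by (intro add_right_mono) (simp add: s)
      also have "\<dots> \<le> ereal C" by (rule le)
      finally show ?thesis by simp
    qed
    moreover have "(\<lambda>k. w k \<bullet> ?g) \<longlonglongrightarrow> u \<bullet> ?g" using weak g unfolding weakly_converges_on_def by blast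
    then have "(\<lambda>k. (w k - p n) \<bullet> ?g + s n + l k) \<longlonglongrightarrow> (u - p n) \<bullet> ?g + s n + l'"
      unfolding inner_diff_left by (intro tendsto_add tendsto_diff tendsto_const l)
    ultimately have "(u - p n) \<bullet> ?g + s n + l' \<le> C"
      by (intro LIMSEQ_le_const2) auto
    then show ?thesis by (simp add: power2_norm_eq_inner algebra_simps)
  qed
  define M where "M = C - l' + A + B * norm u"
  have dist_p: "(norm (u - p n))\<^sup>2 \<le> 2 * (r n * M) + (r n * B)\<^sup>2" for n
  proof -
    let ?d = "norm (u - p n)"
    have "- A - B * norm (p n) \<le> s n" using AB[OF P(1)] s by simp
    moreover have "B * norm (p n) \<le> B * (norm u + ?d)"
      using norm_triangle_ineq4[of u "u - p n"] B by (intro mult_left_mono) auto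
    ultimately have "inverse (r n) * ?d\<^sup>2 \<le> M + B * ?d"
      using key[of n] by (simp add: M_def algebra_simps)
    then have "r n * (inverse (r n) * ?d\<^sup>2) \<le> r n * (M + B * ?d)"
      using r[of n] by (intro mult_left_mono) auto
    then have "?d\<^sup>2 \<le> r n * M + (r n * B) * ?d" using r[of n]
      by (simp add: algebra_simps flip: mult.assoc)
    moreover have "0 \<le> (?d - r n * B)\<^sup>2" by simp
    ultimately show ?thesis by (simp add: power2_diff algebra_simps)
  qed
  have r0: "r \<longlonglongrightarrow> 0" unfolding r_def using LIMSEQ_Suc[OF lim_1_over_n[where 'a = real]] by simp
  have "(\<lambda>n. 2 * (r n * M) + (r n * B)\<^sup>2) \<longlonglongrightarrow> 2 * (0 * M) + (0 * B)\<^sup>2"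
    by (intro tendsto_intros r0)
  then have lim: "(\<lambda>n. 2 * (r n * M) + (r n * B)\<^sup>2) \<longlonglongrightarrow> 0" by simp
  have "(\<lambda>n. (norm (u - p n))\<^sup>2) \<longlonglongrightarrow> 0"
    by (rule tendsto_sandwich[OF _ _ tendsto_const lim]) (use dist_p in auto)
  then have "(\<lambda>n. norm (u - p n)) \<longlonglongrightarrow> 0"
    by (rule norm_tendsto_0_of_power2)
  then have "p \<longlonglongrightarrow> u"
    by (subst tendsto_dist_iff) (simp add: dist_norm norm_minus_commute)
  moreover have "\<phi> (p n) \<le> ereal (C - l')" for n
  proof -
    have "0 \<le> inverse (r n) * (norm (u - p n))\<^sup>2" using r[of n] by simp
    then show ?thesis using key[of n] by (simp add: s)
  qed
  ultimately have "\<phi> u \<le> ereal (C - l')"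
    by (intro Gamma0_sequential_bound[OF \<phi> u(1) P(1) _ tendsto_const[of "C - l'"]])
  then show ?thesis by (cases "\<phi> u") auto
qed

text \<open>
  Minty's trick inverts the inclusion.  With \<open>p = prox \<phi> (y + v)\<close> and
  \<open>q = y + v - p\<close>, both \<open>(q, p)\<close> and \<open>(v, y)\<close> lie in the graph of the subdifferential of the conjugate.  As
  \<open>q - v = y - p\<close>, monotonicity of this graph forces \<open>p = y\<close> and \<open>q = v\<close>.
\<close>

lemma conjugate_subgradient_flip:
  fixes S :: "'a::{real_inner, complete_space} set"
  assumes \<phi>: "\<phi> \<in> Gamma0 S" and S: "subspace S" "closed S" and "y \<in> S" "v \<in> S"
    and yv: "y \<in> subdifferential S (fenchel_conjugate S \<phi>) v"
  shows "v \<in> subdifferential S \<phi> y"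
proof -
  define p where "p = prox S \<phi> (y + v)"
  define q where "q = y + v - p"
  have p: "p \<in> S" and q: "q \<in> subdifferential S \<phi> p"
    using prox_subgradient[OF \<phi> S, of "y + v"] assms(4,5) S(1)
    by (auto simp: p_def q_def subspace_add)
  obtain r where r: "\<phi> p = ereal r" using subdifferential_finite[OF \<phi> p q] .
  have qS: "q \<in> S" using q by (simp add: subdifferential_def)
  have conj_q: "fenchel_conjugate S \<phi> q \<le> ereal (p \<bullet> q - r)"
    unfolding fenchel_conjugate_def
  proof (rule SUP_least)
    fix x assume x: "x \<in> S"
    have "ereal ((x - p) \<bullet> q) + ereal r \<le> \<phi> x" using q x r by (auto simp: subdifferential_def)
    then show "ereal (x \<bullet> q) - \<phi> x \<le> ereal (p \<bullet> q - r)"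
      by (cases "\<phi> x") (auto simp: inner_diff_left)
  qed
  have conj_v: "ereal (p \<bullet> v - r) \<le> fenchel_conjugate S \<phi> v"
    unfolding fenchel_conjugate_def using SUP_upper[OF p, of "\<lambda>x. ereal (x \<bullet> v) - \<phi> x"] by (simp add: r)
  have "ereal ((q - v) \<bullet> y) + fenchel_conjugate S \<phi> v \<le> fenchel_conjugate S \<phi> q"
    using yv qS by (auto simp: subdifferential_def)
  then have "ereal ((q - v) \<bullet> y) + ereal (p \<bullet> v - r) \<le> ereal (p \<bullet> q - r)"
    using conj_q conj_v by (meson add_left_mono order_trans)
  then have "(q - v) \<bullet> y + p \<bullet> v \<le> p \<bullet> q" by simp
  then have "(y - p) \<bullet> (y - p) \<le> 0"
    by (simp add: q_def inner_diff_left inner_diff_right inner_add_left inner_add_right inner_commute)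
  then have "y - p = 0" by (metis inner_eq_zero_iff inner_ge_zero order_antisym)
  then show ?thesis using q by (simp add: q_def)
qed

section \<open>Weak convergence\<close>

lemma complete_subspace_projection:
  fixes S :: "'a::{real_inner, complete_space} set"
  assumes "subspace S" "closed S"
  obtains p where "p \<in> S" "\<And>y. y \<in> S \<Longrightarrow> y \<bullet> u = y \<bullet> p"
proof -
  have "\<exists>p\<in>S. \<forall>y\<in>S. y \<bullet> u = y \<bullet> p"
    by (rule subspace_Riesz[OF assms, where B = "norm u"])
      (auto simp: inner_add_left mult.commute[of "norm u"] intro: Cauchy_Schwarz_ineq2)
  with that show thesis by blast
qed

text \<open>
  A diagonal argument makes \<open>z\<^sub>k\<^sub>n \<bullet> z\<^sub>m\<close> converge for every \<open>m\<close>.  The vectors tested against which \<open>z\<^sub>k\<^sub>n\<close> converges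
  form a closed subspace \<open>V\<close> containing the whole sequence; a general vector acts on the sequence like its
  projection on \<open>V\<close>.  The limit functional is then represented by a vector.
\<close>

lemma bounded_weakly_convergent_subsequence:
  fixes S :: "'a::{real_inner, complete_space} set" and z :: "nat \<Rightarrow> 'a"
  assumes S: "subspace S" "closed S" and z: "\<And>n. z n \<in> S" and bound: "\<And>n. norm (z n) \<le> B"
  obtains k l where "strict_mono k" "l \<in> S" "weakly_converges_on S (z \<circ> k) l"
proof -
  have inner_bound: "norm (z n \<bullet> u) \<le> B * B" if "u \<in> range z" for n u
  proof -
    have "\<bar>z n \<bullet> u\<bar> \<le> norm (z n) * norm u" by (rule Cauchy_Schwarz_ineq2)
    also have "\<dots> \<le> B * B" using bound that norm_ge_zero order_trans[OF norm_ge_zero bound]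
      by (intro mult_mono) auto
    finally show ?thesis by simp
  qed
  obtain k where k: "strict_mono (k::nat \<Rightarrow> nat)"
    and conv: "\<And>u. u \<in> range z \<Longrightarrow> \<exists>l. (\<lambda>n. z (k n) \<bullet> u) \<longlonglongrightarrow> l"
    by (rule function_convergent_subsequence[of "range z" "\<lambda>n u. z n \<bullet> u" "B * B"])
      (use inner_bound in auto)
  define V where "V = {u. convergent (\<lambda>n. z (k n) \<bullet> u)}"
  have "subspace V"
    unfolding subspace_def V_def
    by (auto simp: inner_add_right intro: convergent_add convergent_mult[OF convergent_const] convergent_const)
  have "closed V"
  proof (rule closed_sequential_limits[THEN iffD2, rule_format], elim conjE)
    fix x l assume x: "\<forall>n. x n \<in> V" and l: "x \<longlonglongrightarrow> l"
    have "Cauchy (\<lambda>n. z (k n) \<bullet> l)"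
    proof (rule metric_CauchyI)
      fix e :: real assume "0 < e"
      have "B \<ge> 0" using order_trans[OF norm_ge_zero bound] .
      have "0 < e / 3 / (B + 1)" using \<open>0 < e\<close> \<open>B \<ge> 0\<close> by simp
      then obtain j where j: "dist (x j) l < e / 3 / (B + 1)"
        using l unfolding lim_sequentially by blast
      have near: "\<bar>z i \<bullet> l - z i \<bullet> x j\<bar> < e / 3" for i
      proof -
        have "\<bar>z i \<bullet> (l - x j)\<bar> \<le> norm (z i) * norm (l - x j)" by (rule Cauchy_Schwarz_ineq2)
        also have "\<dots> \<le> (B + 1) * norm (l - x j)" using bound[of i] by (intro mult_right_mono) auto
        also have "\<dots> < (B + 1) * (e / 3 / (B + 1))"
          using j \<open>B \<ge> 0\<close> by (intro mult_strict_left_mono) (auto simp: dist_norm norm_minus_commute)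
        also have "\<dots> = e / 3" using \<open>B \<ge> 0\<close> by (simp add: field_simps)
        finally show ?thesis by (simp add: inner_diff_right)
      qed
      have "Cauchy (\<lambda>n. z (k n) \<bullet> x j)" using x by (simp add: V_def Cauchy_convergent_iff)
      then obtain M where M: "\<And>m n. m \<ge> M \<Longrightarrow> n \<ge> M \<Longrightarrow> dist (z (k m) \<bullet> x j) (z (k n) \<bullet> x j) < e / 3"
        using metric_CauchyD[of "\<lambda>n. z (k n) \<bullet> x j" "e / 3"] \<open>0 < e\<close> by fastforce
      have "dist (z (k m) \<bullet> l) (z (k n) \<bullet> l) < e" if "m \<ge> M" "n \<ge> M" for m n
        using M[OF that] near[of "k m"] near[of "k n"] unfolding dist_real_def by linarith
      then show "\<exists>M. \<forall>m\<ge>M. \<forall>n\<ge>M. dist (z (k m) \<bullet> l) (z (k n) \<bullet> l) < e" by blast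
    qed
    then show "l \<in> V" by (simp add: V_def Cauchy_convergent_iff)
  qed
  have zV: "z n \<in> V" for n using conv by (auto simp: V_def convergent_def)
  have all: "convergent (\<lambda>n. z (k n) \<bullet> u)" for u
  proof -
    obtain p where "p \<in> V" and p: "\<And>y. y \<in> V \<Longrightarrow> y \<bullet> u = y \<bullet> p"
      by (rule complete_subspace_projection[OF \<open>subspace V\<close> \<open>closed V\<close>, of u]) (rule that)
    have "(\<lambda>n. z (k n) \<bullet> u) = (\<lambda>n. z (k n) \<bullet> p)" using p[OF zV] by (rule ext)
    with \<open>p \<in> V\<close> show ?thesis by (simp add: V_def)
  qed
  define f where "f u = lim (\<lambda>n. z (k n) \<bullet> u)" for u
  have f: "(\<lambda>n. z (k n) \<bullet> u) \<longlonglongrightarrow> f u" for u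
    using all[of u] by (simp add: f_def convergent_LIMSEQ_iff)
  have "\<exists>l\<in>S. \<forall>u\<in>S. f u = u \<bullet> l"
  proof (rule subspace_Riesz[OF S, where B = B])
    show "f (x + y) = f x + f y" for x y
      using f[of "x + y"] tendsto_add[OF f[of x] f[of y]]
      by (simp add: inner_add_right LIMSEQ_unique)
    show "f (r *\<^sub>R x) = r * f x" for x r
      using f[of "r *\<^sub>R x"] tendsto_mult[OF tendsto_const[of r] f[of x]]
      by (simp add: LIMSEQ_unique)
    show "\<bar>f u\<bar> \<le> B * norm u" for u
    proof (rule LIMSEQ_le_const2[OF tendsto_rabs[OF f]], intro exI allI impI)
      show "\<bar>z (k n) \<bullet> u\<bar> \<le> B * norm u" for n
        by (rule order_trans[OF Cauchy_Schwarz_ineq2]) (intro mult_right_mono bound norm_ge_zero)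
    qed
  qed
  then obtain l where "l \<in> S" "\<And>u. u \<in> S \<Longrightarrow> f u = l \<bullet> u" by (auto simp: inner_commute)
  then have "weakly_converges_on S (z \<circ> k) l" using f unfolding weakly_converges_on_def o_def by metis
  with k \<open>l \<in> S\<close> show thesis by (rule that)
qed

lemma weakly_converges_on_add_null:
  assumes "weakly_converges_on S x l" "(\<lambda>n. y n - x n) \<longlonglongrightarrow> 0"
  shows "weakly_converges_on S y l"
  unfolding weakly_converges_on_def
proof
  fix u assume "u \<in> S"
  have "(\<lambda>n. x n \<bullet> u) \<longlonglongrightarrow> l \<bullet> u" using assms(1) \<open>u \<in> S\<close> unfolding weakly_converges_on_def by blast
  then have "(\<lambda>n. x n \<bullet> u + (y n - x n) \<bullet> u) \<longlonglongrightarrow> l \<bullet> u + 0 \<bullet> u"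
    by (intro tendsto_add tendsto_inner[OF assms(2) tendsto_const])
  then show "(\<lambda>n. y n \<bullet> u) \<longlonglongrightarrow> l \<bullet> u" by (simp add: inner_diff_left)
qed

lemma weakly_converges_on_Times:
  assumes "weakly_converges_on (S \<times> T) z l" "subspace S" "subspace T"
  shows "weakly_converges_on S (\<lambda>n. fst (z n)) (fst l)" "weakly_converges_on T (\<lambda>n. snd (z n)) (snd l)"
proof -
  have "(\<lambda>n. z n \<bullet> (u, 0)) \<longlonglongrightarrow> l \<bullet> (u, 0)" if "u \<in> S" for u
    using assms(1) that subspace_0[OF assms(3)] unfolding weakly_converges_on_def by blast
  moreover have "(\<lambda>n. z n \<bullet> (0, u)) \<longlonglongrightarrow> l \<bullet> (0, u)" if "u \<in> T" for u
    using assms(1) that subspace_0[OF assms(2)] unfolding weakly_converges_on_def by blast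
  ultimately show "weakly_converges_on S (\<lambda>n. fst (z n)) (fst l)" "weakly_converges_on T (\<lambda>n. snd (z n)) (snd l)"
    by (auto simp: weakly_converges_on_def inner_prod_def)
qed

text \<open>
  Two weak cluster points \<open>l\<close> and \<open>l'\<close> in \<open>Z\<close> coincide, because convergence of the distances to both of them makes
  \<open>z\<^sub>n \<bullet> (l' - l)\<close> convergent along the whole sequence.  Weak compactness then gives convergence.
\<close>

lemma Opial:
  fixes S :: "'a::{real_inner, complete_space} set" and z :: "nat \<Rightarrow> 'a"
  assumes S: "subspace S" "closed S" and z: "\<And>n. z n \<in> S"
    and "Z \<noteq> {}" and dist: "\<And>w. w \<in> Z \<Longrightarrow> convergent (\<lambda>n. norm (z n - w))"
    and cluster: "\<And>k l. strict_mono k \<Longrightarrow> l \<in> S \<Longrightarrow> weakly_converges_on S (z \<circ> k) l \<Longrightarrow> l \<in> Z"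
  shows "\<exists>l\<in>Z. weakly_converges_on S z l"
proof -
  obtain w where "w \<in> Z" using \<open>Z \<noteq> {}\<close> by blast
  from dist[OF this] have "Bseq (\<lambda>n. norm (z n - w))" by (rule convergent_imp_Bseq)
  then obtain B where B: "\<And>n. norm (z n - w) \<le> B" by (auto simp: Bseq_def)
  have bound: "norm (z n) \<le> B + norm w" for n
    using norm_triangle_ineq[of "z n - w" w] B[of n] by simp
  obtain k l where k: "strict_mono k" and l: "l \<in> S" "weakly_converges_on S (z \<circ> k) l"
    by (rule bounded_weakly_convergent_subsequence[OF S z bound])
  have lZ: "l \<in> Z" using cluster k l by blast
  have unique: "l' = l" if k': "strict_mono k'" and l': "l' \<in> S" "weakly_converges_on S (z \<circ> k') l'" for k' l'
  proof -
    have lZ': "l' \<in> Z" using cluster k' l' by blast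
    \<comment> \<open>\<open>2 z\<^sub>n \<bullet> (l' - l)\<close> converges along the whole sequence, being a combination of squared distances.\<close>
    have eq: "z n \<bullet> (l' - l) = ((norm (z n - l))\<^sup>2 - (norm (z n - l'))\<^sup>2 - (norm l)\<^sup>2 + (norm l')\<^sup>2) / 2" for n
      by (simp add: power2_norm_eq_inner inner_diff_left inner_diff_right inner_commute)
    obtain a b where "(\<lambda>n. norm (z n - l)) \<longlonglongrightarrow> a" "(\<lambda>n. norm (z n - l')) \<longlonglongrightarrow> b"
      using dist[OF lZ] dist[OF lZ'] by (auto simp: convergent_def)
    then have "(\<lambda>n. z n \<bullet> (l' - l)) \<longlonglongrightarrow> (a\<^sup>2 - b\<^sup>2 - (norm l)\<^sup>2 + (norm l')\<^sup>2) / 2"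
      (is "_ \<longlonglongrightarrow> ?c") unfolding eq by (intro tendsto_intros) auto
    then have "((\<lambda>n. z n \<bullet> (l' - l)) \<circ> k) \<longlonglongrightarrow> ?c" "((\<lambda>n. z n \<bullet> (l' - l)) \<circ> k') \<longlonglongrightarrow> ?c"
      using k k' by (blast intro: LIMSEQ_subseq_LIMSEQ)+
    moreover have "((\<lambda>n. z n \<bullet> (l' - l)) \<circ> k) \<longlonglongrightarrow> l \<bullet> (l' - l)"
      "((\<lambda>n. z n \<bullet> (l' - l)) \<circ> k') \<longlonglongrightarrow> l' \<bullet> (l' - l)"
      using l l' subspace_diff[OF S(1) l'(1) l(1)] unfolding weakly_converges_on_def o_def by blast+
    ultimately have "l \<bullet> (l' - l) = l' \<bullet> (l' - l)" by (metis LIMSEQ_unique)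
    then have "(l' - l) \<bullet> (l' - l) = 0" by (simp add: inner_diff_left)
    then show ?thesis by simp
  qed
  have "weakly_converges_on S z l"
    unfolding weakly_converges_on_def
  proof (rule ballI, rule ccontr)
    fix u assume u: "u \<in> S" and "\<not> (\<lambda>n. z n \<bullet> u) \<longlonglongrightarrow> l \<bullet> u"
    then obtain e where e: "e > 0" "\<And>N. \<exists>n\<ge>N. \<not> dist (z n \<bullet> u) (l \<bullet> u) < e"
      unfolding lim_sequentially by blast
    then have "\<exists>r. strict_mono (r::nat \<Rightarrow> nat) \<and> (\<forall>n. \<not> dist (z (r n) \<bullet> u) (l \<bullet> u) < e)"
      using infinite_enumerate[of "{n. \<not> dist (z n \<bullet> u) (l \<bullet> u) < e}"]
      unfolding infinite_nat_iff_unbounded_le by auto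
    then obtain r where r: "strict_mono (r::nat \<Rightarrow> nat)" "\<And>n. \<not> dist (z (r n) \<bullet> u) (l \<bullet> u) < e" by blast
    obtain k' l' where k': "strict_mono k'" and l': "l' \<in> S" "weakly_converges_on S ((z \<circ> r) \<circ> k') l'"
      by (rule bounded_weakly_convergent_subsequence[OF S, of "z \<circ> r" "B + norm w"]) (use z bound in auto)
    have "l' = l"
      by (rule unique[of "r \<circ> k'"]) (use r k' l' in \<open>auto simp: strict_mono_o o_assoc\<close>)
    then have "(\<lambda>n. z (r (k' n)) \<bullet> u) \<longlonglongrightarrow> l \<bullet> u"
      using l'(2) u by (simp add: weakly_converges_on_def)
    then show False using r(2) e(1) unfolding lim_sequentially by blast
  qed
  with lZ show ?thesis by blast
qed

section \<open>Relaxed projections and bounded delays\<close>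

text \<open>
  The half-space \<open>{y. (w - y) \<bullet> \<tau> \<ge> 0}\<close> contains \<open>zbar\<close>, and \<open>\<pi> < 0\<close> says that \<open>z\<close> lies outside it.  The update is the
  projection onto this half-space with relaxation \<open>\<rho>\<close>; it decreases the squared distance to
  \<open>zbar\<close> by at least \<open>\<rho> (2 - \<rho>) \<pi>\<^sup>2 / \<parallel>\<tau>\<parallel>\<^sup>2\<close>, that is, \<open>(2 - \<rho>) / \<rho>\<close> times the squared step length.
\<close>

lemma relaxed_projection_step:
  fixes z z' w \<tau> zbar :: "'a::real_inner"
  assumes lam: "0 < \<epsilon>" "\<epsilon> \<le> \<rho>" "\<rho> \<le> 2 - \<epsilon>" and \<pi>: "\<pi> = (w - z) \<bullet> \<tau>"
    and half: "0 \<le> (w - zbar) \<bullet> \<tau>"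
    and step: "\<pi> < 0 \<Longrightarrow> z' = z + (\<rho> * \<pi> / (norm \<tau>)\<^sup>2) *\<^sub>R \<tau>" and no_step: "\<not> \<pi> < 0 \<Longrightarrow> z' = z"
  shows "(norm (z' - zbar))\<^sup>2 + (\<epsilon> / 2) * (norm (z' - z))\<^sup>2 \<le> (norm (z - zbar))\<^sup>2"
    and "\<epsilon> * max 0 (- \<pi>) \<le> norm (z' - z) * norm \<tau>"
proof -
  have "(norm (z' - zbar))\<^sup>2 + (\<epsilon> / 2) * (norm (z' - z))\<^sup>2 \<le> (norm (z - zbar))\<^sup>2
      \<and> \<epsilon> * max 0 (- \<pi>) \<le> norm (z' - z) * norm \<tau>"
  proof (cases "\<pi> < 0")
    case True
    then have T: "norm \<tau> > 0" using \<pi> by auto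
    define \<alpha> where "\<alpha> = \<rho> * \<pi> / (norm \<tau>)\<^sup>2"
    have \<alpha>0: "\<alpha> < 0" using True T lam by (simp add: \<alpha>_def divide_neg_pos mult_pos_neg)
    have z': "z' = z + \<alpha> *\<^sub>R \<tau>" using step[OF True] by (simp add: \<alpha>_def)
    have \<alpha>T: "\<alpha> * (norm \<tau>)\<^sup>2 = \<rho> * \<pi>" using T by (simp add: \<alpha>_def)
    have n1: "(norm (z' - z))\<^sup>2 = \<alpha> * (\<rho> * \<pi>)"
      by (simp add: z' power_mult_distrib flip: \<alpha>T) (simp add: power2_eq_square)
    have in1: "(z - zbar) \<bullet> \<tau> \<ge> - \<pi>" using half by (simp add: \<pi> inner_diff_left)
    have "(norm (z' - zbar))\<^sup>2 = (norm (z - zbar))\<^sup>2 + 2 * \<alpha> * ((z - zbar) \<bullet> \<tau>) + (norm (z' - z))\<^sup>2"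
      unfolding power2_norm_eq_inner z'
      by (simp add: inner_add_left inner_add_right inner_diff_left inner_diff_right inner_commute algebra_simps)
    also have "\<dots> \<le> (norm (z - zbar))\<^sup>2 + 2 * \<alpha> * (- \<pi>) + \<alpha> * (\<rho> * \<pi>)"
      using mult_left_mono_neg[OF in1, of "2 * \<alpha>"] \<alpha>0 by (simp add: n1)
    finally have le: "(norm (z' - zbar))\<^sup>2 \<le> (norm (z - zbar))\<^sup>2 - (2 - \<rho>) * (\<alpha> * \<pi>)"
      by (simp add: algebra_simps)
    have \<alpha>\<pi>: "0 < \<alpha> * \<pi>" using \<alpha>0 True by (simp add: mult_neg_neg)
    have "(\<epsilon> / 2) * \<rho> \<le> 2 - \<rho>"
    proof -
      have "(\<epsilon> / 2) * \<rho> \<le> (\<epsilon> / 2) * 2" using lam by (intro mult_left_mono) auto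
      also have "\<dots> = \<epsilon>" by simp
      also have "\<dots> \<le> 2 - \<rho>" using lam by simp
      finally show ?thesis .
    qed
    then have "(\<epsilon> / 2) * \<rho> * (\<alpha> * \<pi>) \<le> (2 - \<rho>) * (\<alpha> * \<pi>)" using \<alpha>\<pi> by (intro mult_right_mono) auto
    then have one: "(norm (z' - zbar))\<^sup>2 + (\<epsilon> / 2) * (norm (z' - z))\<^sup>2 \<le> (norm (z - zbar))\<^sup>2"
      using le by (simp add: n1 algebra_simps)
    have "norm (z' - z) * norm \<tau> = \<bar>\<alpha> * (norm \<tau>)\<^sup>2\<bar>" by (simp add: z' abs_mult power2_eq_square)
    also have "\<dots> = \<rho> * (- \<pi>)" using True lam by (simp add: \<alpha>T abs_mult)
    finally have "\<epsilon> * (- \<pi>) \<le> norm (z' - z) * norm \<tau>"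
      using lam True by (simp add: mult_right_mono_neg)
    with one True show ?thesis by simp
  qed (use no_step in auto)
  then show "(norm (z' - zbar))\<^sup>2 + (\<epsilon> / 2) * (norm (z' - z))\<^sup>2 \<le> (norm (z - zbar))\<^sup>2"
    and "\<epsilon> * max 0 (- \<pi>) \<le> norm (z' - z) * norm \<tau>" by blast+
qed

lemma Fejer_sequence_converges:
  fixes z :: "nat \<Rightarrow> 'a::real_normed_vector"
  assumes "0 < c" and le: "\<And>n. (norm (z (Suc n) - w))\<^sup>2 + c * (norm (z (Suc n) - z n))\<^sup>2 \<le> (norm (z n - w))\<^sup>2"
  shows "convergent (\<lambda>n. norm (z n - w))" "(\<lambda>n. norm (z (Suc n) - z n)) \<longlonglongrightarrow> 0"
proof -
  define N where "N n = norm (z n - w)" for n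
  have dec: "N (Suc n) \<le> N n" for n
  proof (rule power2_le_imp_le)
    show "(N (Suc n))\<^sup>2 \<le> (N n)\<^sup>2"
    proof -
      have "0 \<le> c * (norm (z (Suc n) - z n))\<^sup>2" using \<open>0 < c\<close> by simp
      then show ?thesis using le[of n] unfolding N_def by linarith
    qed
  qed (simp add: N_def)
  then have "decseq N" by (simp add: decseq_Suc_iff)
  then obtain L where L: "N \<longlonglongrightarrow> L" by (rule decseq_convergent[of _ 0]) (auto simp: N_def)
  then show "convergent (\<lambda>n. norm (z n - w))" unfolding N_def convergent_def by blast
  have "(\<lambda>n. ((N n)\<^sup>2 - (N (Suc n))\<^sup>2) / c) \<longlonglongrightarrow> (L\<^sup>2 - L\<^sup>2) / c"
    using \<open>0 < c\<close> by (intro tendsto_intros L LIMSEQ_Suc) auto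
  then have lim: "(\<lambda>n. ((N n)\<^sup>2 - (N (Suc n))\<^sup>2) / c) \<longlonglongrightarrow> 0" by simp
  have "(norm (z (Suc n) - z n))\<^sup>2 \<le> ((N n)\<^sup>2 - (N (Suc n))\<^sup>2) / c" for n
    using le[of n] \<open>0 < c\<close> by (simp add: N_def field_simps)
  then have "(\<lambda>n. (norm (z (Suc n) - z n))\<^sup>2) \<longlonglongrightarrow> 0"
    by (intro tendsto_sandwich[OF _ _ tendsto_const lim]) auto
  then show "(\<lambda>n. norm (z (Suc n) - z n)) \<longlonglongrightarrow> 0"
    by (rule norm_tendsto_0_of_power2)
qed

lemma bounded_lag_vanishes:
  fixes z :: "nat \<Rightarrow> 'a::real_normed_vector"
  assumes inc: "(\<lambda>n. norm (z (Suc n) - z n)) \<longlonglongrightarrow> 0"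
    and q: "\<And>n. q n \<le> n" "\<And>n. n \<le> q n + M"
  shows "(\<lambda>n. norm (z (q n) - z n)) \<longlonglongrightarrow> 0"
proof -
  have lag: "(\<lambda>n. norm (z (n - j) - z n)) \<longlonglongrightarrow> 0" for j
  proof (induction j)
    case (Suc j)
    have "(\<lambda>n. norm (z (Suc n - Suc j) - z (Suc n))) \<longlonglongrightarrow> 0"
    proof (rule tendsto_sandwich[OF _ _ tendsto_const])
      show "(\<lambda>n. norm (z (n - j) - z n) + norm (z (Suc n) - z n)) \<longlonglongrightarrow> 0"
        using tendsto_add[OF Suc inc] by simp
      show "\<forall>\<^sub>F n in sequentially. norm (z (Suc n - Suc j) - z (Suc n))
          \<le> norm (z (n - j) - z n) + norm (z (Suc n) - z n)"
      proof (rule always_eventually, rule allI)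
        fix n
        show "norm (z (Suc n - Suc j) - z (Suc n)) \<le> norm (z (n - j) - z n) + norm (z (Suc n) - z n)"
          using norm_triangle_ineq4[of "z (n - j) - z n" "z (Suc n) - z n"] by simp
      qed
    qed auto
    then show ?case by (subst (asm) filterlim_sequentially_Suc)
  qed simp
  have "(\<lambda>n. \<Sum>j\<le>M. norm (z (n - j) - z n)) \<longlonglongrightarrow> (\<Sum>j\<le>M. 0)" by (intro tendsto_sum lag)
  then have lim: "(\<lambda>n. \<Sum>j\<le>M. norm (z (n - j) - z n)) \<longlonglongrightarrow> 0" by simp
  have le: "norm (z (q n) - z n) \<le> (\<Sum>j\<le>M. norm (z (n - j) - z n))" for n
    using member_le_sum[of "n - q n" "{..M}" "\<lambda>j. norm (z (n - j) - z n)"] q[of n] by simp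
  show ?thesis
    by (rule tendsto_sandwich[OF _ _ tendsto_const lim]) (use le in auto)
qed

text \<open>
  A block that is not activated keeps its values, so its present values were computed at its last activation,
  which the sweeping condition places at most \<open>m\<close> steps back.
\<close>

lemma last_activation:
  fixes In :: "nat \<Rightarrow> 'i set" and y :: "nat \<Rightarrow> 'b"
  assumes "In 0 = UNIV" and sweep: "\<And>n. (\<Union>j\<in>{n..n + m}. In j) = UNIV"
    and keep: "\<And>n. i \<notin> In n \<Longrightarrow> y n = y (n - 1)"
  shows "\<exists>j. i \<in> In j \<and> j \<le> n \<and> n \<le> j + m \<and> y n = y j"
proof -
  define j where "j = (GREATEST j. j \<le> n \<and> i \<in> In j)"
  have ex: "0 \<le> n \<and> i \<in> In 0" using assms(1) by simp
  have j: "j \<le> n \<and> i \<in> In j" unfolding j_def by (rule GreatestI_nat[where k = 0 and b = n]) (use ex in auto)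
  have max: "j' \<le> j" if "j' \<le> n" "i \<in> In j'" for j'
    unfolding j_def by (rule Greatest_le_nat[where b = n]) (use that in auto)
  have "n \<le> j + m"
  proof (cases "n \<le> m")
    case False
    have "i \<in> (\<Union>j\<in>{n - m..n - m + m}. In j)" unfolding sweep by simp
    then obtain j' where "n - m \<le> j'" "j' \<le> n" "i \<in> In j'" using False by auto
    with max[of j'] show ?thesis by simp
  qed simp
  moreover have "y (j + d) = y j" if "j + d \<le> n" for d
    using that
  proof (induction d)
    case (Suc d)
    then have "i \<notin> In (j + Suc d)" using max[of "j + Suc d"] by auto
    from keep[OF this] Suc show ?case by simp
  qed simp
  from this[of "n - j"] have "y n = y j" using j by simp
  ultimately show ?thesis using j by blast
qed

section \<open>Direct sums, adjoints and gradients on subspaces\<close>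

lemma subspace_direct_sum: "(\<And>i. subspace (S i)) \<Longrightarrow> subspace (direct_sum S)"
  by (auto simp: direct_sum_def subspace_def)

lemma closed_direct_sum:
  assumes "\<And>i. closed (S i)" shows "closed (direct_sum S)"
proof -
  have "direct_sum S = (\<Inter>i. (\<lambda>x. x $ i) -` S i)" by (auto simp: direct_sum_def)
  then show ?thesis using assms by (auto intro!: closed_INT closed_vimage continuous_intros)
qed

lemma norm_vec_le_sum: "norm v \<le> (\<Sum>i\<in>UNIV. norm (v $ i))"
  unfolding norm_vec_def by (rule L2_set_le_sum) simp

lemma vec_norm_tendsto_0:
  assumes "\<And>i. (\<lambda>n. norm (v n $ i)) \<longlonglongrightarrow> 0"
  shows "(\<lambda>n. norm (v n)) \<longlonglongrightarrow> 0"
proof -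
  have lim: "(\<lambda>n. \<Sum>i\<in>UNIV. norm (v n $ i)) \<longlonglongrightarrow> 0" by (intro tendsto_null_sum assms)
  show ?thesis by (rule tendsto_sandwich[OF _ _ tendsto_const lim]) (auto intro!: always_eventually norm_vec_le_sum)
qed

lemma tendsto_0_le_mult:
  fixes v :: "nat \<Rightarrow> real"
  assumes "v \<longlonglongrightarrow> 0" "\<And>n. norm (u n) \<le> K * v n"
  shows "(\<lambda>n. norm (u n)) \<longlonglongrightarrow> 0"
proof -
  have lim: "(\<lambda>n. K * v n) \<longlonglongrightarrow> 0" by (rule tendsto_mult_right_zero[OF assms(1)])
  show ?thesis by (rule tendsto_sandwich[OF _ _ tendsto_const lim]) (use assms(2) in auto)
qed

lemma adjoint_on_unique:
  assumes S: "subspace S" and w: "w \<in> S" "\<And>x. x \<in> S \<Longrightarrow> A x \<bullet> v = x \<bullet> w"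
  shows "adjoint_on S A v = w"
  unfolding adjoint_on_def
proof (rule the_equality)
  fix w' assume w': "w' \<in> S \<and> (\<forall>x\<in>S. A x \<bullet> v = x \<bullet> w')"
  have "w' - w \<in> S" using S w w' by (simp add: subspace_diff)
  then have "(w' - w) \<bullet> w' = (w' - w) \<bullet> w" using w w' by metis
  then have "(w' - w) \<bullet> (w' - w) = 0" by (simp add: inner_diff_right)
  then show "w' = w" by simp
qed (use w in auto)

lemma adjoint_on:
  fixes S :: "'a::{real_inner, complete_space} set"
  assumes S: "subspace S" "closed S" and A: "bounded_linear_between S T A"
  shows "adjoint_on S A v \<in> S" "x \<in> S \<Longrightarrow> A x \<bullet> v = x \<bullet> adjoint_on S A v"
proof -
  obtain B where B: "\<And>x. x \<in> S \<Longrightarrow> norm (A x) \<le> B * norm x"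
    using A unfolding bounded_linear_between_def by blast
  have "\<exists>w\<in>S. \<forall>x\<in>S. A x \<bullet> v = x \<bullet> w"
  proof (rule subspace_Riesz[OF S, where B = "B * norm v"])
    fix x assume "x \<in> S"
    have "\<bar>A x \<bullet> v\<bar> \<le> norm (A x) * norm v" by (rule Cauchy_Schwarz_ineq2)
    also have "\<dots> \<le> (B * norm x) * norm v" using B[OF \<open>x \<in> S\<close>] by (intro mult_right_mono) auto
    finally show "\<bar>A x \<bullet> v\<bar> \<le> B * norm v * norm x" by (simp add: ac_simps)
  qed (use A in \<open>auto simp: bounded_linear_between_def inner_add_left\<close>)
  then obtain w where w: "w \<in> S" "\<And>x. x \<in> S \<Longrightarrow> A x \<bullet> v = x \<bullet> w" by blast
  have "adjoint_on S A v = w" by (rule adjoint_on_unique[OF S(1) w])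
  with w show "adjoint_on S A v \<in> S" "x \<in> S \<Longrightarrow> A x \<bullet> v = x \<bullet> adjoint_on S A v" by auto
qed

text \<open>
  Derivatives within a subspace are only meaningful along its directions; restricting to a line inside the
  subspace reduces uniqueness of the gradient and convexity arguments to one real variable.
\<close>

lemma has_derivative_within_line:
  fixes h :: "'a::real_normed_vector \<Rightarrow> 'b::real_normed_vector"
  assumes h: "(h has_derivative D) (at x within S)" and S: "subspace S" "x \<in> S" "d \<in> S"
  shows "((\<lambda>t::real. h (x + t *\<^sub>R d)) has_derivative (\<lambda>t. D (t *\<^sub>R d))) (at 0)"
proof -
  have line: "((\<lambda>t. x + t *\<^sub>R d) has_derivative (\<lambda>t. t *\<^sub>R d)) (at 0 within UNIV)"
    by (auto intro!: derivative_eq_intros)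
  have "(h has_derivative D) (at (x + 0 *\<^sub>R d) within (\<lambda>t. x + t *\<^sub>R d) ` UNIV)"
    using S by (auto intro!: has_derivative_subset[OF h] simp: subspace_add subspace_scale)
  from has_derivative_in_compose[OF line this] show ?thesis by simp
qed

lemma has_gradient_within_line:
  assumes "(h has_derivative (\<lambda>d. d \<bullet> g)) (at x within S)" "subspace S" "x \<in> S" "d \<in> S"
  shows "((\<lambda>t::real. h (x + t *\<^sub>R d)) has_real_derivative d \<bullet> g) (at 0)"
  using has_derivative_within_line[OF assms] by (simp add: has_field_derivative_def mult.commute[of _ "d \<bullet> g"])

lemma gradient_on:
  fixes S :: "'a::{real_inner, complete_space} set"
  assumes S: "subspace S" "closed S" "x \<in> S" and h: "h differentiable (at x within S)"
  shows "gradient_on S h x \<in> S" "(h has_derivative (\<lambda>d. d \<bullet> gradient_on S h x)) (at x within S)"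
proof -
  let ?grad = "\<lambda>g. g \<in> S \<and> (h has_derivative (\<lambda>d. d \<bullet> g)) (at x within S)"
  obtain E where E: "(h has_derivative E) (at x within S)" using h by (auto simp: differentiable_def)
  interpret E: bounded_linear E using E by (rule has_derivative_bounded_linear)
  obtain B where B: "\<And>x. norm (E x) \<le> norm x * B" using E.bounded by blast
  have "\<exists>g\<in>S. \<forall>d\<in>S. E d = d \<bullet> g"
    by (rule subspace_Riesz[OF S(1,2), where B = B])
      (use B in \<open>auto simp: E.add E.scaleR mult.commute[of B]\<close>)
  then obtain g where g: "g \<in> S" "\<And>d. d \<in> S \<Longrightarrow> E d = d \<bullet> g" by blast
  have "(h has_derivative (\<lambda>d. d \<bullet> g)) (at x within S)"
    using E S g by (auto simp: has_derivative_within_alt subspace_diff bounded_linear_inner_left)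
  with g have "?grad g" by blast
  moreover have "g' = g" if g': "?grad g'" for g'
  proof -
    have d: "g' - g \<in> S" using g g' S by (simp add: subspace_diff)
    have "(g' - g) \<bullet> g' = (g' - g) \<bullet> g"
      using DERIV_unique has_gradient_within_line[OF _ S(1,3) d] g' \<open>?grad g\<close> by blast
    then have "(g' - g) \<bullet> (g' - g) = 0" by (simp add: inner_diff_right)
    then show ?thesis by simp
  qed
  ultimately have "?grad (gradient_on S h x)" unfolding gradient_on_def by (rule theI)
  then show "gradient_on S h x \<in> S" "(h has_derivative (\<lambda>d. d \<bullet> gradient_on S h x)) (at x within S)" by auto
qed

lemma convex_gradient_inequality:
  assumes h: "convex_on S h" and g: "(h has_derivative (\<lambda>d. d \<bullet> g)) (at x within S)"
    and S: "subspace S" "x \<in> S" "y \<in> S"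
  shows "h x + (y - x) \<bullet> g \<le> h y"
proof -
  have "((\<lambda>t::real. h (x + t *\<^sub>R (y - x))) has_real_derivative (y - x) \<bullet> g) (at 0)"
    by (rule has_gradient_within_line[OF g]) (use S in \<open>auto simp: subspace_diff\<close>)
  then have "((\<lambda>t::real. (h (x + t *\<^sub>R (y - x)) - h x) / t) \<longlongrightarrow> (y - x) \<bullet> g) (at 0)"
    by (simp add: DERIV_def)
  then have lim: "((\<lambda>t::real. (h (x + t *\<^sub>R (y - x)) - h x) / t) \<longlongrightarrow> (y - x) \<bullet> g) (at_right 0)"
    by (rule tendsto_mono[rotated]) (simp add: at_le)
  have "(h (x + t *\<^sub>R (y - x)) - h x) / t \<le> h y - h x" if t: "0 < t" "t < 1" for t :: real
  proof -
    have "x + t *\<^sub>R (y - x) = (1 - t) *\<^sub>R x + t *\<^sub>R y" by (simp add: algebra_simps)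
    then have "h (x + t *\<^sub>R (y - x)) \<le> (1 - t) * h x + t * h y"
      using convex_onD[OF h, of t x y] S t by simp
    then show ?thesis using t by (simp add: field_simps)
  qed
  then have "\<forall>\<^sub>F t in at_right 0. (h (x + t *\<^sub>R (y - x)) - h x) / t \<le> h y - h x"
    unfolding eventually_at_right_field by (intro exI[of _ 1]) auto
  with lim have "(y - x) \<bullet> g \<le> h y - h x" by (rule tendsto_upperbound) simp
  then show ?thesis by simp
qed

text \<open>
  Nonexpansiveness of the resolvent: \<open>abar\<close> is the resolvent of \<open>abar + r ubar\<close> as \<open>a\<close> is that of \<open>\<xi>\<close>, with the same
  parameter.  Since \<open>r\<close> is arbitrary here, this bounds iterates computed with varying parameters.
\<close>

lemma resolvent_distance:
  fixes a :: "'a::real_inner"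
  assumes \<phi>: "\<phi> \<in> Gamma0 S" and a: "a \<in> S" "u \<in> subdifferential S \<phi> a"
    and abar: "abar \<in> S" "ubar \<in> subdifferential S \<phi> abar" and r: "0 < r"
    and u: "u = inverse r *\<^sub>R (\<xi> - a)"
  shows "norm (a - abar) \<le> norm (\<xi> - abar - r *\<^sub>R ubar)"
    and "norm (u - ubar) \<le> 2 * inverse r * norm (\<xi> - abar - r *\<^sub>R ubar)"
proof -
  define e where "e = \<xi> - abar - r *\<^sub>R ubar"
  have ue: "u - ubar = inverse r *\<^sub>R (e - (a - abar))"
    using r by (simp add: u e_def algebra_simps)
  have "0 \<le> (a - abar) \<bullet> (u - ubar)" by (rule subdifferential_monotone[OF \<phi> a abar])
  then have "0 \<le> (a - abar) \<bullet> (e - (a - abar))"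
    using r by (simp add: ue zero_le_mult_iff)
  then have "norm (a - abar) * norm (a - abar) \<le> (a - abar) \<bullet> e"
    by (simp add: inner_diff_right power2_eq_square flip: power2_norm_eq_inner)
  also have "\<dots> \<le> norm (a - abar) * norm e" by (rule norm_cauchy_schwarz)
  finally have le: "norm (a - abar) \<le> norm e"
    by (cases "norm (a - abar) = 0") (auto simp: mult_le_cancel_left_pos)
  then show "norm (a - abar) \<le> norm (\<xi> - abar - r *\<^sub>R ubar)" by (simp add: e_def)
  have "norm (u - ubar) = inverse r * norm (e - (a - abar))" using r by (simp add: ue)
  also have "\<dots> \<le> inverse r * (2 * norm e)"
    using le norm_triangle_ineq4[of e "a - abar"] r by (intro mult_left_mono) auto
  finally show "norm (u - ubar) \<le> 2 * inverse r * norm (\<xi> - abar - r *\<^sub>R ubar)" by (simp add: e_def)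
qed

lemma ereal_sum_not_MInf: "(\<And>i. i \<in> A \<Longrightarrow> f i \<noteq> -\<infinity>) \<Longrightarrow> (\<Sum>i\<in>A. f i) \<noteq> (-\<infinity>::ereal)"
  by (induction A rule: infinite_finite_induct) auto

lemma replace_in_direct_sum: "x \<in> direct_sum S \<Longrightarrow> z \<in> S i \<Longrightarrow> replace i z x \<in> direct_sum S"
  by (auto simp: direct_sum_def replace_def)

lemma replace_same: "replace i (x $ i) x = x"
  by (auto simp: replace_def vec_eq_iff)

lemma inner_replace_diff: "(replace i z x - x) \<bullet> u = (z - x $ i) \<bullet> (u $ i)"
proof -
  have "(replace i z x - x) \<bullet> u = (\<Sum>j\<in>UNIV. if j = i then (z - x $ i) \<bullet> (u $ i) else 0)"
    unfolding inner_vec_def by (intro sum.cong) (auto simp: replace_def)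
  then show ?thesis by simp
qed

section \<open>Kuhn--Tucker points of the equilibrium problem\<close>

locale nash_problem =
  fixes \<H> :: "'i::finite \<Rightarrow> 'h::{real_inner, complete_space} set"
    and \<G> :: "'k::finite \<Rightarrow> 'g::{real_inner, complete_space} set"
    and \<phi> :: "'i \<Rightarrow> 'h \<Rightarrow> ereal"
    and f :: "'i \<Rightarrow> 'h ^ 'i \<Rightarrow> real"
    and g :: "'k \<Rightarrow> 'g \<Rightarrow> ereal"
    and L :: "'k \<Rightarrow> 'h ^ 'i \<Rightarrow> 'g"
  assumes hilbert_H: "\<And>i. subspace (\<H> i)" "\<And>i. closed (\<H> i)"
    and hilbert_G: "\<And>k. subspace (\<G> k)" "\<And>k. closed (\<G> k)"
    and phi: "\<And>i. \<phi> i \<in> Gamma0 (\<H> i)"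
    and f_convex: "\<And>i y. y \<in> direct_sum \<H> \<Longrightarrow> convex_on (\<H> i) (\<lambda>z. f i (replace i z y))"
    and f_diff: "\<And>i y. y \<in> direct_sum \<H> \<Longrightarrow> (\<lambda>z. f i (replace i z y)) differentiable_on (\<H> i)"
    and G_monotone: "monotone_operator_on (direct_sum \<H>) (gradient_operator \<H> f)"
    and G_lipschitz: "\<exists>C. lipschitz_on C (direct_sum \<H>) (gradient_operator \<H> f)"
    and g: "\<And>k. g k \<in> Gamma0 (\<G> k)"
    and L: "\<And>k. bounded_linear_between (direct_sum \<H>) (\<G> k) (L k)"
begin

abbreviation "DH \<equiv> direct_sum \<H>"
abbreviation "DG \<equiv> direct_sum \<G>"
abbreviation "GG \<equiv> gradient_operator \<H> f"
definition "LL y = (\<chi> k. L k y)"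
definition "Adj v = adjoint_on DH LL v"

text \<open>
  All nonsmooth terms as a single separable function on the product space.  It belongs to \<^const>\<open>Gamma0\<close>, so
  that the blockwise inclusions become one inclusion and a single weak lower semicontinuity argument suffices.
\<close>

definition Phi :: "('h ^ 'i) \<times> ('g ^ 'k) \<Rightarrow> ereal" where
  "Phi u = (\<Sum>i\<in>UNIV. \<phi> i (fst u $ i)) + (\<Sum>k\<in>UNIV. g k (snd u $ k))"

text \<open>
  Kuhn--Tucker points, the zeros of the monotone operator
  \<open>(x, v) \<mapsto> (\<partial>\<phi> x + G x + L\<^sup>* v) \<times> (\<partial>g\<^sup>* v - L x)\<close>.  The second inclusion is written as \<open>v \<in> \<partial>g (L x)\<close>, so that both
  of them together form one subgradient inclusion for \<^const>\<open>Phi\<close>.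
\<close>

definition KT :: "(('h ^ 'i) \<times> ('g ^ 'k)) set" where
  "KT = {(x, v). x \<in> DH \<and> v \<in> DG \<and> (- GG x - Adj v, v) \<in> subdifferential (DH \<times> DG) Phi (x, LL x)}"

lemma DH: "subspace DH" "closed DH"
  by (auto intro: subspace_direct_sum closed_direct_sum hilbert_H)

lemma DG: "subspace DG" "closed DG"
  by (auto intro: subspace_direct_sum closed_direct_sum hilbert_G)

lemma DHG: "subspace (DH \<times> DG)" "closed (DH \<times> DG)"
  by (auto intro: subspace_Times closed_Times DH DG)

lemma DH_nth: "x \<in> DH \<Longrightarrow> x $ i \<in> \<H> i" by (simp add: direct_sum_def)
lemma DG_nth: "v \<in> DG \<Longrightarrow> v $ k \<in> \<G> k" by (simp add: direct_sum_def)

lemma LL: "bounded_linear_between DH DG LL"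
proof -
  have "\<forall>k. \<exists>B. \<forall>x\<in>DH. norm (L k x) \<le> B * norm x"
    using L by (simp add: bounded_linear_between_def)
  then obtain B where B: "\<And>k x. x \<in> DH \<Longrightarrow> norm (L k x) \<le> B k * norm x" by metis
  have "norm (LL x) \<le> (\<Sum>k\<in>UNIV. B k) * norm x" if "x \<in> DH" for x
  proof -
    have "norm (LL x) \<le> (\<Sum>k\<in>UNIV. norm (L k x))" using norm_vec_le_sum[of "LL x"] by (simp add: LL_def)
    also have "\<dots> \<le> (\<Sum>k\<in>UNIV. B k * norm x)" by (intro sum_mono B that)
    finally show ?thesis by (simp add: sum_distrib_right)
  qed
  moreover have "\<And>k x. x \<in> DH \<Longrightarrow> L k x \<in> \<G> k"
    "\<And>k x y. x \<in> DH \<Longrightarrow> y \<in> DH \<Longrightarrow> L k (x + y) = L k x + L k y"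
    "\<And>k x r. x \<in> DH \<Longrightarrow> L k (r *\<^sub>R x) = r *\<^sub>R L k x"
    using L by (auto simp: bounded_linear_between_def)
  ultimately show ?thesis
    unfolding bounded_linear_between_def by (auto simp: LL_def vec_eq_iff direct_sum_def)
qed

lemma LL_in: "x \<in> DH \<Longrightarrow> LL x \<in> DG" using LL by (simp add: bounded_linear_between_def)
lemma LL_diff: "x \<in> DH \<Longrightarrow> y \<in> DH \<Longrightarrow> LL (x - y) = LL x - LL y"
proof -
  assume xy: "x \<in> DH" "y \<in> DH"
  have "LL (x + (-1) *\<^sub>R y) = LL x + LL ((-1) *\<^sub>R y)" "LL ((-1) *\<^sub>R y) = (-1) *\<^sub>R LL y"
    using LL xy DH(1) unfolding bounded_linear_between_def by (blast intro: subspace_scale)+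
  then show ?thesis by simp
qed

lemma Adj_in: "Adj v \<in> DH" and Adj: "x \<in> DH \<Longrightarrow> x \<bullet> Adj v = LL x \<bullet> v"
  using adjoint_on[OF DH LL] by (auto simp: Adj_def)

lemma Adj_diff: "Adj (v - w) = Adj v - Adj w"
  unfolding Adj_def[of "v - w"]
  by (rule adjoint_on_unique[OF DH(1)])
    (auto simp: subspace_diff DH Adj_in inner_diff_right Adj)

lemma Adj_nth: "Adj v $ i = (\<Sum>k\<in>UNIV. adjoint_on DH (L k) (v $ k) $ i)"
proof -
  have "Adj v = (\<Sum>k\<in>UNIV. adjoint_on DH (L k) (v $ k))"
    unfolding Adj_def
  proof (rule adjoint_on_unique[OF DH(1)])
    show "(\<Sum>k\<in>UNIV. adjoint_on DH (L k) (v $ k)) \<in> DH"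
      by (intro subspace_sum DH adjoint_on(1)[OF DH L])
    show "LL x \<bullet> v = x \<bullet> (\<Sum>k\<in>UNIV. adjoint_on DH (L k) (v $ k))" if "x \<in> DH" for x
      unfolding inner_sum_right inner_vec_def[of "LL x"]
      by (intro sum.cong) (simp_all add: LL_def adjoint_on(2)[OF DH L that])
  qed
  then show ?thesis by (simp add: sum_component)
qed

lemma LL_Adj_bound:
  obtains B where "0 \<le> B" "\<And>x. x \<in> DH \<Longrightarrow> norm (LL x) \<le> B * norm x" "\<And>v. norm (Adj v) \<le> B * norm v"
proof -
  obtain B0 where B0: "\<And>x. x \<in> DH \<Longrightarrow> norm (LL x) \<le> B0 * norm x"
    using LL unfolding bounded_linear_between_def by blast
  have B: "norm (LL x) \<le> \<bar>B0\<bar> * norm x" if "x \<in> DH" for x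
    using B0[OF that] by (rule order_trans) (intro mult_right_mono, auto)
  have "norm (Adj v) \<le> \<bar>B0\<bar> * norm v" for v
  proof (cases "Adj v = 0")
    case False
    have "norm (Adj v) * norm (Adj v) = LL (Adj v) \<bullet> v"
      using Adj[OF Adj_in, of v v] by (simp add: power2_eq_square flip: power2_norm_eq_inner)
    also have "\<dots> \<le> norm (LL (Adj v)) * norm v" by (rule norm_cauchy_schwarz)
    also have "\<dots> \<le> (\<bar>B0\<bar> * norm (Adj v)) * norm v" by (intro mult_right_mono B Adj_in) auto
    finally have "norm (Adj v) * norm (Adj v) \<le> norm (Adj v) * (\<bar>B0\<bar> * norm v)" by (simp add: ac_simps)
    then show ?thesis using False by (simp add: mult_le_cancel_left_pos)
  qed simp
  with B show thesis by (intro that[of "\<bar>B0\<bar>"]) auto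
qed

lemma partial_gradient:
  assumes x: "x \<in> DH"
  shows "GG x $ i \<in> \<H> i"
    "((\<lambda>z. f i (replace i z x)) has_derivative (\<lambda>d. d \<bullet> GG x $ i)) (at (x $ i) within \<H> i)"
proof -
  have "(\<lambda>z. f i (replace i z x)) differentiable (at (x $ i) within \<H> i)"
    using f_diff[OF x] DH_nth[OF x] by (simp add: differentiable_on_def)
  from gradient_on[OF hilbert_H DH_nth[OF x] this] show "GG x $ i \<in> \<H> i"
    "((\<lambda>z. f i (replace i z x)) has_derivative (\<lambda>d. d \<bullet> GG x $ i)) (at (x $ i) within \<H> i)"
    by (simp_all add: gradient_operator_def partial_gradient_def)
qed

lemma GG_in: "x \<in> DH \<Longrightarrow> GG x \<in> DH"
  using partial_gradient(1) by (simp add: direct_sum_def)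

lemma GG_monotone: "x \<in> DH \<Longrightarrow> y \<in> DH \<Longrightarrow> 0 \<le> (x - y) \<bullet> (GG x - GG y)"
  using G_monotone by (simp add: monotone_operator_on_def)

lemma GG_lipschitz:
  obtains C where "0 \<le> C" "\<And>x y. x \<in> DH \<Longrightarrow> y \<in> DH \<Longrightarrow> norm (GG x - GG y) \<le> C * norm (x - y)"
  using G_lipschitz by (auto simp: lipschitz_on_def dist_norm)

lemma Phi_Gamma0: "Phi \<in> Gamma0 (DH \<times> DG)"
proof -
  have "\<exists>z. z \<in> \<H> i \<and> \<phi> i z < \<infinity>" for i by (rule Gamma0_proper[OF phi[of i]]) auto
  then obtain zh where zh: "\<And>i. zh i \<in> \<H> i" "\<And>i. \<phi> i (zh i) < \<infinity>" by metis
  have "\<exists>z. z \<in> \<G> k \<and> g k z < \<infinity>" for k by (rule Gamma0_proper[OF g[of k]]) auto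
  then obtain zg where zg: "\<And>k. zg k \<in> \<G> k" "\<And>k. g k (zg k) < \<infinity>" by metis
  define z where "z = ((\<chi> i. zh i), (\<chi> k. zg k))"
  have z: "z \<in> DH \<times> DG" using zh zg by (simp add: z_def direct_sum_def)
  have H: "(\<lambda>u. \<phi> i (fst u $ i)) \<in> Gamma0 (DH \<times> DG)" for i
  proof (rule Gamma0_comp[OF phi[of i]])
    show "linear (\<lambda>u::('h ^ 'i) \<times> ('g ^ 'k). fst u $ i)" by unfold_locales auto
    show "norm (fst u $ i) \<le> norm u" for u :: "('h ^ 'i) \<times> ('g ^ 'k)"
      using order_trans[OF Finite_Cartesian_Product.norm_nth_le norm_fst_le[of "fst u" "snd u"]] by simp
    show "(\<lambda>u. fst u $ i) ` (DH \<times> DG) = \<H> i"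
    proof
      show "\<H> i \<subseteq> (\<lambda>u. fst u $ i) ` (DH \<times> DG)"
      proof
        fix w assume "w \<in> \<H> i"
        with z have "(replace i w (fst z), snd z) \<in> DH \<times> DG" by (auto intro: replace_in_direct_sum)
        then show "w \<in> (\<lambda>u. fst u $ i) ` (DH \<times> DG)" by (rule rev_image_eqI) (simp add: replace_def)
      qed
    qed (auto intro: DH_nth)
  qed
  have G: "(\<lambda>u. g k (snd u $ k)) \<in> Gamma0 (DH \<times> DG)" for k
  proof (rule Gamma0_comp[OF g[of k]])
    show "linear (\<lambda>u::('h ^ 'i) \<times> ('g ^ 'k). snd u $ k)" by unfold_locales auto
    show "norm (snd u $ k) \<le> norm u" for u :: "('h ^ 'i) \<times> ('g ^ 'k)"
      using order_trans[OF Finite_Cartesian_Product.norm_nth_le norm_snd_le[of "snd u" "fst u"]] by simp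
    show "(\<lambda>u. snd u $ k) ` (DH \<times> DG) = \<G> k"
    proof
      show "\<G> k \<subseteq> (\<lambda>u. snd u $ k) ` (DH \<times> DG)"
      proof
        fix w assume "w \<in> \<G> k"
        with z have "(fst z, replace k w (snd z)) \<in> DH \<times> DG" by (auto intro: replace_in_direct_sum)
        then show "w \<in> (\<lambda>u. snd u $ k) ` (DH \<times> DG)" by (rule rev_image_eqI) (simp add: replace_def)
      qed
    qed (auto intro: DG_nth)
  qed
  show ?thesis
    unfolding Phi_def[abs_def]
  proof (rule Gamma0_add[where z = z])
    show "(\<lambda>u. \<Sum>i\<in>UNIV. \<phi> i (fst u $ i)) \<in> Gamma0 (DH \<times> DG)"
      by (rule Gamma0_sum[where z = z]) (use H z zh in \<open>auto simp: z_def\<close>)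
    show "(\<lambda>u. \<Sum>k\<in>UNIV. g k (snd u $ k)) \<in> Gamma0 (DH \<times> DG)"
      by (rule Gamma0_sum[where z = z]) (use G z zg in \<open>auto simp: z_def\<close>)
    have "(\<Sum>i\<in>UNIV. \<phi> i (fst z $ i)) \<noteq> \<infinity>" "(\<Sum>k\<in>UNIV. g k (snd z $ k)) \<noteq> \<infinity>"
      using zh(2) zg(2) by (auto simp: sum_Pinfty z_def less_top)
    then show "(\<Sum>i\<in>UNIV. \<phi> i (fst z $ i)) < \<infinity>" "(\<Sum>k\<in>UNIV. g k (snd z $ k)) < \<infinity>" by auto
  qed (rule z)
qed

lemma Phi_subgradient:
  assumes "\<And>i. as $ i \<in> subdifferential (\<H> i) (\<phi> i) (a $ i)"
    and "\<And>k. bs $ k \<in> subdifferential (\<G> k) (g k) (b $ k)"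
  shows "(as, bs) \<in> subdifferential (DH \<times> DG) Phi (a, b)"
proof -
  have "as \<in> DH" "bs \<in> DG" using assms by (auto simp: subdifferential_def direct_sum_def)
  moreover have "ereal (((y, w) - (a, b)) \<bullet> (as, bs)) + Phi (a, b) \<le> Phi (y, w)" if "y \<in> DH" "w \<in> DG" for y w
  proof -
    have "(\<Sum>i\<in>UNIV. ereal ((y $ i - a $ i) \<bullet> as $ i) + \<phi> i (a $ i)) \<le> (\<Sum>i\<in>UNIV. \<phi> i (y $ i))"
      using assms(1) DH_nth[OF that(1)] by (intro sum_mono) (auto simp: subdifferential_def)
    moreover have "(\<Sum>k\<in>UNIV. ereal ((w $ k - b $ k) \<bullet> bs $ k) + g k (b $ k)) \<le> (\<Sum>k\<in>UNIV. g k (w $ k))"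
      using assms(2) DG_nth[OF that(2)] by (intro sum_mono) (auto simp: subdifferential_def)
    ultimately have "(\<Sum>i\<in>UNIV. ereal ((y $ i - a $ i) \<bullet> as $ i) + \<phi> i (a $ i))
        + (\<Sum>k\<in>UNIV. ereal ((w $ k - b $ k) \<bullet> bs $ k) + g k (b $ k)) \<le> Phi (y, w)"
      unfolding Phi_def fst_conv snd_conv by (rule add_mono)
    moreover have "ereal (((y, w) - (a, b)) \<bullet> (as, bs))
        = (\<Sum>i\<in>UNIV. ereal ((y $ i - a $ i) \<bullet> as $ i)) + (\<Sum>k\<in>UNIV. ereal ((w $ k - b $ k) \<bullet> bs $ k))"
      by (simp add: inner_vec_def)
    ultimately show ?thesis
      unfolding Phi_def fst_conv snd_conv sum.distrib by (simp only: ac_simps)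
  qed
  ultimately show ?thesis by (auto simp: subdifferential_def)
qed

text \<open>
  Monotonicity of the Kuhn--Tucker operator: the half-space generated by a point of its graph contains all
  of its zeros.  The terms with \<open>L\<close> and its adjoint cancel.
\<close>

lemma KT_halfspace:
  assumes KT: "(x, v) \<in> KT" and ab: "a \<in> DH" "b \<in> DG"
    and sub: "(as, bs) \<in> subdifferential (DH \<times> DG) Phi (a, b)"
  shows "0 \<le> ((a, bs) - (x, v)) \<bullet> (as + GG a + Adj bs, b - LL a)"
proof -
  have x: "x \<in> DH" "v \<in> DG" and xs: "(- GG x - Adj v, v) \<in> subdifferential (DH \<times> DG) Phi (x, LL x)"
    using KT by (auto simp: KT_def)
  have "0 \<le> ((a, b) - (x, LL x)) \<bullet> ((as, bs) - (- GG x - Adj v, v))"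
    by (rule subdifferential_monotone[OF Phi_Gamma0 _ sub _ xs]) (use ab x LL_in in auto)
  then have "0 \<le> (a - x) \<bullet> (as + GG x + Adj v) + (b - LL x) \<bullet> (bs - v)"
    by (simp add: algebra_simps)
  moreover have "0 \<le> (a - x) \<bullet> (GG a - GG x)" by (rule GG_monotone[OF ab(1) x(1)])
  moreover have "(a - x) \<bullet> Adj (bs - v) = (LL a - LL x) \<bullet> (bs - v)"
    using Adj[of "a - x" "bs - v"] LL_diff[OF ab(1) x(1)] DH(1) ab x by (simp add: subspace_diff)
  then have "(a - x) \<bullet> Adj bs - (a - x) \<bullet> Adj v = (LL a - LL x) \<bullet> (bs - v)"
    by (simp add: Adj_diff inner_diff_right)
  ultimately show ?thesis
    by (simp add: inner_add_right inner_diff_right inner_diff_left inner_commute)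
qed

text \<open>
  If only block \<open>i\<close> of \<open>x\<close> is changed, to \<open>z\<close>, and the second argument of \<^const>\<open>Phi\<close> follows as \<open>L y\<close>, the dual terms
  cancel and the subgradient inequality compares the nonsmooth costs of player \<open>i\<close> up to
  the linearization of \<open>f\<^sub>i\<close>, which convexity of \<open>f\<^sub>i\<close> in its own block absorbs.
\<close>

lemma KT_nash:
  assumes KT: "(x, v) \<in> KT"
  shows "nash_solution \<H> \<phi> f g L x"
proof -
  have x: "x \<in> DH" "v \<in> DG" and xs: "(- GG x - Adj v, v) \<in> subdifferential (DH \<times> DG) Phi (x, LL x)"
    using KT by (auto simp: KT_def)
  obtain P where P: "Phi (x, LL x) = ereal P"
    by (rule subdifferential_finite[OF Phi_Gamma0 _ xs]) (use x LL_in in auto)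
  have opt: "\<phi> i (x $ i) + ereal (f i (replace i (x $ i) x)) + (\<Sum>k\<in>UNIV. g k (L k (replace i (x $ i) x)))
      \<le> \<phi> i z + ereal (f i (replace i z x)) + (\<Sum>k\<in>UNIV. g k (L k (replace i z x)))" if z: "z \<in> \<H> i" for i z
  proof -
    define y where "y = replace i z x"
    have y: "y \<in> DH" using x z by (simp add: y_def replace_in_direct_sum)
    define R where "R = (\<Sum>j\<in>UNIV - {i}. \<phi> j (x $ j))"
    define gs where "gs u = (\<Sum>k\<in>UNIV. g k (L k u))" for u
    have Phix: "Phi (x, LL x) = \<phi> i (x $ i) + R + gs x"
      unfolding Phi_def R_def gs_def by (subst sum.remove[of UNIV i]) (auto simp: LL_def)
    have "(\<Sum>j\<in>UNIV - {i}. \<phi> j (y $ j)) = R"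
      unfolding R_def by (intro sum.cong) (auto simp: y_def replace_def)
    then have Phiy: "Phi (y, LL y) = \<phi> i z + R + gs y"
      unfolding Phi_def gs_def by (subst sum.remove[of UNIV i]) (auto simp: LL_def y_def replace_def)
    have notM: "\<phi> i z \<noteq> -\<infinity>" "\<phi> i (x $ i) \<noteq> -\<infinity>" "R \<noteq> -\<infinity>" "gs x \<noteq> -\<infinity>" "gs y \<noteq> -\<infinity>"
      using Gamma0_not_MInf[OF phi] Gamma0_not_MInf[OF g] z DH_nth[OF x(1)] DG_nth[OF LL_in[OF x(1)]] DG_nth[OF LL_in[OF y]]
      by (auto simp: R_def gs_def LL_def intro!: ereal_sum_not_MInf)
    have "ereal (((y, LL y) - (x, LL x)) \<bullet> (- GG x - Adj v, v)) + Phi (x, LL x) \<le> Phi (y, LL y)"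
      using xs y LL_in[OF y] unfolding subdifferential_def by blast
    moreover have "((y, LL y) - (x, LL x)) \<bullet> (- GG x - Adj v, v) = - ((y - x) \<bullet> GG x)"
      using Adj[of "y - x" v] LL_diff[OF y x(1)] subspace_diff[OF DH(1) y x(1)]
      by (simp add: inner_diff_right)
    moreover have "(y - x) \<bullet> GG x = (z - x $ i) \<bullet> GG x $ i" unfolding y_def by (rule inner_replace_diff)
    ultimately have "ereal (- ((z - x $ i) \<bullet> GG x $ i)) + (\<phi> i (x $ i) + R + gs x) \<le> \<phi> i z + R + gs y"
      by (simp add: Phix Phiy)
    moreover have "f i x + (z - x $ i) \<bullet> GG x $ i \<le> f i y"
      using convex_gradient_inequality[OF f_convex[OF x(1)] partial_gradient(2)[OF x(1)] hilbert_H(1) DH_nth[OF x(1)] z]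
      by (simp add: replace_same y_def)
    ultimately have "\<phi> i (x $ i) + ereal (f i x) + gs x \<le> \<phi> i z + ereal (f i y) + gs y"
      using notM P unfolding Phix
      by (cases "\<phi> i (x $ i)"; cases R; cases "gs x"; cases "\<phi> i z"; cases "gs y") auto
    then show ?thesis by (simp add: replace_same y_def gs_def)
  qed
  then show ?thesis
    unfolding nash_solution_def Argmin_def is_arg_min_def using x DH_nth[OF x(1)]
    by (auto simp: not_less)
qed

text \<open>
  The critical point provided by the hypotheses uses the conjugates of the \<open>g\<^sub>k\<close>; this lemma brings it into the form of
  \<^const>\<open>KT\<close>.
\<close>

lemma KT_conjugate:
  assumes x: "x \<in> DH" and v: "v \<in> DG"
    and sub: "\<And>i. - partial_gradient \<H> f i x - (\<Sum>k\<in>UNIV. adjoint_on DH (L k) (v $ k) $ i)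
        \<in> subdifferential (\<H> i) (\<phi> i) (x $ i)"
    and conj: "\<And>k. L k x \<in> subdifferential (\<G> k) (fenchel_conjugate (\<G> k) (g k)) (v $ k)"
  shows "(- GG x - Adj v) $ i \<in> subdifferential (\<H> i) (\<phi> i) (x $ i)"
    "v $ k \<in> subdifferential (\<G> k) (g k) (LL x $ k)" "(x, v) \<in> KT"
proof -
  show s1: "(- GG x - Adj v) $ i \<in> subdifferential (\<H> i) (\<phi> i) (x $ i)" for i
    using sub[of i] by (simp add: Adj_nth gradient_operator_def)
  show s2: "v $ k \<in> subdifferential (\<G> k) (g k) (LL x $ k)" for k
    using conjugate_subgradient_flip[OF g hilbert_G _ DG_nth[OF v] conj[of k]] DG_nth[OF LL_in[OF x], of k]
    by (simp add: LL_def)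
  show "(x, v) \<in> KT"
    unfolding KT_def using x v Phi_subgradient[OF s1 s2] by simp
qed

text \<open>
  The graph of the Kuhn--Tucker operator is closed under weak convergence of points with null
  residuals.  In the subgradient inequality for \<^const>\<open>Phi\<close>, the product \<open>L a\<^sub>n \<bullet> b\<^sup>*\<^sub>n\<close> of two weakly convergent sequences
  cancels, and monotonicity of \<open>G\<close> replaces \<open>G a\<^sub>n\<close> by the fixed vector \<open>G y\<close>, so the inequality passes to the limit
  (\<open>limit\<close>).  It then involves \<open>G y\<close> instead of \<open>G x\<close>; Minty's device of testing it at \<open>x + s (y - x)\<close> and letting
  \<open>s\<close> tend to zero repairs this.
\<close>

lemma KT_demiclosed:
  fixes a as :: "nat \<Rightarrow> 'h ^ 'i" and b bs :: "nat \<Rightarrow> 'g ^ 'k"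
  assumes ab: "\<And>n. a n \<in> DH" "\<And>n. b n \<in> DG"
    and sub: "\<And>n. (as n, bs n) \<in> subdifferential (DH \<times> DG) Phi (a n, b n)"
    and xv: "x \<in> DH" "v \<in> DG"
    and weak: "weakly_converges_on DH a x" "weakly_converges_on DG bs v"
    and bound: "\<And>n. norm (a n) \<le> B" "\<And>n. norm (bs n) \<le> B"
    and ts: "(\<lambda>n. norm (as n + GG (a n) + Adj (bs n))) \<longlonglongrightarrow> 0"
    and t: "(\<lambda>n. norm (b n - LL (a n))) \<longlonglongrightarrow> 0"
  shows "(x, v) \<in> KT"
proof -
  define u where "u = (x, LL x)"
  have u: "u \<in> DH \<times> DG" using xv LL_in by (simp add: u_def)
  have ab_in: "(a n, b n) \<in> DH \<times> DG" for n using ab by simp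
  have "weakly_converges_on DG (\<lambda>n. LL (a n)) (LL x)"
    unfolding weakly_converges_on_def
  proof
    fix w
    have "(\<lambda>n. a n \<bullet> Adj w) \<longlonglongrightarrow> x \<bullet> Adj w"
      using weak(1) Adj_in unfolding weakly_converges_on_def by blast
    then show "(\<lambda>n. LL (a n) \<bullet> w) \<longlonglongrightarrow> LL x \<bullet> w" using Adj ab(1) xv(1) by simp
  qed
  then have b_weak: "weakly_converges_on DG b (LL x)"
    by (rule weakly_converges_on_add_null) (use t tendsto_norm_zero_iff in blast)
  have ab_weak: "weakly_converges_on (DH \<times> DG) (\<lambda>n. (a n, b n)) u"
    unfolding weakly_converges_on_def u_def
  proof (intro ballI, elim SigmaE)
    fix w y z assume "y \<in> DH" "z \<in> DG" "w = (y, z)"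
    then show "(\<lambda>n. (a n, b n) \<bullet> w) \<longlonglongrightarrow> (x, LL x) \<bullet> w"
      using weak(1) b_weak unfolding weakly_converges_on_def by (auto intro: tendsto_add)
  qed
  have limit: "Phi u + ereal ((x - y) \<bullet> GG y + (w - LL y) \<bullet> v) \<le> ereal C"
    if y: "y \<in> DH" and w: "w \<in> DG" and C: "Phi (y, w) = ereal C" for y w C
  proof (rule Gamma0_weak_lsc[OF Phi_Gamma0 DHG u ab_in ab_weak])
    \<comment> \<open>a lower bound for the linear term in which every product has a strongly convergent or a fixed factor\<close>
    define l where "l n = (y - a n) \<bullet> (as n + GG (a n) + Adj (bs n)) - (b n - LL (a n)) \<bullet> bs n
      + ((a n - y) \<bullet> GG y + (w - LL y) \<bullet> bs n)" for n
    have "0 \<le> B" using order_trans[OF norm_ge_zero bound(1)] .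
    have "(\<lambda>n. norm ((y - a n) \<bullet> (as n + GG (a n) + Adj (bs n)))) \<longlonglongrightarrow> 0"
    proof (rule tendsto_0_le_mult[OF ts])
      show "norm ((y - a n) \<bullet> (as n + GG (a n) + Adj (bs n)))
          \<le> (norm y + B) * norm (as n + GG (a n) + Adj (bs n))" for n
        unfolding real_norm_def
        using norm_triangle_ineq4[of y "a n"] bound(1)[of n]
        by (intro order_trans[OF Cauchy_Schwarz_ineq2] mult_right_mono) auto
    qed
    moreover have "(\<lambda>n. norm ((b n - LL (a n)) \<bullet> bs n)) \<longlonglongrightarrow> 0"
    proof (rule tendsto_0_le_mult[OF t])
      show "norm ((b n - LL (a n)) \<bullet> bs n) \<le> B * norm (b n - LL (a n))" for n
        unfolding real_norm_def mult.commute[of B]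
        by (intro order_trans[OF Cauchy_Schwarz_ineq2] mult_left_mono bound) auto
    qed
    moreover have "(\<lambda>n. a n \<bullet> GG y) \<longlonglongrightarrow> x \<bullet> GG y" "(\<lambda>n. bs n \<bullet> (w - LL y)) \<longlonglongrightarrow> v \<bullet> (w - LL y)"
      using weak GG_in[OF y] subspace_diff[OF DG(1) w LL_in[OF y]] unfolding weakly_converges_on_def by blast+
    ultimately have "l \<longlonglongrightarrow> 0 - 0 + ((x \<bullet> GG y - y \<bullet> GG y) + v \<bullet> (w - LL y))"
      unfolding l_def inner_diff_left[of _ y] inner_commute[of "w - LL y"]
      by (intro tendsto_add tendsto_diff tendsto_const) (simp_all add: tendsto_norm_zero_iff tendsto_rabs_zero_iff)
    then show "l \<longlonglongrightarrow> (x - y) \<bullet> GG y + (w - LL y) \<bullet> v" by (simp add: inner_diff_left inner_commute)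
    show "Phi (a n, b n) + ereal (l n) \<le> ereal C" for n
    proof -
      have "ereal (((y, w) - (a n, b n)) \<bullet> (as n, bs n)) + Phi (a n, b n) \<le> ereal C"
        using sub[of n] y w unfolding C[symmetric] subdifferential_def by blast
      moreover have "l n \<le> ((y, w) - (a n, b n)) \<bullet> (as n, bs n)"
      proof -
        have "(y - a n) \<bullet> Adj (bs n) = (LL y - LL (a n)) \<bullet> bs n"
          using Adj[of "y - a n" "bs n"] LL_diff[OF y ab(1)] subspace_diff[OF DH(1) y ab(1)] by simp
        moreover have "0 \<le> (a n - y) \<bullet> (GG (a n) - GG y)" by (rule GG_monotone[OF ab(1) y])
        ultimately show ?thesis
          unfolding l_def by (simp add: inner_add_right inner_diff_right inner_diff_left)
      qed
      ultimately show ?thesis by (cases "Phi (a n, b n)") auto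
    qed
  qed
  obtain y0 w0 C0 where "y0 \<in> DH" "w0 \<in> DG" "Phi (y0, w0) = ereal C0"
    using Gamma0_proper[OF Phi_Gamma0] by (metis mem_Sigma_iff surj_pair)
  then have "Phi u \<noteq> \<infinity>" using limit by fastforce
  then obtain P where P: "Phi u = ereal P"
    using Gamma0_not_MInf[OF Phi_Gamma0 u] by (cases "Phi u") auto
  obtain K where K: "0 \<le> K" "\<And>x y. x \<in> DH \<Longrightarrow> y \<in> DH \<Longrightarrow> norm (GG x - GG y) \<le> K * norm (x - y)"
    by (rule GG_lipschitz) blast
  have "ereal (((y, w) - u) \<bullet> (- GG x - Adj v, v)) + Phi u \<le> Phi (y, w)" if y: "y \<in> DH" and w: "w \<in> DG" for y w
  proof (cases "Phi (y, w)")
    case (real C)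
    \<comment> \<open>\<open>?E\<close> is the affine minorant with \<open>G x\<close> in place of \<open>G y\<close>; the Lipschitz condition controls the difference along the segment\<close>
    let ?E = "P + (x - y) \<bullet> GG x + (w - LL y) \<bullet> v"
    have le: "?E \<le> C + s * (K * (norm (x - y))\<^sup>2)" if s: "0 < s" "s < 1" for s
    proof -
      define ys where "ys = (1 - s) *\<^sub>R x + s *\<^sub>R y"
      define ws where "ws = (1 - s) *\<^sub>R LL x + s *\<^sub>R w"
      have ys: "ys \<in> DH" and ws: "ws \<in> DG"
        using DH DG xv y w LL_in by (simp_all add: ys_def ws_def subspace_add subspace_scale)
      have conv: "Phi (ys, ws) \<le> ereal ((1 - s) * P + s * C)"
        using Gamma0_convex[OF Phi_Gamma0 u, of "(y, w)" "1 - s" s] y w s P real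
        by (simp add: u_def ys_def ws_def)
      then obtain C' where C': "Phi (ys, ws) = ereal C'"
        using Gamma0_not_MInf[OF Phi_Gamma0, of "(ys, ws)"] ys ws by (cases "Phi (ys, ws)") auto
      have "LL ys = (1 - s) *\<^sub>R LL x + s *\<^sub>R LL y"
        using LL xv y DH(1) by (simp add: ys_def bounded_linear_between_def subspace_scale)
      then have "ws - LL ys = s *\<^sub>R (w - LL y)" by (simp add: ws_def algebra_simps)
      moreover have xy: "x - ys = s *\<^sub>R (x - y)" by (simp add: ys_def algebra_simps)
      ultimately have "P + (s * ((x - y) \<bullet> GG ys) + s * ((w - LL y) \<bullet> v)) \<le> C'"
        using limit[OF ys ws C'] by (simp add: P)
      also have "C' \<le> (1 - s) * P + s * C" using conv by (simp add: C')
      finally have "s * (P + (x - y) \<bullet> GG ys + (w - LL y) \<bullet> v) \<le> s * C" by (simp add: algebra_simps)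
      then have le1: "P + (x - y) \<bullet> GG ys + (w - LL y) \<bullet> v \<le> C" using s by simp
      have "(x - y) \<bullet> (GG x - GG ys) \<le> norm (x - y) * norm (GG x - GG ys)" by (rule norm_cauchy_schwarz)
      also have "\<dots> \<le> norm (x - y) * (K * norm (x - ys))"
        by (intro mult_left_mono K xv ys) auto
      also have "\<dots> = s * (K * (norm (x - y))\<^sup>2)" using s by (simp add: xy power2_eq_square)
      finally show ?thesis using le1 by (simp add: inner_diff_right)
    qed
    have "((\<lambda>s. C + s * (K * (norm (x - y))\<^sup>2)) \<longlongrightarrow> C + 0 * (K * (norm (x - y))\<^sup>2)) (at_right 0)"
      by (intro tendsto_intros)
    moreover have "\<forall>\<^sub>F s in at_right 0. ?E \<le> C + s * (K * (norm (x - y))\<^sup>2)"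
      unfolding eventually_at_right_field using le by (intro exI[of _ 1]) auto
    ultimately have "?E \<le> C + 0 * (K * (norm (x - y))\<^sup>2)" by (rule tendsto_lowerbound) simp
    moreover have "((y, w) - u) \<bullet> (- GG x - Adj v, v) = (x - y) \<bullet> GG x + (w - LL y) \<bullet> v"
      using Adj[of "y - x" v] LL_diff[OF y xv(1)] subspace_diff[OF DH(1) y xv(1)]
      by (simp add: u_def inner_diff_right inner_diff_left)
    ultimately show ?thesis by (simp add: P real)
  next
    case PInf then show ?thesis by simp
  next
    case MInf then show ?thesis using Gamma0_not_MInf[OF Phi_Gamma0, of "(y, w)"] y w by simp
  qed
  moreover have "- GG x - Adj v \<in> DH"
    using DH(1) GG_in[OF xv(1)] Adj_in by (simp add: subspace_diff subspace_neg)
  ultimately show ?thesis using xv by (auto simp: KT_def subdifferential_def u_def)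
qed

end

section \<open>Asymptotic behaviour of the iteration\<close>

text \<open>
  The Kuhn--Tucker pair \<open>(xbar, vbar)\<close> and the sweeping length \<open>m\<close> are parameters here, so that all lemmas refer to
  the same witnesses of the two existential hypotheses.
\<close>

locale nash_algorithm = nash_problem \<H> \<G> \<phi> f g L
  for \<H> :: "'i::finite \<Rightarrow> 'h::{real_inner, complete_space} set"
    and \<G> :: "'k::finite \<Rightarrow> 'g::{real_inner, complete_space} set"
    and \<phi> :: "'i \<Rightarrow> 'h \<Rightarrow> ereal"
    and f :: "'i \<Rightarrow> 'h ^ 'i \<Rightarrow> real"
    and g :: "'k \<Rightarrow> 'g \<Rightarrow> ereal"
    and L :: "'k \<Rightarrow> 'h ^ 'i \<Rightarrow> 'g" +
  fixes chi :: "'i \<Rightarrow> real"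
    and \<alpha> \<epsilon> :: real
    and lam :: "nat \<Rightarrow> real"
    and D m :: nat
    and \<gamma> :: "'i \<Rightarrow> nat \<Rightarrow> real"
    and \<mu> :: "'k \<Rightarrow> nat \<Rightarrow> real"
    and c :: "'i \<Rightarrow> nat \<Rightarrow> nat"
    and d :: "'k \<Rightarrow> nat \<Rightarrow> nat"
    and In :: "nat \<Rightarrow> 'i set"
    and Kn :: "nat \<Rightarrow> 'k set"
    and xbar :: "'h ^ 'i" and vbar :: "'g ^ 'k"
    and x xs a as ts :: "nat \<Rightarrow> 'h ^ 'i"
    and vs ys b bs t :: "nat \<Rightarrow> 'g ^ 'k"
    and p step :: "nat \<Rightarrow> real"
  assumes chi_nonneg: "\<And>i. 0 \<le> chi i"
    and chi: "\<And>y z. y \<in> direct_sum \<H> \<Longrightarrow> z \<in> direct_sum \<H> \<Longrightarrow>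
        (y - z) \<bullet> (gradient_operator \<H> f y - gradient_operator \<H> f z)
          \<le> (\<Sum>i\<in>UNIV. chi i * (norm (y $ i - z $ i))\<^sup>2)"
    and alpha: "0 < \<alpha>"
    and eps: "0 < \<epsilon>"
    and lam: "\<And>n. lam n \<in> {\<epsilon>..2 - \<epsilon>}"
    and xbar: "xbar \<in> direct_sum \<H>" and vbar: "vbar \<in> direct_sum \<G>"
    and xbar_critical: "\<And>i. - partial_gradient \<H> f i xbar
              - (\<Sum>k\<in>UNIV. adjoint_on (direct_sum \<H>) (L k) (vbar $ k) $ i)
            \<in> subdifferential (\<H> i) (\<phi> i) (xbar $ i)"
    and vbar_critical: "\<And>k. L k xbar \<in> subdifferential (\<G> k) (fenchel_conjugate (\<G> k) (g k)) (vbar $ k)"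
    and x_init: "\<And>i. x 0 $ i \<in> \<H> i"
    and gamma: "\<And>i n. \<gamma> i n \<in> {\<epsilon>..1 / (chi i + \<alpha>)}"
    and c_delay: "\<And>i n. int n - int D \<le> int (c i n) \<and> c i n \<le> n"
    and vs_init: "\<And>k. vs 0 $ k \<in> \<G> k"
    and mu: "\<And>k n. \<mu> k n \<in> {\<alpha>..1 / \<epsilon>}"
    and d_delay: "\<And>k n. int n - int D \<le> int (d k n) \<and> d k n \<le> n"
    and activation_0: "In 0 = UNIV" "Kn 0 = UNIV"
    and activation_sweep: "\<And>n. (\<Union>j\<in>{n..n + m}. In j) = UNIV" "\<And>n. (\<Union>j\<in>{n..n + m}. Kn j) = UNIV"
    and xs: "\<And>n i. i \<in> In n \<Longrightarrow>
        xs n $ i = x (c i n) $ i - \<gamma> i (c i n) *\<^sub>R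
          (partial_gradient \<H> f i (x (c i n))
            + (\<Sum>k\<in>UNIV. adjoint_on (direct_sum \<H>) (L k) (vs (c i n) $ k) $ i))"
    and a: "\<And>n i. i \<in> In n \<Longrightarrow>
        a n $ i = prox (\<H> i) (\<lambda>z. ereal (\<gamma> i (c i n)) * \<phi> i z) (xs n $ i)"
    and as: "\<And>n i. i \<in> In n \<Longrightarrow> as n $ i = inverse (\<gamma> i (c i n)) *\<^sub>R (xs n $ i - a n $ i)"
    and a_keep: "\<And>n i. i \<notin> In n \<Longrightarrow> a n $ i = a (n - 1) $ i \<and> as n $ i = as (n - 1) $ i"
    and ys: "\<And>n k. k \<in> Kn n \<Longrightarrow>
        ys n $ k = \<mu> k (d k n) *\<^sub>R (vs (d k n) $ k) + L k (x (d k n))"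
    and b: "\<And>n k. k \<in> Kn n \<Longrightarrow>
        b n $ k = prox (\<G> k) (\<lambda>z. ereal (\<mu> k (d k n)) * g k z) (ys n $ k)"
    and bs: "\<And>n k. k \<in> Kn n \<Longrightarrow> bs n $ k = inverse (\<mu> k (d k n)) *\<^sub>R (ys n $ k - b n $ k)"
    and b_keep: "\<And>n k. k \<notin> Kn n \<Longrightarrow> b n $ k = b (n - 1) $ k \<and> bs n $ k = bs (n - 1) $ k"
    and ts: "\<And>n. ts n = as n + gradient_operator \<H> f (a n)
        + adjoint_on (direct_sum \<H>) (\<lambda>y. \<chi> k. L k y) (bs n)"
    and t: "\<And>n. t n = b n - (\<chi> k. L k (a n))"
    and p: "\<And>n. p n = (a n - x n) \<bullet> ts n + t n \<bullet> (bs n - vs n)"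
    and step: "\<And>n. p n < 0 \<Longrightarrow>
        step n = lam n * p n / ((norm (t n))\<^sup>2 + (norm (ts n))\<^sup>2) \<and>
        x (Suc n) = x n + step n *\<^sub>R ts n \<and> vs (Suc n) = vs n + step n *\<^sub>R t n"
    and no_step: "\<And>n. \<not> p n < 0 \<Longrightarrow> x (Suc n) = x n \<and> vs (Suc n) = vs n"
begin

lemma ts_eq: "ts n = as n + GG (a n) + Adj (bs n)"
  by (simp add: ts Adj_def LL_def[abs_def])

lemma t_eq: "t n = b n - LL (a n)"
  by (simp add: t LL_def)

lemma gamma_bounds: "0 < \<gamma> i n" "\<gamma> i n \<le> 1 / \<alpha>" "inverse (\<gamma> i n) \<le> 1 / \<epsilon>" "chi i + \<alpha> \<le> inverse (\<gamma> i n)"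
proof -
  have g: "\<epsilon> \<le> \<gamma> i n" "\<gamma> i n \<le> 1 / (chi i + \<alpha>)" using gamma[of i n] by auto
  show pos: "0 < \<gamma> i n" using g eps by linarith
  have ca: "0 < chi i + \<alpha>" using chi_nonneg[of i] alpha by linarith
  have "1 / (chi i + \<alpha>) \<le> 1 / \<alpha>" using chi_nonneg[of i] alpha by (intro divide_left_mono) auto
  then show "\<gamma> i n \<le> 1 / \<alpha>" using g by linarith
  show "inverse (\<gamma> i n) \<le> 1 / \<epsilon>" using g eps pos by (simp add: inverse_eq_divide divide_left_mono)
  show "chi i + \<alpha> \<le> inverse (\<gamma> i n)" using g ca pos by (simp add: field_simps)
qed

lemma mu_bounds: "0 < \<mu> k n" "\<mu> k n \<le> 1 / \<epsilon>" "inverse (\<mu> k n) \<le> 1 / \<alpha>" "\<epsilon> \<le> inverse (\<mu> k n)"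
proof -
  have g: "\<alpha> \<le> \<mu> k n" "\<mu> k n \<le> 1 / \<epsilon>" using mu[of k n] by auto
  show pos: "0 < \<mu> k n" using g alpha by linarith
  show "\<mu> k n \<le> 1 / \<epsilon>" by (rule g)
  show "inverse (\<mu> k n) \<le> 1 / \<alpha>" using g alpha pos by (simp add: inverse_eq_divide divide_left_mono)
  show "\<epsilon> \<le> inverse (\<mu> k n)" using g eps pos by (simp add: field_simps)
qed

text \<open>
  The present value of block \<open>i\<close> was computed at step \<open>primal_active n i\<close>, from the iterate of index
  \<open>primal_index n i\<close>, which is at most \<open>m + D\<close> steps old; likewise for the dual blocks.  The points \<open>\<xi>\<close> and \<open>\<eta>\<close> below are the
  arguments at which the proximal operators were then evaluated.
\<close>

definition primal_active :: "nat \<Rightarrow> 'i \<Rightarrow> nat" where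
  "primal_active n i = (SOME j. i \<in> In j \<and> j \<le> n \<and> n \<le> j + m \<and> (a n $ i, as n $ i) = (a j $ i, as j $ i))"

definition dual_active :: "nat \<Rightarrow> 'k \<Rightarrow> nat" where
  "dual_active n k = (SOME j. k \<in> Kn j \<and> j \<le> n \<and> n \<le> j + m \<and> (b n $ k, bs n $ k) = (b j $ k, bs j $ k))"

definition "primal_index n i = c i (primal_active n i)"
definition "dual_index n k = d k (dual_active n k)"

lemma primal_active: "i \<in> In (primal_active n i)" "primal_active n i \<le> n" "n \<le> primal_active n i + m" "a n $ i = a (primal_active n i) $ i" "as n $ i = as (primal_active n i) $ i"
  using someI_ex[OF last_activation[where In = In and y = "\<lambda>n. (a n $ i, as n $ i)" and n = n and i = i and m = m,
        OF activation_0(1) activation_sweep(1)], folded primal_active_def] a_keep by auto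

lemma dual_active: "k \<in> Kn (dual_active n k)" "dual_active n k \<le> n" "n \<le> dual_active n k + m" "b n $ k = b (dual_active n k) $ k" "bs n $ k = bs (dual_active n k) $ k"
  using someI_ex[OF last_activation[where In = Kn and y = "\<lambda>n. (b n $ k, bs n $ k)" and n = n and i = k and m = m,
        OF activation_0(2) activation_sweep(2)], folded dual_active_def] b_keep by auto

lemma primal_index_lag: "primal_index n i \<le> n" "n \<le> primal_index n i + (m + D)"
  using primal_active(2,3)[of n i] c_delay[of "primal_active n i" i] by (auto simp: primal_index_def)

lemma dual_index_lag: "dual_index n k \<le> n" "n \<le> dual_index n k + (m + D)"
  using dual_active(2,3)[of n k] d_delay[of "dual_active n k" k] by (auto simp: dual_index_def)

definition "primal_param n i = \<gamma> i (primal_index n i)"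
definition "dual_param n k = \<mu> k (dual_index n k)"
definition "\<xi> n i = x (primal_index n i) $ i - primal_param n i *\<^sub>R (GG (x (primal_index n i)) + Adj (vs (primal_index n i))) $ i"
definition "\<eta> n k = dual_param n k *\<^sub>R (vs (dual_index n k) $ k) + LL (x (dual_index n k)) $ k"

lemma primal_update:
  "a n $ i = prox (\<H> i) (\<lambda>z. ereal (primal_param n i) * \<phi> i z) (\<xi> n i)"
  "as n $ i = inverse (primal_param n i) *\<^sub>R (\<xi> n i - a n $ i)"
proof -
  have "xs (primal_active n i) $ i = \<xi> n i"
    using xs[OF primal_active(1)[where n = n]] by (simp add: \<xi>_def primal_param_def primal_index_def Adj_nth gradient_operator_def)
  then show "a n $ i = prox (\<H> i) (\<lambda>z. ereal (primal_param n i) * \<phi> i z) (\<xi> n i)"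
    "as n $ i = inverse (primal_param n i) *\<^sub>R (\<xi> n i - a n $ i)"
    using a[OF primal_active(1)[where n = n]] as[OF primal_active(1)[where n = n]] primal_active(4,5)[of n i]
    by (simp_all add: primal_param_def primal_index_def)
qed

lemma dual_update:
  "b n $ k = prox (\<G> k) (\<lambda>z. ereal (dual_param n k) * g k z) (\<eta> n k)"
  "bs n $ k = inverse (dual_param n k) *\<^sub>R (\<eta> n k - b n $ k)"
proof -
  have "ys (dual_active n k) $ k = \<eta> n k"
    using ys[OF dual_active(1)[where n = n]] by (simp add: \<eta>_def dual_param_def dual_index_def LL_def)
  then show "b n $ k = prox (\<G> k) (\<lambda>z. ereal (dual_param n k) * g k z) (\<eta> n k)"
    "bs n $ k = inverse (dual_param n k) *\<^sub>R (\<eta> n k - b n $ k)"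
    using b[OF dual_active(1)[where n = n]] bs[OF dual_active(1)[where n = n]] dual_active(4,5)[of n k]
    by (simp_all add: dual_param_def dual_index_def)
qed

text \<open>
  Stated with membership of the past iterates as a hypothesis, so that it serves in the induction that
  establishes this membership.
\<close>

lemma updates_of_past:
  assumes past: "\<And>q. q \<le> n \<Longrightarrow> x q \<in> DH \<and> vs q \<in> DG"
  shows "a n $ i \<in> \<H> i" "as n $ i \<in> subdifferential (\<H> i) (\<phi> i) (a n $ i)"
    "b n $ k \<in> \<G> k" "bs n $ k \<in> subdifferential (\<G> k) (g k) (b n $ k)"
proof -
  have q: "x (primal_index n i) \<in> DH" "vs (dual_index n k) \<in> DG" "x (dual_index n k) \<in> DH"
    using past primal_index_lag(1) dual_index_lag(1) by auto
  have "GG (x (primal_index n i)) + Adj (vs (primal_index n i)) \<in> DH"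
    using q GG_in Adj_in DH(1) by (simp add: subspace_add)
  then have xi: "\<xi> n i \<in> \<H> i"
    unfolding \<xi>_def using q by (intro subspace_diff subspace_scale hilbert_H DH_nth)
  have eta: "\<eta> n k \<in> \<G> k"
    unfolding \<eta>_def using q LL_in by (intro subspace_add subspace_scale hilbert_G DG_nth)
  have pos: "0 < primal_param n i" "0 < dual_param n k" by (simp_all add: primal_param_def dual_param_def gamma_bounds mu_bounds)
  show "a n $ i \<in> \<H> i" "as n $ i \<in> subdifferential (\<H> i) (\<phi> i) (a n $ i)"
    using prox_scaled_subgradient[OF phi hilbert_H xi pos(1) primal_update(1)]
    by (simp_all add: primal_update(2))
  show "b n $ k \<in> \<G> k" "bs n $ k \<in> subdifferential (\<G> k) (g k) (b n $ k)"
    using prox_scaled_subgradient[OF g hilbert_G eta pos(2) dual_update(1)]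
    by (simp_all add: dual_update(2))
qed

lemma iterates_in: "x n \<in> DH \<and> vs n \<in> DG"
proof (induction n rule: less_induct)
  case (less n)
  show ?case
  proof (cases n)
    case 0 then show ?thesis using x_init vs_init by (simp add: direct_sum_def)
  next
    case (Suc l)
    have past: "x q \<in> DH \<and> vs q \<in> DG" if "q \<le> l" for q using less that Suc by simp
    note up = updates_of_past[of l, OF past]
    have "a l \<in> DH" "b l \<in> DG" "as l \<in> DH" "bs l \<in> DG"
      using up by (auto simp: direct_sum_def subdifferential_def)
    then have "ts l \<in> DH" "t l \<in> DG"
      using GG_in Adj_in LL_in DH(1) DG(1) by (simp_all add: ts_eq t_eq subspace_add subspace_diff)
    then show ?thesis
      using past[of l] step[of l] no_step[of l] DH(1) DG(1) Suc
      by (cases "p l < 0") (auto simp: subspace_add subspace_scale)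
  qed
qed

lemma x_in: "x n \<in> DH" and vs_in: "vs n \<in> DG" using iterates_in by auto

lemma a_nth_in: "a n $ i \<in> \<H> i" and as_subgradient: "as n $ i \<in> subdifferential (\<H> i) (\<phi> i) (a n $ i)"
  and b_nth_in: "b n $ k \<in> \<G> k" and bs_subgradient: "bs n $ k \<in> subdifferential (\<G> k) (g k) (b n $ k)"
  using updates_of_past iterates_in by auto

lemma ab_in: "a n \<in> DH" "b n \<in> DG"
  using a_nth_in b_nth_in by (auto simp: direct_sum_def)

lemma Phi_sub: "(as n, bs n) \<in> subdifferential (DH \<times> DG) Phi (a n, b n)"
  by (rule Phi_subgradient[OF as_subgradient bs_subgradient])

definition "z n = (x n, vs n)"

lemma z_in: "z n \<in> DH \<times> DG" by (simp add: z_def x_in vs_in)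

lemma KT_bar: "(xbar, vbar) \<in> KT"
  and xbar_sub: "(- GG xbar - Adj vbar) $ i \<in> subdifferential (\<H> i) (\<phi> i) (xbar $ i)"
  and vbar_sub: "vbar $ k \<in> subdifferential (\<G> k) (g k) (LL xbar $ k)"
  using KT_conjugate[OF xbar vbar xbar_critical vbar_critical] by auto

text \<open>
  In the product space, \<open>p n\<close> is the value at \<open>z n\<close> of the affine function that defines the half-space attached
  to the point \<open>((a n, bs n), (ts n, t n))\<close> of the graph of the Kuhn--Tucker operator.
\<close>

lemma projection_step:
  assumes "zbar \<in> KT"
  shows "(norm (z (Suc n) - zbar))\<^sup>2 + (\<epsilon> / 2) * (norm (z (Suc n) - z n))\<^sup>2 \<le> (norm (z n - zbar))\<^sup>2"
    "\<epsilon> * max 0 (- p n) \<le> norm (z (Suc n) - z n) * norm (ts n, t n)"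
proof -
  obtain y w where zbar: "zbar = (y, w)" by (cases zbar)
  have l: "0 < \<epsilon>" "\<epsilon> \<le> lam n" "lam n \<le> 2 - \<epsilon>" using lam[of n] eps by auto
  have pn: "p n = ((a n, bs n) - z n) \<bullet> (ts n, t n)"
    by (simp add: p z_def inner_commute)
  have half: "0 \<le> ((a n, bs n) - zbar) \<bullet> (ts n, t n)"
    unfolding zbar ts_eq t_eq by (rule KT_halfspace[OF assms[unfolded zbar] ab_in Phi_sub])
  have nrm: "(norm (ts n, t n))\<^sup>2 = (norm (t n))\<^sup>2 + (norm (ts n))\<^sup>2"
    by (simp add: norm_Pair)
  have st: "z (Suc n) = z n + (lam n * p n / (norm (ts n, t n))\<^sup>2) *\<^sub>R (ts n, t n)" if "p n < 0"
    using step[OF that] by (simp add: z_def nrm)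
  have no: "z (Suc n) = z n" if "\<not> p n < 0" using no_step[OF that] by (simp add: z_def)
  show "(norm (z (Suc n) - zbar))\<^sup>2 + (\<epsilon> / 2) * (norm (z (Suc n) - z n))\<^sup>2 \<le> (norm (z n - zbar))\<^sup>2"
    "\<epsilon> * max 0 (- p n) \<le> norm (z (Suc n) - z n) * norm (ts n, t n)"
    by (rule relaxed_projection_step[OF l pn half st no]; assumption)+
qed

lemma dist_KT_convergent: "zbar \<in> KT \<Longrightarrow> convergent (\<lambda>n. norm (z n - zbar))"
  by (rule Fejer_sequence_converges(1)[where c = "\<epsilon> / 2"]) (use eps projection_step in auto)

lemma z_increments: "(\<lambda>n. norm (z (Suc n) - z n)) \<longlonglongrightarrow> 0"
  by (rule Fejer_sequence_converges(2)[where c = "\<epsilon> / 2" and w = "(xbar, vbar)"])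
    (use eps projection_step[OF KT_bar] in auto)

lemma z_bounded: obtains R where "0 \<le> R" "\<And>n. norm (z n - (xbar, vbar)) \<le> R"
proof -
  have "Bseq (\<lambda>n. norm (z n - (xbar, vbar)))" by (rule convergent_imp_Bseq[OF dist_KT_convergent[OF KT_bar]])
  then obtain R where "0 < R" "\<And>n. norm (norm (z n - (xbar, vbar))) \<le> R" unfolding Bseq_def by blast
  then show thesis by (intro that[of R]) auto
qed

lemma norm_fst_z: "norm (x n - y) \<le> norm (z n - (y, w))" and norm_snd_z: "norm (vs n - w) \<le> norm (z n - (y, w))"
  using norm_fst_le[of "x n - y" "vs n - w"] norm_snd_le[of "vs n - w" "x n - y"] by (simp_all add: z_def)

lemmas norm_nth = Finite_Cartesian_Product.norm_nth_le

text \<open>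
  The iterates are bounded, being Fejer monotone, and the proximal steps are compared with the
  Kuhn--Tucker point through nonexpansiveness of resolvents, uniformly because the parameters lie in a
  compact subset of the positive reals.
\<close>

lemma updates_bounded:
  obtains M where "\<And>n. norm (a n) \<le> M" "\<And>n. norm (bs n) \<le> M" "\<And>n. norm (ts n, t n) \<le> M"
    "\<And>n. norm (a n - x n) \<le> M" "\<And>n. norm (b n - LL (x n)) \<le> M"
proof -
  obtain C where C: "0 \<le> C" "\<And>x y. x \<in> DH \<Longrightarrow> y \<in> DH \<Longrightarrow> norm (GG x - GG y) \<le> C * norm (x - y)"
    by (rule GG_lipschitz) blast
  obtain B where B: "0 \<le> B" "\<And>x. x \<in> DH \<Longrightarrow> norm (LL x) \<le> B * norm x" "\<And>v. norm (Adj v) \<le> B * norm v"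
    by (rule LL_Adj_bound) blast
  obtain R where R: "0 \<le> R" "\<And>n. norm (z n - (xbar, vbar)) \<le> R" by (rule z_bounded) blast
  have Rx: "norm (x n - xbar) \<le> R" and Rv: "norm (vs n - vbar) \<le> R" for n
    using norm_fst_z[of n xbar vbar] norm_snd_z[of n vbar xbar] R(2)[of n] by linarith+
  define E where "E = R + (C * R + B * R) / \<alpha>"
  define F where "F = R / \<epsilon> + B * R"
  have E0: "0 \<le> E" and F0: "0 \<le> F" using R B C alpha eps by (auto simp: E_def F_def)
  have primal: "norm (\<xi> n i - xbar $ i - primal_param n i *\<^sub>R (- GG xbar - Adj vbar) $ i) \<le> E" for n i
  proof -
    let ?q = "primal_index n i"
    have eq: "\<xi> n i - xbar $ i - primal_param n i *\<^sub>R (- GG xbar - Adj vbar) $ i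
      = (x ?q - xbar) $ i - primal_param n i *\<^sub>R ((GG (x ?q) - GG xbar) + Adj (vs ?q - vbar)) $ i"
      by (simp add: \<xi>_def Adj_diff algebra_simps)
    have "norm ((x ?q - xbar) $ i) \<le> R" using norm_nth[of "x ?q - xbar" i] Rx[of ?q] by linarith
    moreover have "norm (primal_param n i *\<^sub>R ((GG (x ?q) - GG xbar) + Adj (vs ?q - vbar)) $ i) \<le> (1 / \<alpha>) * (C * R + B * R)"
      (is "norm (_ *\<^sub>R ?w $ i) \<le> _")
    proof -
      have "norm (?w $ i) \<le> norm ?w" by (rule norm_nth)
      also have "\<dots> \<le> norm (GG (x ?q) - GG xbar) + norm (Adj (vs ?q - vbar))" by (rule norm_triangle_ineq)
      also have "\<dots> \<le> C * norm (x ?q - xbar) + B * norm (vs ?q - vbar)"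
        by (intro add_mono C B x_in xbar)
      also have "\<dots> \<le> C * R + B * R" by (intro add_mono mult_left_mono Rx Rv C B)
      finally have "norm (?w $ i) \<le> C * R + B * R" .
      then show ?thesis
        unfolding norm_scaleR using gamma_bounds(1,2)[of i ?q] alpha R B C
        by (intro mult_mono) (auto simp: primal_param_def)
    qed
    ultimately show ?thesis
      unfolding eq E_def
      using norm_triangle_ineq4[of "(x ?q - xbar) $ i" "primal_param n i *\<^sub>R ((GG (x ?q) - GG xbar) + Adj (vs ?q - vbar)) $ i"]
      by simp
  qed
  have dual: "norm (\<eta> n k - LL xbar $ k - dual_param n k *\<^sub>R vbar $ k) \<le> F" for n k
  proof -
    let ?q = "dual_index n k"
    have eq: "\<eta> n k - LL xbar $ k - dual_param n k *\<^sub>R vbar $ k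
      = dual_param n k *\<^sub>R (vs ?q - vbar) $ k + LL (x ?q - xbar) $ k"
      by (simp add: \<eta>_def LL_diff[OF x_in xbar] algebra_simps)
    have "norm (dual_param n k *\<^sub>R (vs ?q - vbar) $ k) \<le> (1 / \<epsilon>) * R"
      unfolding norm_scaleR using mu_bounds(1,2)[of k ?q] eps R order_trans[OF norm_nth Rv, of ?q k]
      by (intro mult_mono) (auto simp: dual_param_def)
    moreover have "norm (LL (x ?q - xbar) $ k) \<le> B * R"
    proof -
      have "norm (LL (x ?q - xbar) $ k) \<le> norm (LL (x ?q - xbar))" by (rule norm_nth)
      also have "\<dots> \<le> B * norm (x ?q - xbar)" by (intro B subspace_diff DH x_in xbar)
      also have "\<dots> \<le> B * R" by (intro mult_left_mono Rx B)
      finally show ?thesis .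
    qed
    ultimately show ?thesis unfolding eq F_def
      using norm_triangle_ineq[of "dual_param n k *\<^sub>R (vs ?q - vbar) $ k" "LL (x ?q - xbar) $ k"] by simp
  qed
  have pos: "0 < primal_param n i" "0 < dual_param n k" for n i k by (simp_all add: primal_param_def dual_param_def gamma_bounds mu_bounds)
  note resP = resolvent_distance[OF phi a_nth_in as_subgradient DH_nth[OF xbar] xbar_sub pos(1) primal_update(2)]
  note resD = resolvent_distance[OF g b_nth_in bs_subgradient DG_nth[OF LL_in[OF xbar]] vbar_sub pos(2) dual_update(2)]
  have a_nth: "norm (a n $ i - xbar $ i) \<le> E" for n i
    using resP(1)[of n i] primal[of n i] by linarith
  have b_nth: "norm (b n $ k - LL xbar $ k) \<le> F" for n k
    using resD(1)[of n k] dual[of n k] by linarith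
  have as_nth: "norm (as n $ i - (- GG xbar - Adj vbar) $ i) \<le> 2 * (1 / \<epsilon>) * E" for n i
  proof (rule order_trans[OF resP(2)])
    show "2 * inverse (primal_param n i) * norm (\<xi> n i - xbar $ i - primal_param n i *\<^sub>R (- GG xbar - Adj vbar) $ i) \<le> 2 * (1 / \<epsilon>) * E"
      using gamma_bounds(1,3)[of i "primal_index n i"] primal[of n i] eps
      by (intro mult_mono) (auto simp: primal_param_def)
  qed
  have bs_nth: "norm (bs n $ k - vbar $ k) \<le> 2 * (1 / \<alpha>) * F" for n k
  proof (rule order_trans[OF resD(2)])
    show "2 * inverse (dual_param n k) * norm (\<eta> n k - LL xbar $ k - dual_param n k *\<^sub>R vbar $ k) \<le> 2 * (1 / \<alpha>) * F"
      using mu_bounds(1,3)[of k "dual_index n k"] dual[of n k] alpha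
      by (intro mult_mono) (auto simp: dual_param_def)
  qed
  define M1 where "M1 = real CARD('i) * E"
  define M2 where "M2 = real CARD('k) * F"
  define M3 where "M3 = real CARD('i) * (2 * (1 / \<epsilon>) * E)"
  define M4 where "M4 = real CARD('k) * (2 * (1 / \<alpha>) * F)"
  have vec_bound: "norm u \<le> real CARD('n) * K" if "\<And>i. norm (u $ i) \<le> K" for u :: "'b::real_normed_vector ^ 'n::finite" and K
    by (rule order_trans[OF norm_vec_le_sum sum_bounded_above]) (use that in auto)
  have 1: "norm (a n - xbar) \<le> M1" for n unfolding M1_def by (rule vec_bound) (simp add: a_nth)
  have 2: "norm (b n - LL xbar) \<le> M2" for n unfolding M2_def by (rule vec_bound) (simp add: b_nth)
  have 3: "norm (as n - (- GG xbar - Adj vbar)) \<le> M3" for n unfolding M3_def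
    by (rule vec_bound) (use as_nth in simp)
  have 4: "norm (bs n - vbar) \<le> M4" for n unfolding M4_def by (rule vec_bound) (use bs_nth in simp)
  have ts_bound: "norm (ts n) \<le> M3 + C * M1 + B * M4" for n
  proof -
    have split: "ts n = (as n - (- GG xbar - Adj vbar)) + (GG (a n) - GG xbar) + Adj (bs n - vbar)"
      by (simp add: ts_eq Adj_diff)
    have "norm (ts n) \<le> norm (as n - (- GG xbar - Adj vbar)) + norm (GG (a n) - GG xbar) + norm (Adj (bs n - vbar))" unfolding split
      by (meson add_right_mono norm_triangle_ineq order_trans)
    also have "\<dots> \<le> M3 + C * norm (a n - xbar) + B * norm (bs n - vbar)"
      by (intro add_mono 3 C B ab_in xbar)
    also have "\<dots> \<le> M3 + C * M1 + B * M4" by (intro add_mono mult_left_mono 1 4 C B order_refl)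
    finally show ?thesis .
  qed
  have t_bound: "norm (t n) \<le> M2 + B * M1" for n
  proof -
    have split: "t n = (b n - LL xbar) - LL (a n - xbar)" by (simp add: t_eq LL_diff[OF ab_in(1) xbar])
    have "norm (t n) \<le> norm (b n - LL xbar) + norm (LL (a n - xbar))" unfolding split by (rule norm_triangle_ineq4)
    also have "\<dots> \<le> M2 + B * norm (a n - xbar)"
      by (intro add_mono 2 B subspace_diff DH ab_in xbar)
    also have "\<dots> \<le> M2 + B * M1" by (intro add_mono mult_left_mono 1 B order_refl)
    finally show ?thesis .
  qed
  have ax: "norm (a n - x n) \<le> M1 + R" for n
    using norm_triangle_ineq4[of "a n - xbar" "x n - xbar"] 1[of n] Rx[of n] by simp
  have bx: "norm (b n - LL (x n)) \<le> M2 + B * R" for n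
  proof -
    have split: "b n - LL (x n) = (b n - LL xbar) - LL (x n - xbar)" by (simp add: LL_diff[OF x_in xbar])
    have "norm (b n - LL (x n)) \<le> norm (b n - LL xbar) + norm (LL (x n - xbar))" unfolding split by (rule norm_triangle_ineq4)
    also have "\<dots> \<le> M2 + B * norm (x n - xbar)"
      by (intro add_mono 2 B subspace_diff DH x_in xbar)
    also have "\<dots> \<le> M2 + B * R" by (intro add_mono mult_left_mono Rx B order_refl)
    finally show ?thesis .
  qed
  have a_b: "norm (a n) \<le> M1 + norm xbar" "norm (bs n) \<le> M4 + norm vbar" for n
    using norm_triangle_ineq[of "a n - xbar" xbar] 1[of n] norm_triangle_ineq[of "bs n - vbar" vbar] 4[of n] by simp_all
  have tt: "norm (ts n, t n) \<le> (M3 + C * M1 + B * M4) + (M2 + B * M1)" for n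
    using norm_Pair_le[of "ts n" "t n"] ts_bound[of n] t_bound[of n] by linarith
  define M where "M = Max {M1 + norm xbar, M4 + norm vbar, (M3 + C * M1 + B * M4) + (M2 + B * M1), M1 + R, M2 + B * R}"
  have "M1 + norm xbar \<le> M" "M4 + norm vbar \<le> M" "(M3 + C * M1 + B * M4) + (M2 + B * M1) \<le> M"
    "M1 + R \<le> M" "M2 + B * R \<le> M"
    unfolding M_def by (intro Max_ge; simp)+
  then show thesis
    using a_b tt ax bx by (intro that[of M]) (blast intro: order_trans)+
qed

text \<open>
  The perturbation caused by the delays: this error and the next one would vanish if every block were updated
  from the current iterate.
\<close>

definition "primal_error n = as n - ((\<chi> i. inverse (primal_param n i) *\<^sub>R (x n - a n) $ i) - GG (x n) - Adj (vs n))"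
definition "dual_error n = bs n - (vs n + (\<chi> k. inverse (dual_param n k) *\<^sub>R (LL (x n) - b n) $ k))"

text \<open>
  Successive iterates approach each other and the delays are bounded, so the delayed iterates and the current one
  merge; all operators involved are Lipschitzian.
\<close>

lemma primal_error_null: "(\<lambda>n. norm (primal_error n)) \<longlonglongrightarrow> 0"
proof (rule vec_norm_tendsto_0)
  fix i
  obtain C where C: "0 \<le> C" "\<And>x y. x \<in> DH \<Longrightarrow> y \<in> DH \<Longrightarrow> norm (GG x - GG y) \<le> C * norm (x - y)"
    by (rule GG_lipschitz) blast
  obtain B where B: "0 \<le> B" "\<And>x. x \<in> DH \<Longrightarrow> norm (LL x) \<le> B * norm x" "\<And>v. norm (Adj v) \<le> B * norm v"
    by (rule LL_Adj_bound) blast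
  have lag: "(\<lambda>n. norm (z (primal_index n i) - z n)) \<longlonglongrightarrow> 0"
    by (rule bounded_lag_vanishes[where M = "m + D", OF z_increments]) (rule primal_index_lag)+
  show "(\<lambda>n. norm (primal_error n $ i)) \<longlonglongrightarrow> 0"
  proof (rule tendsto_0_le_mult[OF lag])
    fix n
    let ?q = "primal_index n i" and ?r = "inverse (primal_param n i)"
    have r: "0 < ?r" "?r \<le> 1 / \<epsilon>" "primal_param n i \<noteq> 0"
      using gamma_bounds(1,3)[of i ?q] by (auto simp: primal_param_def)
    have split: "primal_error n $ i = ?r *\<^sub>R (x ?q - x n) $ i - (GG (x ?q) - GG (x n)) $ i - Adj (vs ?q - vs n) $ i"
      using r by (simp add: primal_error_def primal_update(2) \<xi>_def Adj_diff algebra_simps)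
    have "norm (primal_error n $ i) \<le> norm (?r *\<^sub>R (x ?q - x n) $ i) + norm ((GG (x ?q) - GG (x n)) $ i) + norm (Adj (vs ?q - vs n) $ i)" unfolding split
      by (meson add_right_mono norm_triangle_ineq4 order_trans)
    also have "\<dots> \<le> (1 / \<epsilon>) * norm (z ?q - z n) + C * norm (z ?q - z n) + B * norm (z ?q - z n)"
    proof (intro add_mono)
      have zx: "norm (x ?q - x n) \<le> norm (z ?q - z n)" "norm (vs ?q - vs n) \<le> norm (z ?q - z n)"
        using norm_fst_z norm_snd_z by (simp_all add: z_def[of n])
      show "norm (?r *\<^sub>R (x ?q - x n) $ i) \<le> (1 / \<epsilon>) * norm (z ?q - z n)"
        unfolding norm_scaleR using r eps zx(1) norm_nth[of "x ?q - x n" i] by (intro mult_mono) auto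
      have "norm ((GG (x ?q) - GG (x n)) $ i) \<le> C * norm (x ?q - x n)"
        by (rule order_trans[OF norm_nth C(2)[OF x_in x_in]])
      also have "\<dots> \<le> C * norm (z ?q - z n)" by (intro mult_left_mono zx C)
      finally show "norm ((GG (x ?q) - GG (x n)) $ i) \<le> C * norm (z ?q - z n)" .
      have "norm (Adj (vs ?q - vs n) $ i) \<le> B * norm (vs ?q - vs n)"
        by (rule order_trans[OF norm_nth B(3)])
      also have "\<dots> \<le> B * norm (z ?q - z n)" by (intro mult_left_mono zx B)
      finally show "norm (Adj (vs ?q - vs n) $ i) \<le> B * norm (z ?q - z n)" .
    qed
    finally show "norm (primal_error n $ i) \<le> (1 / \<epsilon> + C + B) * norm (z ?q - z n)" by (simp add: algebra_simps)
  qed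
qed

lemma dual_error_null: "(\<lambda>n. norm (dual_error n)) \<longlonglongrightarrow> 0"
proof (rule vec_norm_tendsto_0)
  fix k
  obtain B where B: "0 \<le> B" "\<And>x. x \<in> DH \<Longrightarrow> norm (LL x) \<le> B * norm x" "\<And>v. norm (Adj v) \<le> B * norm v"
    by (rule LL_Adj_bound) blast
  have lag: "(\<lambda>n. norm (z (dual_index n k) - z n)) \<longlonglongrightarrow> 0"
    by (rule bounded_lag_vanishes[where M = "m + D", OF z_increments]) (rule dual_index_lag)+
  show "(\<lambda>n. norm (dual_error n $ k)) \<longlonglongrightarrow> 0"
  proof (rule tendsto_0_le_mult[OF lag])
    fix n
    let ?q = "dual_index n k" and ?r = "inverse (dual_param n k)"
    have r: "0 < ?r" "?r \<le> 1 / \<alpha>" "dual_param n k \<noteq> 0"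
      using mu_bounds(1,3)[of k ?q] by (auto simp: dual_param_def)
    have split: "dual_error n $ k = (vs ?q - vs n) $ k + ?r *\<^sub>R LL (x ?q - x n) $ k"
      using r by (simp add: dual_error_def dual_update(2) \<eta>_def LL_diff[OF x_in x_in] algebra_simps)
    have "norm (dual_error n $ k) \<le> norm ((vs ?q - vs n) $ k) + norm (?r *\<^sub>R LL (x ?q - x n) $ k)" unfolding split
      by (rule norm_triangle_ineq)
    also have "\<dots> \<le> norm (z ?q - z n) + (1 / \<alpha>) * (B * norm (z ?q - z n))"
    proof (intro add_mono)
      have zx: "norm (x ?q - x n) \<le> norm (z ?q - z n)" "norm (vs ?q - vs n) \<le> norm (z ?q - z n)"
        using norm_fst_z norm_snd_z by (simp_all add: z_def[of n])
      show "norm ((vs ?q - vs n) $ k) \<le> norm (z ?q - z n)" by (rule order_trans[OF norm_nth zx(2)])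
      have "norm (LL (x ?q - x n) $ k) \<le> B * norm (x ?q - x n)"
        by (rule order_trans[OF norm_nth B(2)]) (intro subspace_diff DH x_in)
      also have "\<dots> \<le> B * norm (z ?q - z n)" by (intro mult_left_mono zx B)
      finally show "norm (?r *\<^sub>R LL (x ?q - x n) $ k) \<le> (1 / \<alpha>) * (B * norm (z ?q - z n))"
        unfolding norm_scaleR using r alpha B(1) by (intro mult_mono) auto
    qed
    finally show "norm (dual_error n $ k) \<le> (1 + 1 / \<alpha> * B) * norm (z ?q - z n)" by (simp add: algebra_simps)
  qed
qed

text \<open>
  Substituting the updates into \<open>p n\<close>, the parts involving \<open>L\<close> and its adjoint cancel.  In each primal block,
  \<open>-\<gamma>\<^sup>-\<^sup>1 \<parallel>a - x\<parallel>\<^sup>2\<close> competes with \<open>\<langle>a - x | G a - G x\<rangle> \<le> \<chi> \<parallel>a - x\<parallel>\<^sup>2\<close>, and \<open>\<gamma> \<le> 1 / (\<chi> + \<alpha>)\<close> leaves \<open>-\<alpha> \<parallel>a - x\<parallel>\<^sup>2\<close>; in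
  each dual block, \<open>\<mu> \<le> 1 / \<epsilon>\<close> leaves \<open>-\<epsilon> \<parallel>b - L x\<parallel>\<^sup>2\<close>.
\<close>

lemma gap_estimate:
  "\<alpha> * (norm (a n - x n))\<^sup>2 + \<epsilon> * (norm (b n - LL (x n)))\<^sup>2
    \<le> max 0 (- p n) + norm (a n - x n) * norm (primal_error n) + norm (b n - LL (x n)) * norm (dual_error n)"
proof -
  define u where "u = a n - x n"
  define w where "w = b n - LL (x n)"
  define \<Gamma> where "\<Gamma> = (\<chi> i. inverse (primal_param n i) *\<^sub>R (x n - a n) $ i)"
  define N where "N = (\<chi> k. inverse (dual_param n k) *\<^sub>R (LL (x n) - b n) $ k)"
  have as_eq: "as n = primal_error n + (\<Gamma> - GG (x n) - Adj (vs n))" by (simp add: primal_error_def \<Gamma>_def)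
  have bs_eq: "bs n - vs n = dual_error n + N" by (simp add: dual_error_def N_def)
  have adj: "u \<bullet> Adj (bs n) - u \<bullet> Adj (vs n) = (LL (a n) - LL (x n)) \<bullet> (bs n - vs n)"
    using Adj[of u "bs n - vs n"] LL_diff[OF ab_in(1) x_in] subspace_diff[OF DH(1) ab_in(1) x_in]
    by (simp add: u_def Adj_diff inner_diff_right)
  have "p n = u \<bullet> primal_error n + u \<bullet> \<Gamma> + u \<bullet> (GG (a n) - GG (x n))
      + (u \<bullet> Adj (bs n) - u \<bullet> Adj (vs n)) + t n \<bullet> (bs n - vs n)"
    unfolding p ts_eq as_eq u_def[symmetric] by (simp add: inner_add_right inner_diff_right)
  also have "\<dots> = u \<bullet> primal_error n + u \<bullet> \<Gamma> + u \<bullet> (GG (a n) - GG (x n)) + w \<bullet> (bs n - vs n)"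
    unfolding adj t_eq w_def by (simp add: inner_diff_left)
  finally have pn: "p n = u \<bullet> primal_error n + u \<bullet> \<Gamma> + u \<bullet> (GG (a n) - GG (x n)) + w \<bullet> dual_error n + w \<bullet> N"
    unfolding bs_eq by (simp add: inner_add_right)
  have "u \<bullet> \<Gamma> + u \<bullet> (GG (a n) - GG (x n)) \<le> - \<alpha> * (norm u)\<^sup>2"
  proof -
    have "u \<bullet> \<Gamma> = (\<Sum>i\<in>UNIV. - inverse (primal_param n i) * (norm (u $ i))\<^sup>2)"
      unfolding inner_vec_def
      by (intro sum.cong) (simp_all add: \<Gamma>_def u_def power2_norm_eq_inner inner_diff_left inner_diff_right algebra_simps)
    moreover have "u \<bullet> (GG (a n) - GG (x n)) \<le> (\<Sum>i\<in>UNIV. chi i * (norm (u $ i))\<^sup>2)"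
      using chi[OF ab_in(1) x_in] by (simp add: u_def)
    moreover have "(\<Sum>i\<in>UNIV. (- inverse (primal_param n i) + chi i) * (norm (u $ i))\<^sup>2)
        = (\<Sum>i\<in>UNIV. - inverse (primal_param n i) * (norm (u $ i))\<^sup>2) + (\<Sum>i\<in>UNIV. chi i * (norm (u $ i))\<^sup>2)"
      by (simp only: distrib_right sum.distrib)
    ultimately have "u \<bullet> \<Gamma> + u \<bullet> (GG (a n) - GG (x n))
        \<le> (\<Sum>i\<in>UNIV. (- inverse (primal_param n i) + chi i) * (norm (u $ i))\<^sup>2)"
      by linarith
    also have "\<dots> \<le> (\<Sum>i\<in>UNIV. - \<alpha> * (norm (u $ i))\<^sup>2)"
    proof (intro sum_mono mult_right_mono)
      show "- inverse (primal_param n i) + chi i \<le> - \<alpha>" for i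
        using gamma_bounds(4)[of i "primal_index n i"] by (simp add: primal_param_def)
    qed simp
    also have "\<dots> = - \<alpha> * (norm u)\<^sup>2"
      by (simp add: power2_norm_eq_inner inner_vec_def sum_distrib_left)
    finally show ?thesis .
  qed
  moreover have "w \<bullet> N \<le> - \<epsilon> * (norm w)\<^sup>2"
  proof -
    have "w \<bullet> N = (\<Sum>k\<in>UNIV. - inverse (dual_param n k) * (norm (w $ k))\<^sup>2)"
      unfolding inner_vec_def
      by (intro sum.cong) (simp_all add: N_def w_def power2_norm_eq_inner inner_diff_left inner_diff_right algebra_simps)
    also have "\<dots> \<le> (\<Sum>k\<in>UNIV. - \<epsilon> * (norm (w $ k))\<^sup>2)"
    proof (intro sum_mono mult_right_mono)
      show "- inverse (dual_param n k) \<le> - \<epsilon>" for k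
        using mu_bounds(4)[of k "dual_index n k"] by (simp add: dual_param_def)
    qed simp
    also have "\<dots> = - \<epsilon> * (norm w)\<^sup>2"
      by (simp add: power2_norm_eq_inner inner_vec_def sum_distrib_left)
    finally show ?thesis .
  qed
  moreover have "u \<bullet> primal_error n \<le> norm u * norm (primal_error n)" "w \<bullet> dual_error n \<le> norm w * norm (dual_error n)"
    by (rule norm_cauchy_schwarz)+
  ultimately show ?thesis using pn unfolding u_def[symmetric] w_def[symmetric] by (simp add: max_def)
qed

text \<open>
  The projection step forces the negative part of \<open>p n\<close> to vanish, as the steps do and the normals are bounded;
  hence the right-hand side of the gap estimate tends to zero.
\<close>

lemma residuals_null:
  "(\<lambda>n. norm (a n - x n)) \<longlonglongrightarrow> 0" "(\<lambda>n. norm (b n - LL (x n))) \<longlonglongrightarrow> 0"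
proof -
  obtain M where M: "\<And>n. norm (ts n, t n) \<le> M" "\<And>n. norm (a n - x n) \<le> M" "\<And>n. norm (b n - LL (x n)) \<le> M"
    by (rule updates_bounded) blast
  have M0: "0 \<le> M" using order_trans[OF norm_ge_zero M(2)] .
  define U where "U n = (M * norm (z (Suc n) - z n)) / \<epsilon> + M * norm (primal_error n) + M * norm (dual_error n)" for n
  have "U \<longlonglongrightarrow> (M * 0) / \<epsilon> + M * 0 + M * 0"
    unfolding U_def using eps by (intro tendsto_intros z_increments primal_error_null dual_error_null) auto
  then have U: "U \<longlonglongrightarrow> 0" by simp
  have le: "\<alpha> * (norm (a n - x n))\<^sup>2 + \<epsilon> * (norm (b n - LL (x n)))\<^sup>2 \<le> U n" for n
  proof -
    have "\<epsilon> * max 0 (- p n) \<le> norm (z (Suc n) - z n) * norm (ts n, t n)" by (rule projection_step(2)[OF KT_bar])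
    also have "\<dots> \<le> norm (z (Suc n) - z n) * M" by (intro mult_left_mono M) simp
    finally have "max 0 (- p n) \<le> (M * norm (z (Suc n) - z n)) / \<epsilon>"
      by (simp only: pos_le_divide_eq[OF eps] mult.commute)
    moreover have "norm (a n - x n) * norm (primal_error n) \<le> M * norm (primal_error n)"
      "norm (b n - LL (x n)) * norm (dual_error n) \<le> M * norm (dual_error n)"
      by (intro mult_right_mono M norm_ge_zero)+
    ultimately show ?thesis using gap_estimate[of n] unfolding U_def by linarith
  qed
  have le_alpha: "(norm (a n - x n))\<^sup>2 \<le> U n / \<alpha>" for n
  proof -
    have "0 \<le> \<epsilon> * (norm (b n - LL (x n)))\<^sup>2" using eps by simp
    then have "\<alpha> * (norm (a n - x n))\<^sup>2 \<le> U n" using le[of n] by linarith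
    then show ?thesis using alpha by (simp add: field_simps)
  qed
  have lim_alpha: "(\<lambda>n. U n / \<alpha>) \<longlonglongrightarrow> 0" using tendsto_divide[OF U tendsto_const[of \<alpha>]] alpha by simp
  have "(\<lambda>n. (norm (a n - x n))\<^sup>2) \<longlonglongrightarrow> 0"
    by (rule tendsto_sandwich[OF _ _ tendsto_const lim_alpha]) (use le_alpha in auto)
  then show "(\<lambda>n. norm (a n - x n)) \<longlonglongrightarrow> 0" by (rule norm_tendsto_0_of_power2)
  have le_eps: "(norm (b n - LL (x n)))\<^sup>2 \<le> U n / \<epsilon>" for n
  proof -
    have "0 \<le> \<alpha> * (norm (a n - x n))\<^sup>2" using alpha by simp
    then have "\<epsilon> * (norm (b n - LL (x n)))\<^sup>2 \<le> U n" using le[of n] by linarith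
    then show ?thesis using eps by (simp add: field_simps)
  qed
  have lim_eps: "(\<lambda>n. U n / \<epsilon>) \<longlonglongrightarrow> 0" using tendsto_divide[OF U tendsto_const[of \<epsilon>]] eps by simp
  have "(\<lambda>n. (norm (b n - LL (x n)))\<^sup>2) \<longlonglongrightarrow> 0"
    by (rule tendsto_sandwich[OF _ _ tendsto_const lim_eps]) (use le_eps in auto)
  then show "(\<lambda>n. norm (b n - LL (x n))) \<longlonglongrightarrow> 0" by (rule norm_tendsto_0_of_power2)
qed

lemma dual_gap_null: "(\<lambda>n. norm (bs n - vs n)) \<longlonglongrightarrow> 0"
proof -
  have "(\<lambda>n. norm ((\<chi> k. inverse (dual_param n k) *\<^sub>R (LL (x n) - b n) $ k) :: 'g ^ 'k)) \<longlonglongrightarrow> 0"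
  proof (rule vec_norm_tendsto_0, rule tendsto_0_le_mult[OF residuals_null(2)])
    fix k n
    have "norm (inverse (dual_param n k) *\<^sub>R (LL (x n) - b n) $ k) \<le> (1 / \<alpha>) * norm (LL (x n) - b n)"
      unfolding norm_scaleR using alpha mu_bounds(1,3)[of k "dual_index n k"] norm_nth[of "LL (x n) - b n" k]
      by (intro mult_mono) (auto simp: dual_param_def)
    then show "norm ((\<chi> k. inverse (dual_param n k) *\<^sub>R (LL (x n) - b n) $ k) $ k) \<le> (1 / \<alpha>) * norm (b n - LL (x n))"
      by (simp add: norm_minus_commute)
  qed
  from tendsto_add[OF dual_error_null this]
  have lim: "(\<lambda>n. norm (dual_error n) + norm ((\<chi> k. inverse (dual_param n k) *\<^sub>R (LL (x n) - b n) $ k) :: 'g ^ 'k)) \<longlonglongrightarrow> 0"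
    by simp
  have "norm (bs n - vs n) \<le> norm (dual_error n) + norm ((\<chi> k. inverse (dual_param n k) *\<^sub>R (LL (x n) - b n) $ k) :: 'g ^ 'k)" for n
    using norm_triangle_ineq[of "dual_error n" "\<chi> k. inverse (dual_param n k) *\<^sub>R (LL (x n) - b n) $ k"]
    by (simp add: dual_error_def)
  then show ?thesis by (intro tendsto_sandwich[OF _ _ tendsto_const lim]) auto
qed

lemma normals_null: "(\<lambda>n. norm (t n)) \<longlonglongrightarrow> 0" "(\<lambda>n. norm (ts n)) \<longlonglongrightarrow> 0"
proof -
  obtain C where C: "0 \<le> C" "\<And>x y. x \<in> DH \<Longrightarrow> y \<in> DH \<Longrightarrow> norm (GG x - GG y) \<le> C * norm (x - y)"
    by (rule GG_lipschitz) blast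
  obtain B where B: "0 \<le> B" "\<And>x. x \<in> DH \<Longrightarrow> norm (LL x) \<le> B * norm x" "\<And>v. norm (Adj v) \<le> B * norm v"
    by (rule LL_Adj_bound) blast
  have "(\<lambda>n. norm (b n - LL (x n)) + B * norm (a n - x n)) \<longlonglongrightarrow> 0 + B * 0"
    by (intro tendsto_intros residuals_null)
  then have lim: "(\<lambda>n. norm (b n - LL (x n)) + B * norm (a n - x n)) \<longlonglongrightarrow> 0" by simp
  have "norm (t n) \<le> norm (b n - LL (x n)) + B * norm (a n - x n)" for n
  proof -
    have split: "t n = (b n - LL (x n)) - LL (a n - x n)" by (simp add: t_eq LL_diff[OF ab_in(1) x_in])
    have "norm (t n) \<le> norm (b n - LL (x n)) + norm (LL (a n - x n))" unfolding split by (rule norm_triangle_ineq4)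
    also have "\<dots> \<le> norm (b n - LL (x n)) + B * norm (a n - x n)"
      by (intro add_mono order_refl B subspace_diff DH ab_in x_in)
    finally show ?thesis .
  qed
  then show "(\<lambda>n. norm (t n)) \<longlonglongrightarrow> 0" by (intro tendsto_sandwich[OF _ _ tendsto_const lim]) auto
  let ?\<Gamma> = "\<lambda>n. (\<chi> i. inverse (primal_param n i) *\<^sub>R (x n - a n) $ i) :: 'h ^ 'i"
  have \<Gamma>: "(\<lambda>n. norm (?\<Gamma> n)) \<longlonglongrightarrow> 0"
  proof (rule vec_norm_tendsto_0, rule tendsto_0_le_mult[OF residuals_null(1)])
    fix i n
    have "norm (inverse (primal_param n i) *\<^sub>R (x n - a n) $ i) \<le> (1 / \<epsilon>) * norm (x n - a n)"
      unfolding norm_scaleR using eps gamma_bounds(1,3)[of i "primal_index n i"] norm_nth[of "x n - a n" i]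
      by (intro mult_mono) (auto simp: primal_param_def)
    then show "norm (?\<Gamma> n $ i) \<le> (1 / \<epsilon>) * norm (a n - x n)"
      by (simp add: norm_minus_commute)
  qed
  have "(\<lambda>n. norm (primal_error n) + norm (?\<Gamma> n) + C * norm (a n - x n) + B * norm (bs n - vs n)) \<longlonglongrightarrow> 0 + 0 + C * 0 + B * 0"
    by (intro tendsto_intros residuals_null dual_gap_null primal_error_null \<Gamma>)
  then have lim: "(\<lambda>n. norm (primal_error n) + norm (?\<Gamma> n) + C * norm (a n - x n) + B * norm (bs n - vs n)) \<longlonglongrightarrow> 0"
    by simp
  have "norm (ts n) \<le> norm (primal_error n) + norm (?\<Gamma> n) + C * norm (a n - x n) + B * norm (bs n - vs n)" for n
  proof -
    have split: "ts n = primal_error n + ?\<Gamma> n + (GG (a n) - GG (x n)) + Adj (bs n - vs n)"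
      by (simp add: ts_eq primal_error_def Adj_diff)
    have "norm (ts n) \<le> norm (primal_error n) + norm (?\<Gamma> n) + norm (GG (a n) - GG (x n)) + norm (Adj (bs n - vs n))" unfolding split
      by (meson add_right_mono norm_triangle_ineq order_trans)
    also have "\<dots> \<le> norm (primal_error n) + norm (?\<Gamma> n) + C * norm (a n - x n) + B * norm (bs n - vs n)"
      by (intro add_mono order_refl C B ab_in x_in)
    finally show ?thesis .
  qed
  then show "(\<lambda>n. norm (ts n)) \<longlonglongrightarrow> 0" by (intro tendsto_sandwich[OF _ _ tendsto_const lim]) auto
qed

lemma cluster_point_KT:
  assumes k: "strict_mono k" and l: "l \<in> DH \<times> DG" and weak: "weakly_converges_on (DH \<times> DG) (z \<circ> k) l"
  shows "l \<in> KT"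
proof -
  obtain y w where yw: "l = (y, w)" "y \<in> DH" "w \<in> DG" using l by auto
  obtain M where M: "\<And>n. norm (a n) \<le> M" "\<And>n. norm (bs n) \<le> M" by (rule updates_bounded) blast
  have sub0: "(\<lambda>n. norm (u (k n))) \<longlonglongrightarrow> 0" if "(\<lambda>n. norm (u n)) \<longlonglongrightarrow> 0" for u :: "nat \<Rightarrow> 'b::real_normed_vector"
    using LIMSEQ_subseq_LIMSEQ[OF that k] by (simp add: o_def)
  have xk: "weakly_converges_on DH (\<lambda>n. x (k n)) y" and vk: "weakly_converges_on DG (\<lambda>n. vs (k n)) w"
    using weakly_converges_on_Times[OF weak DH(1) DG(1)] by (simp_all add: z_def yw)
  have ak: "weakly_converges_on DH (\<lambda>n. a (k n)) y"
    by (rule weakly_converges_on_add_null[OF xk])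
      (rule tendsto_norm_zero_cancel[OF sub0[OF residuals_null(1)]])
  have bk: "weakly_converges_on DG (\<lambda>n. bs (k n)) w"
    by (rule weakly_converges_on_add_null[OF vk])
      (rule tendsto_norm_zero_cancel[OF sub0[OF dual_gap_null]])
  show ?thesis
    unfolding yw(1)
  proof (rule KT_demiclosed[OF ab_in Phi_sub yw(2,3) ak bk M])
    show "(\<lambda>n. norm (as (k n) + GG (a (k n)) + Adj (bs (k n)))) \<longlonglongrightarrow> 0"
      using sub0[OF normals_null(2)] by (simp add: ts_eq)
    show "(\<lambda>n. norm (b (k n) - LL (a (k n)))) \<longlonglongrightarrow> 0"
      using sub0[OF normals_null(1)] by (simp add: t_eq)
  qed
qed

lemma weak_convergence: "\<exists>xsol. nash_solution \<H> \<phi> f g L xsol \<and> weakly_converges_on (direct_sum \<H>) x xsol"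
proof -
  have "\<exists>l\<in>KT. weakly_converges_on (DH \<times> DG) z l"
    by (rule Opial[OF DHG z_in _ dist_KT_convergent cluster_point_KT]) (use KT_bar in auto)
  then obtain y w where yw: "(y, w) \<in> KT" "weakly_converges_on (DH \<times> DG) z (y, w)" by auto
  have "weakly_converges_on DH x y"
    using weakly_converges_on_Times(1)[OF yw(2) DH(1) DG(1)] by (simp add: z_def)
  with KT_nash[OF yw(1)] show ?thesis by blast
qed

end

section \<open>Weak convergence to an equilibrium\<close>

theorem theorem5p1:
  fixes \<H> :: "'i::finite \<Rightarrow> 'h::{real_inner, complete_space} set"
    and \<G> :: "'k::finite \<Rightarrow> 'g::{real_inner, complete_space} set"
    and \<phi> :: "'i \<Rightarrow> 'h \<Rightarrow> ereal"
    and f :: "'i \<Rightarrow> 'h ^ 'i \<Rightarrow> real"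
    and g :: "'k \<Rightarrow> 'g \<Rightarrow> ereal"
    and L :: "'k \<Rightarrow> 'h ^ 'i \<Rightarrow> 'g"
    and chi :: "'i \<Rightarrow> real"
    and \<alpha> \<epsilon> :: real
    and lam :: "nat \<Rightarrow> real"
    and D :: nat
    and \<gamma> :: "'i \<Rightarrow> nat \<Rightarrow> real"
    and \<mu> :: "'k \<Rightarrow> nat \<Rightarrow> real"
    and c :: "'i \<Rightarrow> nat \<Rightarrow> nat"
    and d :: "'k \<Rightarrow> nat \<Rightarrow> nat"
    and In :: "nat \<Rightarrow> 'i set"
    and Kn :: "nat \<Rightarrow> 'k set"
    and x xs a as ts :: "nat \<Rightarrow> 'h ^ 'i"
    and vs ys b bs t :: "nat \<Rightarrow> 'g ^ 'k"
    and p step :: "nat \<Rightarrow> real"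
  assumes hilbert_H: "\<And>i. subspace (\<H> i)" "\<And>i. closed (\<H> i)"
    and hilbert_G: "\<And>k. subspace (\<G> k)" "\<And>k. closed (\<G> k)"
    and phi: "\<And>i. \<phi> i \<in> Gamma0 (\<H> i)"
    and f_convex: "\<And>i y. y \<in> direct_sum \<H> \<Longrightarrow> convex_on (\<H> i) (\<lambda>z. f i (replace i z y))"
    and f_diff: "\<And>i y. y \<in> direct_sum \<H> \<Longrightarrow> (\<lambda>z. f i (replace i z y)) differentiable_on (\<H> i)"
    and G_monotone: "monotone_operator_on (direct_sum \<H>) (gradient_operator \<H> f)"
    and G_lipschitz: "\<exists>C. lipschitz_on C (direct_sum \<H>) (gradient_operator \<H> f)"
    and g: "\<And>k. g k \<in> Gamma0 (\<G> k)"
    and L: "\<And>k. bounded_linear_between (direct_sum \<H>) (\<G> k) (L k)"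
    and chi_nonneg: "\<And>i. 0 \<le> chi i"
    and chi: "\<And>y z. y \<in> direct_sum \<H> \<Longrightarrow> z \<in> direct_sum \<H> \<Longrightarrow>
        (y - z) \<bullet> (gradient_operator \<H> f y - gradient_operator \<H> f z)
          \<le> (\<Sum>i\<in>UNIV. chi i * (norm (y $ i - z $ i))\<^sup>2)"
    and alpha: "0 < \<alpha>"
    and eps: "0 < \<epsilon>" "\<epsilon> < 1" "1 / \<epsilon> > \<alpha> + Max (range chi)"
    and lam: "\<And>n. lam n \<in> {\<epsilon>..2 - \<epsilon>}"
    and kuhn_tucker: "\<exists>xbar\<in>direct_sum \<H>. \<exists>vbar\<in>direct_sum \<G>.
        (\<forall>i. - partial_gradient \<H> f i xbar
              - (\<Sum>k\<in>UNIV. adjoint_on (direct_sum \<H>) (L k) (vbar $ k) $ i)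
            \<in> subdifferential (\<H> i) (\<phi> i) (xbar $ i)) \<and>
        (\<forall>k. L k xbar \<in> subdifferential (\<G> k) (fenchel_conjugate (\<G> k) (g k)) (vbar $ k))"
    and x_init: "\<And>i. x 0 $ i \<in> \<H> i"
    and gamma: "\<And>i n. \<gamma> i n \<in> {\<epsilon>..1 / (chi i + \<alpha>)}"
    and c_delay: "\<And>i n. int n - int D \<le> int (c i n) \<and> c i n \<le> n"
    and vs_init: "\<And>k. vs 0 $ k \<in> \<G> k"
    and mu: "\<And>k n. \<mu> k n \<in> {\<alpha>..1 / \<epsilon>}"
    and d_delay: "\<And>k n. int n - int D \<le> int (d k n) \<and> d k n \<le> n"
    and activation_nonempty: "\<And>n. In n \<noteq> {}" "\<And>n. Kn n \<noteq> {}"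
    and activation_0: "In 0 = UNIV" "Kn 0 = UNIV"
    and activation_sweep: "\<exists>m. \<forall>n. (\<Union>j\<in>{n..n + m}. In j) = UNIV \<and> (\<Union>j\<in>{n..n + m}. Kn j) = UNIV"
    and xs: "\<And>n i. i \<in> In n \<Longrightarrow>
        xs n $ i = x (c i n) $ i - \<gamma> i (c i n) *\<^sub>R
          (partial_gradient \<H> f i (x (c i n))
            + (\<Sum>k\<in>UNIV. adjoint_on (direct_sum \<H>) (L k) (vs (c i n) $ k) $ i))"
    and a: "\<And>n i. i \<in> In n \<Longrightarrow>
        a n $ i = prox (\<H> i) (\<lambda>z. ereal (\<gamma> i (c i n)) * \<phi> i z) (xs n $ i)"
    and as: "\<And>n i. i \<in> In n \<Longrightarrow> as n $ i = inverse (\<gamma> i (c i n)) *\<^sub>R (xs n $ i - a n $ i)"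
    and a_keep: "\<And>n i. i \<notin> In n \<Longrightarrow> a n $ i = a (n - 1) $ i \<and> as n $ i = as (n - 1) $ i"
    and ys: "\<And>n k. k \<in> Kn n \<Longrightarrow>
        ys n $ k = \<mu> k (d k n) *\<^sub>R (vs (d k n) $ k) + L k (x (d k n))"
    and b: "\<And>n k. k \<in> Kn n \<Longrightarrow>
        b n $ k = prox (\<G> k) (\<lambda>z. ereal (\<mu> k (d k n)) * g k z) (ys n $ k)"
    and bs: "\<And>n k. k \<in> Kn n \<Longrightarrow> bs n $ k = inverse (\<mu> k (d k n)) *\<^sub>R (ys n $ k - b n $ k)"
    and b_keep: "\<And>n k. k \<notin> Kn n \<Longrightarrow> b n $ k = b (n - 1) $ k \<and> bs n $ k = bs (n - 1) $ k"
    and ts: "\<And>n. ts n = as n + gradient_operator \<H> f (a n)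
        + adjoint_on (direct_sum \<H>) (\<lambda>y. \<chi> k. L k y) (bs n)"
    and t: "\<And>n. t n = b n - (\<chi> k. L k (a n))"
    and p: "\<And>n. p n = (a n - x n) \<bullet> ts n + t n \<bullet> (bs n - vs n)"
    and step: "\<And>n. p n < 0 \<Longrightarrow>
        step n = lam n * p n / ((norm (t n))\<^sup>2 + (norm (ts n))\<^sup>2) \<and>
        x (Suc n) = x n + step n *\<^sub>R ts n \<and> vs (Suc n) = vs n + step n *\<^sub>R t n"
    and no_step: "\<And>n. \<not> p n < 0 \<Longrightarrow> x (Suc n) = x n \<and> vs (Suc n) = vs n"
  shows "\<exists>xsol. nash_solution \<H> \<phi> f g L xsol \<and> weakly_converges_on (direct_sum \<H>) x xsol"
proof -
  obtain m where m: "\<And>n. (\<Union>j\<in>{n..n + m}. In j) = UNIV" "\<And>n. (\<Union>j\<in>{n..n + m}. Kn j) = UNIV"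
    using activation_sweep by blast
  obtain xbar vbar where bar: "xbar \<in> direct_sum \<H>" "vbar \<in> direct_sum \<G>"
    "\<And>i. - partial_gradient \<H> f i xbar
        - (\<Sum>k\<in>UNIV. adjoint_on (direct_sum \<H>) (L k) (vbar $ k) $ i) \<in> subdifferential (\<H> i) (\<phi> i) (xbar $ i)"
    "\<And>k. L k xbar \<in> subdifferential (\<G> k) (fenchel_conjugate (\<G> k) (g k)) (vbar $ k)"
    using kuhn_tucker by blast
  interpret nash_algorithm \<H> \<G> \<phi> f g L chi \<alpha> \<epsilon> lam D m \<gamma> \<mu> c d In Kn xbar vbar
    x xs a as ts vs ys b bs t p step
    by (unfold_locales; fact hilbert_H hilbert_G phi f_convex f_diff G_monotone G_lipschitz g L chi_nonneg chi alpha
        eps(1) lam bar x_init gamma c_delay vs_init mu d_delay activation_0 m xs a as a_keep ys b bs b_keep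
        ts t p step no_step)
  show ?thesis by (rule weak_convergence)
qed

end
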